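(* Let $K$ be an algebraically closed field of characteristic $0$ and let $F\in\bar S_3$ be a general smooth cubic form in four variables, where $\bar S=K_{\mathsf{dp}}[x_0,x_1,x_2,x_3]$. Then the local cactus rank of $F$ is $7$. For every (nonzero) linear form $l\in\bar S_1$, the apolar scheme of the dehomogenization $\pi_{[l]}(F)$ has length $8$, while if $\{l=0\}$ defines a singular curve section of $V(F)\subset\mathbb{P}(\bar T_1)$ whose tangent cone at the singular point is a square, then there is a length $7$ scheme supported at $[l]\in\mathbb{P}(\bar S_1)$ that is apolar to $F$.
   Context: "General" means that $F$ lies in a suitable nonempty Zariski open subset of $\mathbb{P}(\bar S_3)$. $\bar S=K_{\mathsf{dp}}[x_0,\ldots,x_3]$ is the divided power ring ($x^\beta$ denotes a divided power monomial), and $\bar T=K[y_0,\ldots,y_3]$ acts on it by contraction: $y^\alpha(x^\beta)=x^{\beta-\alpha}$ if $\beta\ge\alpha$ componentwise and $0$ otherwise. The cubic surface is $V(F)=\{[\Psi]\in\mathbb{P}(\bar T_1):\Psi^3(F)=0\}$, and $l\in\bar S_1$ defines the plane $\{l=0\}\subset\mathbb{P}(\bar T_1)$; the plane section is $V(F,l)$, and its tangent cone at a singular point being a square means that it is defined in the plane by the square of a linear form. $\bar T$ is the homogeneous coordinate ring of $\mathbb{P}(\bar S_1)$. A subscheme $Z\subset\mathbb{P}(\bar S_1)$ is apolar to $F$ if its homogeneous (saturated) ideal $I_Z\subset\bar T$ is contained in $F^\perp=\{\Psi\in\bar T:\Psi(F)=0\}$. The local cactus rank of $F$ is the minimal length of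 a local scheme (zero-dimensional scheme supported at one point) of $\mathbb{P}(\bar S_1)$ apolar to $F$. For nonzero $l\in\bar S_1$, complete $l$ to a basis $l,l_1,l_2,l_3$ of $\bar S_1$ with dual basis $l',l_1',l_2',l_3'$ of $\bar T_1$; $\pi_{[l]}:\bar S\to K_{\mathsf{dp}}[l_1,l_2,l_3]$ is the dehomogenization, i.e. the $K$-linear map sending the divided power monomial $l^{\alpha_0}l_1^{\alpha_1}l_2^{\alpha_2}l_3^{\alpha_3}$ to $l_1^{\alpha_1}l_2^{\alpha_2}l_3^{\alpha_3}$. The apolar scheme of $f\in K_{\mathsf{dp}}[l_1,l_2,l_3]$ is $\operatorname{Spec}(K[l_1',l_2',l_3']/f^\perp)$, where $f^\perp$ is the annihilator of $f$ under contraction. *)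

theory Defs
  imports
    "HOL-Library.Poly_Mapping"
    "HOL-Library.Numeral_Type"
    "HOL-Computational_Algebra.Polynomial"
begin

section \<open>Polynomials and divided power polynomials\<close>

text \<open>
  A monomial in variables indexed by \<open>'i\<close> is its exponent vector. The type
  \<open>('i, 'k) mpoly\<close> carries the polynomial multiplication \<open>*\<close> of the library. The type
  \<open>('i, 'k) dpoly\<close> consists of the same finitely supported functions, where the coefficient at
  \<open>\<beta>\<close> now belongs to the divided power monomial \<open>x\<^sup>[\<beta>]\<close>; its product is \<open>dp_mult\<close>, never \<open>*\<close>.
  The type \<open>4\<close> has the elements 0, 1, 2, 3.
\<close>

type_synonym 'i mon = "'i \<Rightarrow>\<^sub>0 nat"
type_synonym ('i, 'k) mpoly = "'i mon \<Rightarrow>\<^sub>0 'k"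
type_synonym ('i, 'k) dpoly = "'i mon \<Rightarrow>\<^sub>0 'k"

definition smul :: "'k::field \<Rightarrow> ('x \<Rightarrow>\<^sub>0 'k) \<Rightarrow> ('x \<Rightarrow>\<^sub>0 'k)" where
  "smul c p = Poly_Mapping.map ((*) c) p"

lemma lookup_smul [simp]: "Poly_Mapping.lookup (smul c p) x = c * Poly_Mapping.lookup p x"
  by (simp add: smul_def Poly_Mapping.map.rep_eq when_def)

interpretation K_space: vector_space "smul :: 'k::field \<Rightarrow> ('x \<Rightarrow>\<^sub>0 'k) \<Rightarrow> _"
  by unfold_locales (auto intro!: poly_mapping_eqI simp: lookup_add algebra_simps)

definition mdeg :: "'i mon \<Rightarrow> nat" where
  "mdeg m = (\<Sum>i\<in>Poly_Mapping.keys m. Poly_Mapping.lookup m i)"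

definition homog :: "nat \<Rightarrow> ('i mon \<Rightarrow>\<^sub>0 'k::field) set" where
  "homog d = {p. \<forall>m\<in>Poly_Mapping.keys p. mdeg m = d}"

definition hom_comp :: "nat \<Rightarrow> ('i mon \<Rightarrow>\<^sub>0 'k::field) \<Rightarrow> ('i mon \<Rightarrow>\<^sub>0 'k)" where
  "hom_comp d p =
    (\<Sum>m | m \<in> Poly_Mapping.keys p \<and> mdeg m = d.
       Poly_Mapping.single m (Poly_Mapping.lookup p m))"

definition eval_mpoly :: "('i \<Rightarrow> 'k) \<Rightarrow> ('i, 'k::field) mpoly \<Rightarrow> 'k" where
  "eval_mpoly a p =
    (\<Sum>m\<in>Poly_Mapping.keys p. Poly_Mapping.lookup p m *
       (\<Prod>i\<in>Poly_Mapping.keys m. a i ^ Poly_Mapping.lookup m i))"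

definition lin_coeff :: "('i mon \<Rightarrow>\<^sub>0 'k::field) \<Rightarrow> 'i \<Rightarrow> 'k" where
  "lin_coeff l i = Poly_Mapping.lookup l (Poly_Mapping.single i 1)"

definition dp_mult :: "('i::finite, 'k::field) dpoly \<Rightarrow> ('i, 'k) dpoly \<Rightarrow> ('i, 'k) dpoly" where
  "dp_mult F G =
    (\<Sum>\<alpha>\<in>Poly_Mapping.keys F. \<Sum>\<beta>\<in>Poly_Mapping.keys G.
       Poly_Mapping.single (\<alpha> + \<beta>)
         (of_nat (\<Prod>i\<in>UNIV. (Poly_Mapping.lookup \<alpha> i + Poly_Mapping.lookup \<beta> i)
                              choose Poly_Mapping.lookup \<alpha> i)
          * Poly_Mapping.lookup F \<alpha> * Poly_Mapping.lookup G \<beta>))"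

text \<open>
  The divided power \<open>l\<^sup>[n]\<close> of a linear form \<open>l = \<Sum>i. c i * x i\<close>, expanded by the rules
  \<open>(u + v)\<^sup>[n] = (\<Sum>k\<le>n. u\<^sup>[k] v\<^sup>[n-k])\<close> and \<open>(c u)\<^sup>[n] = c\<^sup>n u\<^sup>[n]\<close>.
\<close>

definition dp_power :: "('i::finite, 'k::field) dpoly \<Rightarrow> nat \<Rightarrow> ('i, 'k) dpoly" where
  "dp_power l n =
    (\<Sum>\<beta> | mdeg \<beta> = n.
       Poly_Mapping.single \<beta> (\<Prod>i\<in>UNIV. lin_coeff l i ^ Poly_Mapping.lookup \<beta> i))"

definition contract :: "('i, 'k::field) mpoly \<Rightarrow> ('i, 'k) dpoly \<Rightarrow> ('i, 'k) dpoly" where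
  "contract p F =
    (\<Sum>\<alpha>\<in>Poly_Mapping.keys p. \<Sum>\<beta>\<in>Poly_Mapping.keys F.
       if \<forall>i. Poly_Mapping.lookup \<alpha> i \<le> Poly_Mapping.lookup \<beta> i
       then Poly_Mapping.single (\<beta> - \<alpha>) (Poly_Mapping.lookup p \<alpha> * Poly_Mapping.lookup F \<beta>)
       else 0)"

text \<open>
  For \<open>p\<close> and \<open>F\<close> homogeneous of the same degree, \<open>contract p F\<close> is a constant, and this is
  its value as an element of the field.
\<close>

definition pairing :: "('i, 'k::field) mpoly \<Rightarrow> ('i, 'k) dpoly \<Rightarrow> 'k" where
  "pairing p F = Poly_Mapping.lookup (contract p F) 0"

text \<open>\<open>quot_dim V W n\<close>: the residue classes of some \<open>n\<close> elements of \<open>V\<close> form a basis of \<open>V / (V \<inter> W)\<close>.\<close>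

definition quot_dim :: "('x \<Rightarrow>\<^sub>0 'k::field) set \<Rightarrow> ('x \<Rightarrow>\<^sub>0 'k) set \<Rightarrow> nat \<Rightarrow> bool" where
  "quot_dim V W n \<longleftrightarrow>
    (\<exists>B\<subseteq>V. finite B \<and> card B = n \<and>
       (\<forall>v\<in>V. \<exists>!c. (\<forall>b. b \<notin> B \<longrightarrow> c b = 0) \<and> v - (\<Sum>b\<in>B. smul (c b) b) \<in> W))"

section \<open>General forms\<close>

text \<open>
  A subset of the projective space of degree \<open>d\<close> forms is represented by the set of nonzero
  representatives of its points. The polynomials defining the complement have the coefficients
  of the form as variables; variables for monomials of degree other than \<open>d\<close> evaluate to 0.
\<close>

definition zariski_open_forms :: "nat \<Rightarrow> ('i, 'k::field) dpoly set \<Rightarrow> bool" where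
  "zariski_open_forms d U \<longleftrightarrow>
    (\<exists>E :: ('i mon, 'k) mpoly set. (\<forall>P\<in>E. \<exists>e. P \<in> homog e) \<and>
       U = {F \<in> homog d. F \<noteq> 0 \<and> (\<exists>P\<in>E. eval_mpoly (Poly_Mapping.lookup F) P \<noteq> 0)})"

section \<open>The cubic surface and its plane sections\<close>

definition cubic_surface :: "(4, 'k::field) dpoly \<Rightarrow> (4, 'k) mpoly set" where
  "cubic_surface F = {\<Psi> \<in> homog 1. \<Psi> \<noteq> 0 \<and> contract (\<Psi> ^ 3) F = 0}"

definition plane :: "(4, 'k::field) dpoly \<Rightarrow> (4, 'k) mpoly set" where
  "plane l = {\<Psi> \<in> homog 1. pairing \<Psi> l = 0}"

text \<open>
  The degree \<open>k\<close> homogeneous part, as a function of the displacement \<open>\<Phi>\<close>, of the Taylor expansion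
  at \<open>\<Psi>\<close> of the equation \<open>\<Psi> \<mapsto> \<Psi>\<^sup>3(F)\<close>; see \<open>taylor_expansion\<close> below.
\<close>

definition taylor_part ::
    "nat \<Rightarrow> (4, 'k::field) dpoly \<Rightarrow> (4, 'k) mpoly \<Rightarrow> (4, 'k) mpoly \<Rightarrow> 'k" where
  "taylor_part k F \<Psi> \<Phi> = of_nat (3 choose k) * pairing (\<Psi> ^ (3 - k) * \<Phi> ^ k) F"

definition smooth_cubic :: "(4, 'k::field) dpoly \<Rightarrow> bool" where
  "smooth_cubic F \<longleftrightarrow>
    F \<in> homog 3 \<and> (\<forall>\<Psi>\<in>cubic_surface F. \<exists>\<Phi>\<in>homog 1. taylor_part 1 F \<Psi> \<Phi> \<noteq> 0)"

definition section_singular_at ::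
    "(4, 'k::field) dpoly \<Rightarrow> (4, 'k) dpoly \<Rightarrow> (4, 'k) mpoly \<Rightarrow> bool" where
  "section_singular_at F l \<Psi> \<longleftrightarrow>
    \<Psi> \<in> cubic_surface F \<inter> plane l \<and> (\<forall>\<Phi>\<in>plane l. taylor_part 1 F \<Psi> \<Phi> = 0)"

text \<open>
  At a singular point of the section, the tangent cone is given by the first Taylor part that
  does not vanish on the plane. If it is the square of a linear form, that linear form is nonzero
  on the plane and the part in question has degree 2.
\<close>

definition tangent_cone_square ::
    "(4, 'k::field) dpoly \<Rightarrow> (4, 'k) dpoly \<Rightarrow> (4, 'k) mpoly \<Rightarrow> bool" where
  "tangent_cone_square F l \<Psi> \<longleftrightarrow>
    (\<exists>m\<in>homog 1. (\<exists>\<Phi>\<in>plane l. pairing \<Phi> m \<noteq> 0) \<and>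
       (\<forall>\<Phi>\<in>plane l. taylor_part 2 F \<Psi> \<Phi> = (pairing \<Phi> m)\<^sup>2))"

section \<open>Local apolar schemes\<close>

definition poly_ideal :: "('i, 'k::field) mpoly set \<Rightarrow> bool" where
  "poly_ideal I \<longleftrightarrow> 0 \<in> I \<and> (\<forall>p\<in>I. \<forall>q\<in>I. p + q \<in> I) \<and> (\<forall>p\<in>I. \<forall>q. q * p \<in> I)"

definition homogeneous_ideal :: "('i, 'k::field) mpoly set \<Rightarrow> bool" where
  "homogeneous_ideal I \<longleftrightarrow> poly_ideal I \<and> (\<forall>p\<in>I. \<forall>d. hom_comp d p \<in> I)"

definition saturated :: "('i, 'k::field) mpoly set \<Rightarrow> bool" where
  "saturated I \<longleftrightarrow> (\<forall>p. (\<exists>n. \<forall>q\<in>homog n. q * p \<in> I) \<longrightarrow> p \<in> I)"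

text \<open>
  Closed subschemes of the projective space of lines in the linear forms of \<open>dpoly\<close> are
  represented by their saturated homogeneous ideals. A point \<open>[m]\<close> has the coefficients of \<open>m\<close> as
  homogeneous coordinates. A scheme supported at a single point is zero-dimensional.
\<close>

definition local_scheme_at :: "(4, 'k::field) dpoly \<Rightarrow> (4, 'k) mpoly set \<Rightarrow> bool" where
  "local_scheme_at l I \<longleftrightarrow>
    homogeneous_ideal I \<and> saturated I \<and>
    {m \<in> homog 1. m \<noteq> 0 \<and> (\<forall>p\<in>I. eval_mpoly (lin_coeff m) p = 0)} = {smul c l |c. c \<noteq> 0}"

text \<open>
  The length of a zero-dimensional projective scheme is the constant value of its Hilbert
  polynomial.
\<close>

definition scheme_length :: "(4, 'k::field) mpoly set \<Rightarrow> nat \<Rightarrow> bool" where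
  "scheme_length I r \<longleftrightarrow> (\<exists>d0. \<forall>d\<ge>d0. quot_dim (homog d) I r)"

definition apolar :: "(4, 'k::field) mpoly set \<Rightarrow> (4, 'k) dpoly \<Rightarrow> bool" where
  "apolar I F \<longleftrightarrow> I \<subseteq> {p. contract p F = 0}"

definition local_cactus_rank :: "(4, 'k::field) dpoly \<Rightarrow> nat" where
  "local_cactus_rank F =
    (LEAST r. \<exists>l\<in>homog 1. l \<noteq> 0 \<and>
       (\<exists>I. local_scheme_at l I \<and> scheme_length I r \<and> apolar I F))"

section \<open>Dehomogenization\<close>

definition linear_basis :: "(4 \<Rightarrow> (4, 'k::field) dpoly) \<Rightarrow> bool" where
  "linear_basis B \<longleftrightarrow>
    inj B \<and> K_space.independent (range B) \<and> K_space.span (range B) = homog 1"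

definition dp_monomial :: "(4 \<Rightarrow> (4, 'k::field) dpoly) \<Rightarrow> 4 mon \<Rightarrow> (4, 'k) dpoly" where
  "dp_monomial B \<alpha> =
    dp_mult (dp_power (B 0) (Poly_Mapping.lookup \<alpha> 0))
     (dp_mult (dp_power (B 1) (Poly_Mapping.lookup \<alpha> 1))
       (dp_mult (dp_power (B 2) (Poly_Mapping.lookup \<alpha> 2))
         (dp_power (B 3) (Poly_Mapping.lookup \<alpha> 3))))"

text \<open>
  Dehomogenization with respect to \<open>B 0\<close>. The target, the divided power ring in \<open>B 1\<close>, \<open>B 2\<close>,
  \<open>B 3\<close>, is represented by the divided power polynomials not involving the variable 0, the
  variable \<open>j\<close> standing for \<open>B j\<close>. Accordingly, \<open>affine_ring\<close> is the polynomial ring in the dual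
  basis elements of index 1, 2, 3. The map is uniquely determined since the divided power
  monomials in \<open>B\<close> form a basis of the divided power ring.
\<close>

definition dehomogenize :: "(4 \<Rightarrow> (4, 'k::field) dpoly) \<Rightarrow> (4, 'k) dpoly \<Rightarrow> (4, 'k) dpoly" where
  "dehomogenize B =
    (THE \<pi>. Vector_Spaces.linear smul smul \<pi> \<and>
       (\<forall>\<alpha>. \<pi> (dp_monomial B \<alpha>) =
          Poly_Mapping.single (\<alpha> - Poly_Mapping.single 0 (Poly_Mapping.lookup \<alpha> 0)) 1))"

definition affine_ring :: "(4, 'k::field) mpoly set" where
  "affine_ring = {p. \<forall>m\<in>Poly_Mapping.keys p. Poly_Mapping.lookup m 0 = 0}"

definition affine_apolar_length :: "(4, 'k::field) dpoly \<Rightarrow> nat \<Rightarrow> bool" where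
  "affine_apolar_length f n \<longleftrightarrow>
    quot_dim affine_ring {p \<in> affine_ring. contract p f = 0} n"

section \<open>The Taylor expansion of the equation of the surface\<close>

lemma contract_cover:
  assumes "finite A" "Poly_Mapping.keys p \<subseteq> A"
  shows "contract p F =
    (\<Sum>\<alpha>\<in>A. \<Sum>\<beta>\<in>Poly_Mapping.keys F.
       if \<forall>i. Poly_Mapping.lookup \<alpha> i \<le> Poly_Mapping.lookup \<beta> i
       then Poly_Mapping.single (\<beta> - \<alpha>) (Poly_Mapping.lookup p \<alpha> * Poly_Mapping.lookup F \<beta>)
       else 0)"
  unfolding contract_def
  by (rule sum.mono_neutral_left[OF assms]) (auto simp: in_keys_iff intro!: sum.neutral)

lemma contract_add: "contract (p + q) F = contract p F + contract q F"
proof -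
  let ?A = "Poly_Mapping.keys p \<union> Poly_Mapping.keys q"
  have A: "finite ?A" "Poly_Mapping.keys p \<subseteq> ?A" "Poly_Mapping.keys q \<subseteq> ?A"
    "Poly_Mapping.keys (p + q) \<subseteq> ?A"
    using Poly_Mapping.keys_add[of p q] by auto
  show ?thesis
    unfolding contract_cover[OF A(1,2)] contract_cover[OF A(1,3)] contract_cover[OF A(1,4)]
      sum.distrib[symmetric]
    by (intro sum.cong refl) (simp add: lookup_add single_add algebra_simps)
qed

lemma contract_smul: "contract (smul c p) F = smul c (contract p F)"
proof -
  have sub: "Poly_Mapping.keys (smul c p) \<subseteq> Poly_Mapping.keys p"
    by (auto simp: in_keys_iff)
  have single: "smul c (Poly_Mapping.single x a) = Poly_Mapping.single x (c * a)" for x :: "'a mon" and a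
    by (rule poly_mapping_eqI) (simp add: lookup_single when_def)
  show ?thesis
    unfolding contract_cover[OF finite_keys sub] unfolding contract_def K_space.scale_sum_right
    by (intro sum.cong refl) (simp add: single algebra_simps)
qed

lemma taylor_expansion:
  "pairing ((\<Psi> + smul t \<Phi>) ^ 3) F = (\<Sum>k\<le>3. t ^ k * taylor_part k F \<Psi> \<Phi>)"
proof -
  have smul_conv: "smul c p = Poly_Mapping.single 0 c * p" for c and p :: "(4, 'a) mpoly"
    by (simp add: smul_def mult_map_scale_conv_mult)
  have "(\<Psi> + smul t \<Phi>) ^ 3 =
      \<Psi> ^ 3 + smul (3 * t) (\<Psi> ^ 2 * \<Phi>) + smul (3 * t ^ 2) (\<Psi> * \<Phi> ^ 2) + smul (t ^ 3) (\<Phi> ^ 3)"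
  proof -
    have 3: "Poly_Mapping.single 0 (3 * a) = 3 * (Poly_Mapping.single 0 a :: (4, 'a) mpoly)" for a
      using mult_single[of "0 :: 4 mon" 3 0 a] by simp
    have pow: "Poly_Mapping.single 0 (t ^ n) = (Poly_Mapping.single 0 t :: (4, 'a) mpoly) ^ n" for n
      by (induction n) (auto simp: mult_single[of 0 _ 0, simplified, symmetric])
    show ?thesis
      unfolding smul_conv 3 pow by algebra
  qed
  then show ?thesis
    by (simp add: pairing_def contract_add contract_smul lookup_add taylor_part_def
        numeral_3_eq_3 numeral_2_eq_2 algebra_simps)
qed

end

theory Submission
  imports Defs "HOL-Analysis.Determinants"
begin

text \<open>
  A general cubic form satisfies neither of two conditions, and for a smooth cubic satisfying neither
  the three assertions hold. The first condition, \<open>eckardt\<close>, is that some plane section is a cone. The second,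
  \<open>curvilinear\<close>, is that the pairing with \<open>F\<close> factors through the restriction of cubic forms to a
  jet of length 6 of a smooth curve. Each is parametrized by 19 parameters, while cubic forms have 20
  coefficients, so counting monomials gives a nonzero polynomial in the coefficients that vanishes
  whenever one of the conditions holds (\<open>generic_not_eckardt_nor_curvilinear\<close>).

  \<^emph>\<open>Length 8.\<close> The dehomogenization \<open>f\<close> of \<open>F\<close> at \<open>l\<close> is a polynomial of degree 3 in three variables
  whose cubic part is the restriction of \<open>F\<close> to the plane \<open>l = 0\<close>. If this restriction is not a cone,
  \<open>f\<close>, its three first derivatives, three independent linear forms and 1 span all derivatives of \<open>f\<close>
  (\<open>dehomogenization_apolar_length\<close>).

  \<^emph>\<open>No scheme of length below 7.\<close> For a local scheme apolar to \<open>F\<close>, the pairing with \<open>F\<close> extends from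
  cubic forms to a functional \<open>\<phi>\<close> on the local algebra. Let \<open>m\<close> be the maximal ideal. Off the Eckardt
  condition, \<open>\<phi>\<close> and its products with the three linear forms of \<open>m\<close> are independent on \<open>m\<^sup>2\<close>. So
  \<open>m\<^sup>2\<close> has dimension at least 4, and if the length is at most 6, then \<open>m / m\<^sup>2\<close> has dimension at most 1.
  By Nakayama's lemma the algebra is generated by one element \<open>t\<close> with \<open>t\<^sup>6 = 0\<close>, and \<open>F\<close> is
  curvilinear (\<open>short_local_apolar_scheme_curvilinear\<close>).

  \<^emph>\<open>A scheme of length 7.\<close> Let the section by \<open>l\<close> be singular at \<open>u\<^sub>1\<close> with tangent cone a square. In
  adapted coordinates \<open>u\<^sub>0, u\<^sub>1, u\<^sub>2, u\<^sub>3\<close> with \<open>u\<^sub>0 = 1\<close>, the variable \<open>u\<^sub>1\<close> acts on cubic forms like a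
  polynomial \<open>\<zeta>\<close> in \<open>u\<^sub>2\<close> and \<open>u\<^sub>3\<close>, provided that a suitable value is given to \<open>u\<^sub>2\<^sup>4\<close>, which \<open>F\<close> does
  not prescribe. The apolar algebra of the resulting quartic polynomial in two variables has length 7
  (\<open>cuspidal_frame_apolar_scheme\<close>).

  \<^emph>\<open>Such sections exist.\<close> They are the tangent plane sections at the points where the surface meets
  its Hessian: there the quadratic part of the equation degenerates on the tangent plane to a multiple
  of a square, and it does not vanish off the Eckardt condition (\<open>exists_cuspidal_section\<close>). The
  intersection with the Hessian is not empty because two forms in four variables have a common zero
  (\<open>two_forms_common_zero\<close>), which follows from the projective Nullstellensatz.
\<close>

abbreviation "lookup \<equiv> Poly_Mapping.lookup"
abbreviation "single \<equiv> Poly_Mapping.single"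
abbreviation "keys \<equiv> Poly_Mapping.keys"

section \<open>Linear algebra\<close>

text \<open>
  Gaussian elimination: an unknown with a nonzero coefficient in the new equation is eliminated.
\<close>

lemma underdetermined_system:
  fixes m :: "'a \<Rightarrow> 'b \<Rightarrow> 'k::field"
  assumes "finite B" "finite A" "card B < card A"
  shows "\<exists>c. (\<exists>a\<in>A. c a \<noteq> 0) \<and> (\<forall>b\<in>B. (\<Sum>a\<in>A. c a * m a b) = 0)"
  using assms
proof (induction B arbitrary: A m rule: finite_induct)
  case empty
  then show ?case by (intro exI[of _ "\<lambda>_. 1"]) (auto simp: card_gt_0_iff)
next
  case (insert b B)
  show ?case
  proof (cases "\<forall>a\<in>A. m a b = 0")
    case True
    have "card B < card A" using insert by simp
    from insert.IH[OF insert.prems(1) this, of m] show ?thesis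
      using True by (auto intro!: sum.neutral)
  next
    case False
    then obtain a0 where a0: "a0 \<in> A" "m a0 b \<noteq> 0" by auto
    let ?A = "A - {a0}"
    let ?m = "\<lambda>a b'. m a b' - m a b / m a0 b * m a0 b'"
    have "card B < card ?A" using insert a0 by simp
    from insert.IH[of ?A ?m, OF _ this] insert.prems obtain c where
      c: "\<exists>a\<in>?A. c a \<noteq> 0" "\<And>b'. b' \<in> B \<Longrightarrow> (\<Sum>a\<in>?A. c a * ?m a b') = 0" by auto
    define s where "s = (\<Sum>a\<in>?A. c a * m a b) / m a0 b"
    define c' where "c' = c(a0 := - s)"
    have split: "(\<Sum>a\<in>A. c' a * m a b') = (\<Sum>a\<in>?A. c a * m a b') - s * m a0 b'" for b'
    proof -
      have "(\<Sum>a\<in>A. c' a * m a b') = c' a0 * m a0 b' + (\<Sum>a\<in>?A. c' a * m a b')"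
        using insert.prems a0 by (intro sum.remove) auto
      also have "(\<Sum>a\<in>?A. c' a * m a b') = (\<Sum>a\<in>?A. c a * m a b')"
        by (intro sum.cong) (auto simp: c'_def)
      finally show ?thesis by (simp add: c'_def)
    qed
    have "(\<Sum>a\<in>A. c' a * m a b) = 0"
      unfolding split using a0 by (simp add: s_def)
    moreover have "(\<Sum>a\<in>A. c' a * m a b') = 0" if "b' \<in> B" for b'
    proof -
      have "0 = (\<Sum>a\<in>?A. c a * m a b') - (\<Sum>a\<in>?A. c a * m a b / m a0 b * m a0 b')"
        using c(2)[OF that] by (simp add: algebra_simps sum_subtractf)
      then show ?thesis
        unfolding split s_def by (simp add: sum_divide_distrib sum_distrib_right)
    qed
    moreover have "\<exists>a\<in>A. c' a \<noteq> 0" using c(1) by (auto simp: c'_def)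
    ultimately show ?thesis by auto
  qed
qed

definition linear_form :: "(('x \<Rightarrow>\<^sub>0 'k::field) \<Rightarrow> 'k) \<Rightarrow> bool" where
  "linear_form f \<longleftrightarrow> (\<forall>u v. f (u + v) = f u + f v) \<and> (\<forall>c v. f (smul c v) = c * f v)"

lemma linear_form_add: "linear_form f \<Longrightarrow> f (u + v) = f u + f v"
  and linear_form_smul: "linear_form f \<Longrightarrow> f (smul c v) = c * f v"
  by (auto simp: linear_form_def)

lemma linear_form_0: "linear_form f \<Longrightarrow> f 0 = 0"
  using linear_form_smul[of f 0 0] by simp

lemma linear_form_minus: "linear_form f \<Longrightarrow> f (- u) = - f u"
  using linear_form_add[of f u "- u"] by (simp add: linear_form_0 eq_neg_iff_add_eq_0 add.commute)

lemma linear_form_diff: "linear_form f \<Longrightarrow> f (u - v) = f u - f v"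
  using linear_form_add[of f u "- v"] by (simp add: linear_form_minus)

lemma linear_form_sum: "linear_form f \<Longrightarrow> f (\<Sum>x\<in>A. g x) = (\<Sum>x\<in>A. f (g x))"
  by (induction A rule: infinite_finite_induct) (auto simp: linear_form_0 linear_form_add)

lemmas linear_form_simps =
  linear_form_add linear_form_smul linear_form_0 linear_form_minus linear_form_diff linear_form_sum

text \<open>
  If no vector were killed by the forms already treated but not by \<open>\<xi> s\<close>, then \<open>\<xi> s\<close> would be
  a combination of them; such a vector, normalised, extends the dual system.
\<close>

lemma dual_vectors:
  fixes \<xi> :: "'s \<Rightarrow> ('x \<Rightarrow>\<^sub>0 'k::field) \<Rightarrow> 'k"
  assumes "finite S" "K_space.subspace V" "\<And>s. s \<in> S \<Longrightarrow> linear_form (\<xi> s)"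
    and "\<And>c. (\<forall>v\<in>V. (\<Sum>s\<in>S. c s * \<xi> s v) = 0) \<Longrightarrow> \<forall>s\<in>S. c s = 0"
  shows "\<exists>w. \<forall>s\<in>S. w s \<in> V \<and> (\<forall>t\<in>S. \<xi> t (w s) = (if s = t then 1 else 0))"
  using assms
proof (induction S rule: finite_induct)
  case empty
  then show ?case by simp
next
  case (insert s S)
  note V = \<open>K_space.subspace V\<close>
  have indS: "\<forall>t\<in>S. c t = 0" if "\<forall>v\<in>V. (\<Sum>t\<in>S. c t * \<xi> t v) = 0" for c
  proof -
    have "\<forall>t\<in>insert s S. (c(s := 0)) t = 0"
    proof (rule insert.prems(3), rule ballI)
      fix v assume "v \<in> V"
      have "(\<Sum>t\<in>S. (c(s := 0)) t * \<xi> t v) = (\<Sum>t\<in>S. c t * \<xi> t v)"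
        using insert.hyps by (intro sum.cong) auto
      then show "(\<Sum>t\<in>insert s S. (c(s := 0)) t * \<xi> t v) = 0"
        using insert.hyps that \<open>v \<in> V\<close> by simp
    qed
    then show ?thesis using insert.hyps by (auto split: if_splits)
  qed
  obtain w where w: "\<And>t. t \<in> S \<Longrightarrow> w t \<in> V"
    "\<And>t r. t \<in> S \<Longrightarrow> r \<in> S \<Longrightarrow> \<xi> r (w t) = (if t = r then 1 else 0)"
    using insert.IH[OF V] insert.prems(2) indS by blast
  have lin: "linear_form (\<xi> t)" if "t \<in> insert s S" for t using insert.prems(2) that by blast
  have "\<exists>v\<in>V. (\<forall>t\<in>S. \<xi> t v = 0) \<and> \<xi> s v \<noteq> 0"
  proof (rule ccontr)
    assume neg: "\<not> ?thesis"
    let ?c = "\<lambda>t. if t = s then - 1 else \<xi> s (w t)"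
    have "\<forall>t\<in>insert s S. ?c t = 0"
    proof (rule insert.prems(3), rule ballI)
      fix v assume v: "v \<in> V"
      let ?u = "v - (\<Sum>t\<in>S. smul (\<xi> t v) (w t))"
      have "?u \<in> V"
        using v w by (intro K_space.subspace_diff K_space.subspace_sum K_space.subspace_scale V) auto
      moreover have "\<xi> t ?u = 0" if "t \<in> S" for t
      proof -
        have "\<xi> t ?u = \<xi> t v - (\<Sum>r\<in>S. \<xi> r v * \<xi> t (w r))"
          using that by (simp add: linear_form_simps lin)
        also have "(\<Sum>r\<in>S. \<xi> r v * \<xi> t (w r)) = (\<Sum>r\<in>S. if r = t then \<xi> r v else 0)"
          using that w by (intro sum.cong) auto
        finally show ?thesis using that insert.hyps by simp
      qed
      ultimately have "\<xi> s ?u = 0" using neg by blast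
      then have eq: "\<xi> s v = (\<Sum>t\<in>S. \<xi> t v * \<xi> s (w t))"
        by (simp add: linear_form_simps lin)
      have "(\<Sum>t\<in>S. ?c t * \<xi> t v) = (\<Sum>t\<in>S. \<xi> t v * \<xi> s (w t))"
        using insert.hyps by (intro sum.cong) auto
      then show "(\<Sum>t\<in>insert s S. ?c t * \<xi> t v) = 0"
        using insert.hyps eq by simp
    qed
    then show False by auto
  qed
  then obtain v0 where v0: "v0 \<in> V" "\<And>t. t \<in> S \<Longrightarrow> \<xi> t v0 = 0" "\<xi> s v0 \<noteq> 0" by blast
  define v where "v = smul (inverse (\<xi> s v0)) v0"
  have v: "v \<in> V" "\<And>t. t \<in> S \<Longrightarrow> \<xi> t v = 0" "\<xi> s v = 1"
    using v0 by (auto simp: v_def K_space.subspace_scale[OF V] linear_form_smul lin)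
  define w' where "w' t = (if t = s then v else w t - smul (\<xi> s (w t)) v)" for t
  have "w' t \<in> V" if "t \<in> insert s S" for t
    using that v w by (auto simp: w'_def intro!: K_space.subspace_diff K_space.subspace_scale V)
  moreover have "\<xi> r (w' t) = (if t = r then 1 else 0)" if "t \<in> insert s S" "r \<in> insert s S" for t r
    using that v w insert.hyps by (auto simp: w'_def linear_form_simps lin)
  ultimately show ?case by blast
qed

text \<open>
  Vectors dual to the forms \<open>\<xi> s\<close> represent a basis of the quotient, and the coefficients of \<open>v\<close> are
  the values \<open>\<xi> s v\<close>.
\<close>

lemma quot_dimI:
  fixes \<xi> :: "'s \<Rightarrow> ('x \<Rightarrow>\<^sub>0 'k::field) \<Rightarrow> 'k"
  assumes "finite S" "card S = n" "K_space.subspace V" "\<And>s. s \<in> S \<Longrightarrow> linear_form (\<xi> s)"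
    and "\<And>c. (\<forall>v\<in>V. (\<Sum>s\<in>S. c s * \<xi> s v) = 0) \<Longrightarrow> \<forall>s\<in>S. c s = 0"
    and W: "\<And>v. v \<in> V \<Longrightarrow> v \<in> W \<longleftrightarrow> (\<forall>s\<in>S. \<xi> s v = 0)"
  shows "quot_dim V W n"
proof -
  have "\<exists>w. \<forall>s\<in>S. w s \<in> V \<and> (\<forall>t\<in>S. \<xi> t (w s) = (if s = t then 1 else 0))"
    by (rule dual_vectors) (fact assms)+
  then obtain w where w: "\<And>t. t \<in> S \<Longrightarrow> w t \<in> V"
    "\<And>t r. t \<in> S \<Longrightarrow> r \<in> S \<Longrightarrow> \<xi> r (w t) = (if t = r then 1 else 0)"
    by blast
  have inj: "inj_on w S"
  proof (rule inj_onI)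
    fix s t assume "s \<in> S" "t \<in> S" "w s = w t"
    then show "s = t" by (metis w(2) zero_neq_one)
  qed
  let ?B = "w ` S"
  have val: "\<xi> t (v - (\<Sum>b\<in>?B. smul (c b) b)) = \<xi> t v - c (w t)" if "t \<in> S" for t c v
  proof -
    have "\<xi> t (v - (\<Sum>b\<in>?B. smul (c b) b)) = \<xi> t v - (\<Sum>s\<in>S. c (w s) * \<xi> t (w s))"
      using that by (simp add: linear_form_simps assms(4) sum.reindex[OF inj])
    also have "(\<Sum>s\<in>S. c (w s) * \<xi> t (w s)) = (\<Sum>s\<in>S. if s = t then c (w s) else 0)"
      using that w by (intro sum.cong) auto
    finally show ?thesis using that assms(1) by simp
  qed
  have inV: "v - (\<Sum>b\<in>?B. smul (c b) b) \<in> V" if "v \<in> V" for v c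
    using that w by (intro K_space.subspace_diff K_space.subspace_sum K_space.subspace_scale assms(3)) auto
  have "\<exists>!c. (\<forall>b. b \<notin> ?B \<longrightarrow> c b = 0) \<and> v - (\<Sum>b\<in>?B. smul (c b) b) \<in> W" if v: "v \<in> V" for v
  proof -
    have iff: "v - (\<Sum>b\<in>?B. smul (c b) b) \<in> W \<longleftrightarrow> (\<forall>s\<in>S. c (w s) = \<xi> s v)" for c
      unfolding W[OF inV[OF v]] by (rule ball_cong) (auto simp: val)
    let ?c = "\<lambda>b. if b \<in> ?B then \<xi> (the_inv_into S w b) v else 0"
    have "\<forall>s\<in>S. ?c (w s) = \<xi> s v" by (simp add: the_inv_into_f_f[OF inj])
    then show ?thesis unfolding iff
      by (intro ex1I[of _ ?c]) (use \<open>\<forall>s\<in>S. ?c (w s) = \<xi> s v\<close> in \<open>auto simp: fun_eq_iff\<close>)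
  qed
  then show ?thesis unfolding quot_dim_def
    using w(1) assms(1,2) card_image[OF inj] by (intro exI[of _ ?B]) auto
qed

text \<open>The coordinates of \<open>r + 1\<close> vectors modulo \<open>W\<close> are too many for \<open>r\<close> equations.\<close>

lemma quot_dim_dependent:
  fixes v :: "'a \<Rightarrow> ('x \<Rightarrow>\<^sub>0 'k::field)"
  assumes "quot_dim V W r" "finite A" "r < card A" "\<And>a. a \<in> A \<Longrightarrow> v a \<in> V" "K_space.subspace W"
  shows "\<exists>c. (\<exists>a\<in>A. c a \<noteq> 0) \<and> (\<Sum>a\<in>A. smul (c a) (v a)) \<in> W"
proof -
  obtain B where B: "finite B" "card B = r"
    and ex1: "\<forall>v\<in>V. \<exists>!c. (\<forall>b. b \<notin> B \<longrightarrow> c b = 0) \<and> v - (\<Sum>b\<in>B. smul (c b) b) \<in> W"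
    using assms(1) unfolding quot_dim_def by (elim exE conjE)
  have ex: "\<exists>c. v - (\<Sum>b\<in>B. smul (c b) b) \<in> W" if "v \<in> V" for v
    using ex1_implies_ex[OF bspec[OF ex1 that]] by (elim exE conjE) (rule exI)
  obtain m where m: "\<And>a. a \<in> A \<Longrightarrow> v a - (\<Sum>b\<in>B. smul (m a b) b) \<in> W"
    using ex[OF assms(4)] by metis
  obtain c where c: "\<exists>a\<in>A. c a \<noteq> 0" "\<forall>b\<in>B. (\<Sum>a\<in>A. c a * m a b) = 0"
    using underdetermined_system[OF B(1) assms(2), of m] B(2) assms(3) by auto
  have "(\<Sum>a\<in>A. smul (c a) (v a - (\<Sum>b\<in>B. smul (m a b) b))) \<in> W"
    using m by (intro K_space.subspace_sum K_space.subspace_scale assms(5))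
  also have "(\<Sum>a\<in>A. smul (c a) (v a - (\<Sum>b\<in>B. smul (m a b) b))) =
      (\<Sum>a\<in>A. smul (c a) (v a)) - (\<Sum>b\<in>B. smul (\<Sum>a\<in>A. c a * m a b) b)"
    by (simp add: K_space.scale_right_diff_distrib sum_subtractf K_space.scale_sum_right
        K_space.scale_sum_left sum.swap[of _ B A])
  finally show ?thesis using c by auto
qed

section \<open>Polynomials as a ring\<close>

definition const :: "'k::field \<Rightarrow> ('i, 'k) mpoly" where "const c = single 0 c"

definition var :: "'i \<Rightarrow> ('i, 'k::field) mpoly" where "var i = single (single i 1) 1"

lemma const_simps [simp]: "const 0 = 0" "const 1 = 1"
  by (simp_all add: const_def)

lemma const_add: "const (a + b) = const a + const b"
  and const_mult: "const (a * b) = const a * const b"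
  and const_minus: "const (- a) = - const a"
  and const_diff: "const (a - b) = const a - const b"
  by (simp_all add: const_def single_add mult_single single_uminus single_diff)

lemma const_sum: "const (\<Sum>x\<in>A. f x) = (\<Sum>x\<in>A. const (f x))"
  by (induction A rule: infinite_finite_induct) (auto simp: const_add)

lemma smul_conv: "smul c p = const c * p"
  by (simp add: smul_def const_def mult_map_scale_conv_mult)

lemma lookup_const_mult [simp]: "lookup (const c * p) m = c * lookup p m"
  by (simp flip: smul_conv)

lemma var_power: "var i ^ n = single (single i n) 1"
  by (induction n) (auto simp: var_def mult_single simp flip: single_add)

lemma single_prod: "finite A \<Longrightarrow> (\<Prod>x\<in>A. single (f x) 1) = single (\<Sum>x\<in>A. f x) (1::'k::field)"
  by (induction A rule: finite_induct) (auto simp: mult_single)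

lemma mon_sum_single: "finite A \<Longrightarrow> keys m \<subseteq> A \<Longrightarrow> (\<Sum>i\<in>A. single i (lookup m i)) = (m :: 'i mon)"
  by (rule poly_mapping_eqI)
    (auto simp: lookup_sum lookup_single when_def in_keys_iff if_distrib subset_iff
       cong: if_cong)

lemma single_conv_vars:
  "single m a = const a * (\<Prod>i\<in>keys m. var i ^ lookup m i)"
  by (simp add: var_power single_prod mon_sum_single const_def mult_single)

lemma single_conv_vars_UNIV:
  "single m a = const a * (\<Prod>i\<in>UNIV. var i ^ lookup m (i::'i::finite))"
  by (simp add: var_power single_prod mon_sum_single const_def mult_single)

lemma poly_mapping_sum_single: "p = (\<Sum>m\<in>keys p. single m (lookup p m))"
  by (rule poly_mapping_eqI) (auto simp: lookup_sum lookup_single when_def in_keys_iff)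

lemma mpoly_induct [case_names const var add mult]:
  assumes "\<And>c. P (const c)" "\<And>i. P (var i)"
    "\<And>p q. P p \<Longrightarrow> P q \<Longrightarrow> P (p + q)" "\<And>p q. P p \<Longrightarrow> P q \<Longrightarrow> P (p * q)"
  shows "P (p :: ('i, 'k::field) mpoly)"
proof -
  have pow: "P (var i ^ n)" for i n
    using assms(1)[of 1] by (induction n) (auto intro: assms)
  have prod: "P (\<Prod>i\<in>A. var i ^ f i)" for A and f :: "'i \<Rightarrow> nat"
    using assms(1)[of 1] by (induction A rule: infinite_finite_induct) (auto intro: assms pow)
  have "P (single m a)" for m a
    unfolding single_conv_vars by (intro assms prod)
  then have "P (\<Sum>m\<in>A. single m (lookup p m))" for A
    using assms(1)[of 0] by (induction A rule: infinite_finite_induct) (auto intro: assms)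
  then show ?thesis using poly_mapping_sum_single[of p] by metis
qed

subsection \<open>Substitution\<close>

definition ring_map :: "('k::field \<Rightarrow> 'a::comm_ring_1) \<Rightarrow> bool" where
  "ring_map c \<longleftrightarrow> c 0 = 0 \<and> c 1 = 1 \<and> (\<forall>a b. c (a + b) = c a + c b) \<and> (\<forall>a b. c (a * b) = c a * c b)"

text \<open>
  Evaluation at a point is the case that \<open>c\<close> is the identity; substitution of polynomials is the
  case \<open>c = const\<close>.
\<close>

definition subst :: "('k::field \<Rightarrow> 'a::comm_ring_1) \<Rightarrow> ('i \<Rightarrow> 'a) \<Rightarrow> ('i, 'k) mpoly \<Rightarrow> 'a" where
  "subst c a p = (\<Sum>m\<in>keys p. c (lookup p m) * (\<Prod>i\<in>keys m. a i ^ lookup m i))"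

lemma eval_mpoly_subst: "eval_mpoly a p = subst (\<lambda>x. x) a p"
  by (simp add: eval_mpoly_def subst_def)

lemma ring_map_id [simp]: "ring_map (\<lambda>x. x)" and ring_map_const [simp]: "ring_map const"
  by (auto simp: ring_map_def const_add const_mult)

context
  fixes c :: "'k::field \<Rightarrow> 'a::comm_ring_1" and a :: "'i \<Rightarrow> 'a"
  assumes c: "ring_map c"
begin

lemma subst_superset:
  assumes "finite A" "keys p \<subseteq> A"
  shows "subst c a p = (\<Sum>m\<in>A. c (lookup p m) * (\<Prod>i\<in>keys m. a i ^ lookup m i))"
  unfolding subst_def using assms c
  by (intro sum.mono_neutral_left) (auto simp: in_keys_iff ring_map_def)

lemma subst_0 [simp]: "subst c a 0 = 0"
  by (simp add: subst_def)

lemma subst_add [simp]: "subst c a (p + q) = subst c a p + subst c a q"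
proof -
  let ?A = "keys p \<union> keys q"
  have "keys (p + q) \<subseteq> ?A" by (rule Poly_Mapping.keys_add)
  then show ?thesis using c
    by (simp add: subst_superset[of ?A] lookup_add ring_map_def algebra_simps sum.distrib)
qed

lemma subst_sum [simp]: "subst c a (\<Sum>x\<in>A. f x) = (\<Sum>x\<in>A. subst c a (f x))"
  by (induction A rule: infinite_finite_induct) auto

lemma subst_single: "subst c a (single m b) = c b * (\<Prod>i\<in>keys m. a i ^ lookup m i)"
  using c by (cases "b = 0") (auto simp: subst_def ring_map_def)

lemma prod_mon_superset:
  "finite A \<Longrightarrow> keys m \<subseteq> A \<Longrightarrow> (\<Prod>i\<in>keys m. a i ^ lookup m i) = (\<Prod>i\<in>A. (a i :: 'a) ^ lookup m i)"
  by (intro prod.mono_neutral_left) (auto simp: in_keys_iff)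

lemma subst_mult [simp]: "subst c a (p * q) = subst c a p * subst c a q"
proof -
  have single: "subst c a (single m x * single n y) = subst c a (single m x) * subst c a (single n y)"
    for m n :: "'i mon" and x y
  proof -
    let ?A = "keys m \<union> keys n"
    have A: "finite ?A" "keys (m + n) \<subseteq> ?A" "keys m \<subseteq> ?A" "keys n \<subseteq> ?A"
      using Poly_Mapping.keys_add[of m n] by auto
    show ?thesis using c
      unfolding mult_single subst_single prod_mon_superset[OF A(1,2)] prod_mon_superset[OF A(1,3)]
        prod_mon_superset[OF A(1,4)]
      by (simp add: ring_map_def lookup_add power_add prod.distrib algebra_simps)
  qed
  have "subst c a ((\<Sum>m\<in>keys p. single m (lookup p m)) * (\<Sum>m\<in>keys q. single m (lookup q m))) =
    subst c a (\<Sum>m\<in>keys p. single m (lookup p m)) * subst c a (\<Sum>m\<in>keys q. single m (lookup q m))"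
    by (simp add: sum_product single)
  then show ?thesis by (simp flip: poly_mapping_sum_single)
qed

lemma subst_const [simp]: "subst c a (const b) = c b"
  by (simp add: const_def subst_single)

lemma subst_var [simp]: "subst c a (var i) = a i"
  using c by (simp add: var_def subst_single ring_map_def)

lemma subst_1 [simp]: "subst c a 1 = 1"
  using subst_const[of 1] c by (simp add: ring_map_def)

lemma subst_smul [simp]: "subst c a (smul b p) = c b * subst c a p"
  by (simp add: smul_conv)

lemma subst_uminus [simp]: "subst c a (- p) = - subst c a p"
  using subst_add[of p "- p"] by (simp add: eq_neg_iff_add_eq_0 add.commute)

lemma subst_diff [simp]: "subst c a (p - q) = subst c a p - subst c a q"
  using subst_add[of p "- q"] by simp

lemma subst_power [simp]: "subst c a (p ^ n) = subst c a p ^ n"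
  by (induction n) auto

lemma subst_prod [simp]: "subst c a (\<Prod>x\<in>A. f x) = (\<Prod>x\<in>A. subst c a (f x))"
  by (induction A rule: infinite_finite_induct) auto

end

lemma linear_form_eval: "linear_form (eval_mpoly a)"
  by (simp add: linear_form_def eval_mpoly_subst)

subsection \<open>Grading\<close>

lemma mdeg_superset: "finite A \<Longrightarrow> keys m \<subseteq> A \<Longrightarrow> mdeg m = (\<Sum>i\<in>A. lookup m i)"
  unfolding mdeg_def by (intro sum.mono_neutral_left) (auto simp: in_keys_iff)

lemma mdeg_add [simp]: "mdeg (m + n) = mdeg m + mdeg n"
proof -
  have "keys (m + n) \<subseteq> keys m \<union> keys n" by (rule Poly_Mapping.keys_add)
  then show ?thesis
    by (simp add: mdeg_superset[of "keys m \<union> keys n"] lookup_add sum.distrib)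
qed

lemma mdeg_0 [simp]: "mdeg 0 = 0" and mdeg_single [simp]: "mdeg (single i n) = n"
  by (simp_all add: mdeg_def)

lemma mdeg_UNIV: "mdeg m = (\<Sum>i\<in>UNIV. lookup m (i::'i::finite))"
  by (simp add: mdeg_superset)

lemma mdeg_eq_0_iff [simp]: "mdeg m = 0 \<longleftrightarrow> m = 0"
proof
  assume "mdeg m = 0"
  then show "m = 0" by (intro poly_mapping_eqI) (auto simp: mdeg_def in_keys_iff)
qed simp

lemma homogD: "p \<in> homog d \<Longrightarrow> lookup p m \<noteq> 0 \<Longrightarrow> mdeg m = d"
  by (auto simp: homog_def in_keys_iff)

lemma homogI: "(\<And>m. lookup p m \<noteq> 0 \<Longrightarrow> mdeg m = d) \<Longrightarrow> p \<in> homog d"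
  by (auto simp: homog_def in_keys_iff)

lemma homog_0 [simp]: "0 \<in> homog d" by (simp add: homog_def)

lemma homog_add: "p \<in> homog d \<Longrightarrow> q \<in> homog d \<Longrightarrow> p + q \<in> homog d"
  by (rule homogI) (metis add.right_neutral homogD lookup_add)

lemma homog_smul: "p \<in> homog d \<Longrightarrow> smul c p \<in> homog d"
  by (rule homogI) (auto dest: homogD)

lemma subspace_homog: "K_space.subspace (homog d)"
  by (simp add: K_space.subspace_def homog_add homog_smul)

lemma homog_sum: "(\<And>x. x \<in> A \<Longrightarrow> f x \<in> homog d) \<Longrightarrow> (\<Sum>x\<in>A. f x) \<in> homog d"
  by (rule K_space.subspace_sum[OF subspace_homog])

lemma homog_diff: "p \<in> homog d \<Longrightarrow> q \<in> homog d \<Longrightarrow> p - q \<in> homog d"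
  by (rule K_space.subspace_diff[OF subspace_homog])

lemma homog_uminus: "p \<in> homog d \<Longrightarrow> - p \<in> homog d"
  by (rule K_space.subspace_neg[OF subspace_homog])

lemma homog_single: "mdeg m = d \<Longrightarrow> single m a \<in> homog d"
  by (rule homogI) (auto simp: lookup_single when_def split: if_splits)

lemma homog_var [simp]: "var i \<in> homog 1" by (simp add: var_def homog_single)

lemmas homog_var_Suc [simp] = homog_var[unfolded One_nat_def]

lemma homog_const [simp]: "const a \<in> homog 0" by (simp add: const_def homog_single)

lemma homog_mult: "p \<in> homog d \<Longrightarrow> q \<in> homog e \<Longrightarrow> p * q \<in> homog (d + e)"
  unfolding homog_def using keys_mult[of p q] by fastforce

lemma homog_const_mult: "p \<in> homog d \<Longrightarrow> const a * p \<in> homog d"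
  using homog_smul by (simp add: smul_conv)

lemma homog_power: "p \<in> homog d \<Longrightarrow> p ^ n \<in> homog (n * d)"
  using homog_const[of 1] by (induction n) (auto intro: homog_mult)

lemma homog_prod: "finite A \<Longrightarrow> (\<And>x. x \<in> A \<Longrightarrow> f x \<in> homog (d x)) \<Longrightarrow> (\<Prod>x\<in>A. f x) \<in> homog (\<Sum>x\<in>A. d x)"
proof (induction A rule: finite_induct)
  case empty
  then show ?case using homog_const[of 1] by simp
qed (auto intro: homog_mult)

lemma lookup_hom_comp: "lookup (hom_comp d p) m = (if mdeg m = d then lookup p m else 0)"
proof -
  have "lookup (hom_comp d p) m = (\<Sum>n | n \<in> keys p \<and> mdeg n = d. if n = m then lookup p m else 0)"
    unfolding hom_comp_def lookup_sum by (intro sum.cong) (auto simp: lookup_single when_def)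
  also have "\<dots> = (if mdeg m = d then lookup p m else 0)"
    by (simp add: sum.delta in_keys_iff)
  finally show ?thesis .
qed

lemma hom_comp_homog [simp]: "hom_comp d p \<in> homog d"
  by (rule homogI) (auto simp: lookup_hom_comp split: if_splits)

lemma hom_comp_of_homog: "p \<in> homog e \<Longrightarrow> hom_comp d p = (if d = e then p else 0)"
  by (rule poly_mapping_eqI) (auto simp: lookup_hom_comp dest: homogD)

lemma hom_comp_add: "hom_comp d (p + q) = hom_comp d p + hom_comp d q"
  and hom_comp_diff: "hom_comp d (p - q) = hom_comp d p - hom_comp d q"
  and hom_comp_smul: "hom_comp d (smul a p) = smul a (hom_comp d p)"
  and hom_comp_0 [simp]: "hom_comp d 0 = 0"
  by (rule poly_mapping_eqI, simp add: lookup_hom_comp lookup_add lookup_minus)+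

lemma hom_comp_sum: "hom_comp d (\<Sum>x\<in>A. f x) = (\<Sum>x\<in>A. hom_comp d (f x))"
  by (induction A rule: infinite_finite_induct) (auto simp: hom_comp_add)

definition tdeg :: "('i mon \<Rightarrow>\<^sub>0 'k::field) \<Rightarrow> nat" where
  "tdeg p = Max (insert 0 (mdeg ` keys p))"

lemma mdeg_le_tdeg: "lookup p m \<noteq> 0 \<Longrightarrow> mdeg m \<le> tdeg p"
  unfolding tdeg_def by (intro Max_ge) (auto simp: in_keys_iff)

lemma hom_comp_above: "tdeg p < d \<Longrightarrow> hom_comp d p = 0"
  by (rule poly_mapping_eqI) (use mdeg_le_tdeg[of p] in \<open>force simp: lookup_hom_comp\<close>)

lemma sum_hom_comp: "tdeg p \<le> N \<Longrightarrow> (\<Sum>d\<le>N. hom_comp d p) = p"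
  by (rule poly_mapping_eqI) (use mdeg_le_tdeg[of p] in \<open>force simp: lookup_hom_comp lookup_sum\<close>)

lemma hom_comp_mult_homog:
  assumes q: "q \<in> homog e"
  shows "hom_comp (d + e) (p * q) = hom_comp d p * q"
proof -
  define N where "N = max (tdeg p) d"
  have "p * q = (\<Sum>k\<le>N. hom_comp k p * q)"
    using sum_hom_comp[of p N] by (simp add: N_def flip: sum_distrib_right)
  then have "hom_comp (d + e) (p * q) = (\<Sum>k\<le>N. hom_comp (d + e) (hom_comp k p * q))"
    by (simp add: hom_comp_sum)
  also have "\<dots> = (\<Sum>k\<le>N. if k = d then hom_comp d p * q else 0)"
    by (intro sum.cong) (auto simp: hom_comp_of_homog[OF homog_mult[OF hom_comp_homog q]])
  also have "\<dots> = hom_comp d p * q" by (simp add: N_def)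
  finally show ?thesis .
qed

lemma hom_comp_mult_homog_below:
  assumes q: "q \<in> homog e" and "d < e"
  shows "hom_comp d (p * q) = 0"
proof -
  have "p * q = (\<Sum>k\<le>tdeg p. hom_comp k p * q)"
    using sum_hom_comp[of p "tdeg p"] by (simp flip: sum_distrib_right)
  then have "hom_comp d (p * q) = (\<Sum>k\<le>tdeg p. hom_comp d (hom_comp k p * q))"
    by (simp add: hom_comp_sum)
  also have "\<dots> = 0"
    using assms(2) by (intro sum.neutral) (auto simp: hom_comp_of_homog[OF homog_mult[OF hom_comp_homog q]])
  finally show ?thesis .
qed

lemma single_1_eq_iff: "single i (Suc 0) = single j (Suc 0) \<longleftrightarrow> i = j"
  by (metis keys_single nat.distinct(1) singleton_inject)

lemma mdeg_1_cases:
  assumes "mdeg (m :: 'i mon) = 1" shows "\<exists>i. m = single i 1"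
proof -
  from assms have "(\<Sum>i\<in>keys m. lookup m i) = 1" by (simp add: mdeg_def)
  then obtain i where i: "i \<in> keys m" "lookup m i = 1" "\<forall>j\<in>keys m. i \<noteq> j \<longrightarrow> lookup m j = 0"
    by (subst (asm) sum_eq_1_iff) auto
  have "m = single i 1"
    by (rule poly_mapping_eqI) (use i in \<open>auto simp: lookup_single when_def in_keys_iff\<close>)
  then show ?thesis ..
qed

lemma homog_1_conv:
  fixes p :: "('i::finite, 'k::field) mpoly"
  assumes "p \<in> homog 1"
  shows "p = (\<Sum>i\<in>UNIV. smul (lin_coeff p i) (var i))"
proof (rule poly_mapping_eqI)
  fix m :: "'i mon"
  show "lookup p m = lookup (\<Sum>i\<in>UNIV. smul (lin_coeff p i) (var i)) m"
  proof (cases "mdeg m = 1")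
    case True
    then obtain i where m: "m = single i 1" using mdeg_1_cases by blast
    have "lookup (var j) m = (if i = j then 1 else (0::'k))" for j
      by (simp add: m var_def lookup_single when_def single_1_eq_iff)
    then have "lookup (\<Sum>j\<in>UNIV. smul (lin_coeff p j) (var j)) m =
        (\<Sum>j\<in>UNIV. if i = j then lin_coeff p j else 0)"
      unfolding lookup_sum lookup_smul by (intro sum.cong) auto
    also have "\<dots> = lin_coeff p i" by simp
    finally show ?thesis by (simp only: lin_coeff_def m)
  next
    case False
    then have "lookup p m = 0" "lookup (var i) m = (0::'k)" for i
      using homogD[OF assms, of m] homogD[OF homog_var[of i], of m] by auto
    then show ?thesis by (simp add: lookup_sum)
  qed
qed

lemma lin_coeff_simps [simp]:
  "lin_coeff (p + q) i = lin_coeff p i + lin_coeff q i"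
  "lin_coeff (p - q) i = lin_coeff p i - lin_coeff q i"
  "lin_coeff (smul a p) i = a * lin_coeff p i"
  "lin_coeff (const a * p) i = a * lin_coeff p i"
  "lin_coeff 0 i = 0"
  "lin_coeff (var j) i = (if i = j then 1 else 0)"
  by (simp_all add: lin_coeff_def lookup_add lookup_minus var_def lookup_single when_def single_1_eq_iff)

lemma lin_coeff_sum: "lin_coeff (\<Sum>x\<in>A. f x) i = (\<Sum>x\<in>A. lin_coeff (f x) i)"
  by (simp add: lin_coeff_def lookup_sum)

lemma homog_1_eqI: "p \<in> homog 1 \<Longrightarrow> q \<in> homog 1 \<Longrightarrow> (\<And>i::'i::finite. lin_coeff p i = lin_coeff q i) \<Longrightarrow> p = q"
  by (subst homog_1_conv[of p], assumption, subst homog_1_conv[of q], assumption) simp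

lemma finite_mdeg: "finite {m :: 'i::finite mon. mdeg m = d}"
proof -
  have "inj_on lookup {m :: 'i mon. mdeg m = d}"
    by (intro inj_onI) (simp only: Poly_Mapping.lookup_inject)
  moreover have "lookup ` {m :: 'i mon. mdeg m = d} \<subseteq> PiE UNIV (\<lambda>_. {..d})"
  proof safe
    fix m :: "'i mon" and i assume "d = mdeg m"
    have "lookup m i \<le> (\<Sum>i\<in>UNIV. lookup m i)" by (rule member_le_sum) auto
    then show "lookup m i \<le> mdeg m" by (simp add: mdeg_UNIV)
  qed auto
  moreover have "finite (PiE (UNIV :: 'i set) (\<lambda>_. {..d}))" by (intro finite_PiE) auto
  ultimately show ?thesis using finite_subset inj_on_finite by blast
qed

section \<open>Ideals and the projective Nullstellensatz\<close>

lemma ideal_0: "poly_ideal I \<Longrightarrow> 0 \<in> I"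
  and ideal_add: "poly_ideal I \<Longrightarrow> p \<in> I \<Longrightarrow> q \<in> I \<Longrightarrow> p + q \<in> I"
  and ideal_mult: "poly_ideal I \<Longrightarrow> p \<in> I \<Longrightarrow> q * p \<in> I"
  by (auto simp: poly_ideal_def)

lemma ideal_mult_right: "poly_ideal I \<Longrightarrow> p \<in> I \<Longrightarrow> p * q \<in> I"
  using ideal_mult[of I p q] by (simp add: mult.commute)

lemma ideal_uminus: "poly_ideal I \<Longrightarrow> p \<in> I \<Longrightarrow> - p \<in> I"
  using ideal_mult[of I p "- 1"] by simp

lemma ideal_diff: "poly_ideal I \<Longrightarrow> p \<in> I \<Longrightarrow> q \<in> I \<Longrightarrow> p - q \<in> I"
  using ideal_add[of I p "- q"] ideal_uminus[of I q] by simp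

lemma ideal_smul: "poly_ideal I \<Longrightarrow> p \<in> I \<Longrightarrow> smul c p \<in> I"
  by (simp add: smul_conv ideal_mult)

lemma subspace_ideal: "poly_ideal I \<Longrightarrow> K_space.subspace I"
  by (simp add: K_space.subspace_def ideal_0 ideal_add ideal_smul)

lemma ideal_sum: "poly_ideal I \<Longrightarrow> (\<And>x. x \<in> A \<Longrightarrow> f x \<in> I) \<Longrightarrow> (\<Sum>x\<in>A. f x) \<in> I"
  by (rule K_space.subspace_sum[OF subspace_ideal])

lemma ideal_cancel_const:
  assumes "poly_ideal I" "c \<noteq> 0" "const c * p \<in> I"
  shows "p \<in> I"
proof -
  have "const (inverse c) * (const c * p) = p"
    using assms(2) by (simp flip: mult.assoc const_mult)
  then show ?thesis using ideal_mult[OF assms(1,3), of "const (inverse c)"] by simp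
qed

lemma homogeneous_ideal_ideal: "homogeneous_ideal I \<Longrightarrow> poly_ideal I"
  and homogeneous_ideal_comp: "homogeneous_ideal I \<Longrightarrow> p \<in> I \<Longrightarrow> hom_comp d p \<in> I"
  by (auto simp: homogeneous_ideal_def)

text \<open>
  For an ideal \<open>A\<close> this is the ideal generated by \<open>A\<close> and \<open>h\<close>.
\<close>

definition adjoin :: "('i, 'k::field) mpoly set \<Rightarrow> ('i, 'k) mpoly \<Rightarrow> ('i, 'k) mpoly set" where
  "adjoin A h = {a + b * h |a b. a \<in> A}"

lemma adjoinI: "a \<in> A \<Longrightarrow> a + b * h \<in> adjoin A h"
  by (auto simp: adjoin_def)

lemma adjoin_superset: "A \<subseteq> adjoin A h"
  using adjoinI[of _ A 0 h] by auto

lemma adjoin_ideal: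
  assumes "poly_ideal A" shows "poly_ideal (adjoin A h)"
proof -
  have "0 \<in> adjoin A h" using adjoin_superset ideal_0[OF assms] by blast
  moreover have "p + q \<in> adjoin A h" if "p \<in> adjoin A h" "q \<in> adjoin A h" for p q
  proof -
    obtain a b a' b' where "p = a + b * h" "q = a' + b' * h" "a \<in> A" "a' \<in> A"
      using \<open>p \<in> _\<close> \<open>q \<in> _\<close> by (auto simp: adjoin_def)
    then have "p + q = (a + a') + (b + b') * h" "a + a' \<in> A"
      using ideal_add[OF assms] by (auto simp: algebra_simps)
    then show ?thesis by (auto simp: adjoin_def)
  qed
  moreover have "q * p \<in> adjoin A h" if "p \<in> adjoin A h" for p q
  proof -
    obtain a b where "p = a + b * h" "a \<in> A" using \<open>p \<in> _\<close> by (auto simp: adjoin_def)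
    then have "q * p = q * a + (q * b) * h" "q * a \<in> A"
      using ideal_mult[OF assms] by (auto simp: algebra_simps)
    then show ?thesis by (auto simp: adjoin_def)
  qed
  ultimately show ?thesis by (auto simp: poly_ideal_def)
qed

lemma gen_in_adjoin: "poly_ideal A \<Longrightarrow> h \<in> adjoin A h"
  using adjoinI[of 0 A 1 h] by (simp add: ideal_0)

lemma mult_gen_in_adjoin: "poly_ideal A \<Longrightarrow> b * h \<in> adjoin A h"
  using adjoinI[of 0 A b h] by (simp add: ideal_0)

lemma hom_comp_mult_homog_cases:
  "q \<in> homog e \<Longrightarrow> hom_comp d (p * q) = (if d < e then 0 else hom_comp (d - e) p * q)"
  using hom_comp_mult_homog[of q e "d - e" p] by (auto simp: hom_comp_mult_homog_below)

lemma adjoin_homogeneous: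
  assumes A: "homogeneous_ideal A" and h: "h \<in> homog e"
  shows "homogeneous_ideal (adjoin A h)"
  unfolding homogeneous_ideal_def
proof (intro conjI ballI allI)
  show id: "poly_ideal (adjoin A h)" using A by (simp add: adjoin_ideal homogeneous_ideal_def)
  fix p d assume "p \<in> adjoin A h"
  then obtain a b where ab: "p = a + b * h" "a \<in> A" by (auto simp: adjoin_def)
  have "hom_comp d a \<in> A" using A ab by (simp add: homogeneous_ideal_def)
  moreover have "hom_comp d p = hom_comp d a + (if d < e then 0 else hom_comp (d - e) b) * h"
    by (simp add: ab hom_comp_add hom_comp_mult_homog_cases[OF h])
  ultimately show "hom_comp d p \<in> adjoin A h" by (metis adjoinI)
qed

subsection \<open>Roots modulo an ideal\<close>

definition peval :: "'k::field poly \<Rightarrow> ('i, 'k) mpoly \<Rightarrow> ('i, 'k) mpoly" where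
  "peval q u = poly (map_poly const q) u"

lemma peval_pCons [simp]: "peval (pCons c q) u = const c + u * peval q u"
  by (simp add: peval_def map_poly_pCons)

lemma peval_0 [simp]: "peval 0 u = 0"
  by (simp add: peval_def)

lemma peval_add [simp]: "peval (p + q) u = peval p u + peval q u"
proof (induction p arbitrary: q)
  case (pCons c p)
  show ?case
  proof (cases q)
    case (pCons d q')
    then show ?thesis by (simp add: pCons.IH const_add algebra_simps)
  qed
qed simp

lemma peval_smult [simp]: "peval (smult c p) u = const c * peval p u"
  by (induction p) (auto simp: const_mult algebra_simps)

lemma peval_mult [simp]: "peval (p * q) u = peval p u * peval q u"
  by (induction p) (auto simp: algebra_simps)

lemma peval_power [simp]: "peval (p ^ n) u = peval p u ^ n"
  by (induction n) (auto simp: one_pCons)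

lemma peval_sum [simp]: "peval (\<Sum>x\<in>A. f x) u = (\<Sum>x\<in>A. peval (f x) u)"
  by (induction A rule: infinite_finite_induct) auto

lemma peval_monom [simp]: "peval (monom c n) u = const c * u ^ n"
  by (induction n) (auto simp: monom_0 monom_Suc algebra_simps)

text \<open>
  The linear factors of \<open>q(u)\<close> are units modulo \<open>J\<close>, so they can be cancelled one after another.
\<close>

lemma strip_units_from_relation:
  fixes u v :: "('i, 'k::alg_closed_field) mpoly"
  assumes J: "poly_ideal J" and "q \<noteq> 0"
    and "\<And>c. poly q c = 0 \<Longrightarrow> 1 \<in> adjoin J (u - const c)"
    and "peval q u * v \<in> J"
  shows "v \<in> J"
  using assms(2-4)
proof (induction "degree q" arbitrary: q)
  case 0
  then obtain a where "q = [:a:]" "a \<noteq> 0" by (metis degree_eq_zeroE pCons_0_0)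
  then show ?case using 0 ideal_cancel_const[OF J] by auto
next
  case (Suc n)
  then obtain c where c: "poly q c = 0" using alg_closed_imp_poly_has_root[of q] by auto
  then obtain q' where q': "q = [:- c, 1:] * q'" by (auto simp: poly_eq_0_iff_dvd)
  have nz: "q' \<noteq> 0" using Suc.prems q' by auto
  have "degree q = Suc (degree q')" unfolding q' using nz by (subst degree_mult_eq) auto
  then have deg: "n = degree q'" using Suc by simp
  obtain j b where jb: "1 = j + b * (u - const c)" "j \<in> J"
    using Suc.prems(2)[OF c] by (auto simp: adjoin_def)
  let ?w = "peval q' u * v"
  have "(u - const c) * ?w = peval q u * v"
    unfolding q' peval_mult by (simp add: const_minus algebra_simps)
  then have m: "(u - const c) * ?w \<in> J" using Suc.prems by simp
  have "?w * j + b * ((u - const c) * ?w) \<in> J"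
    by (rule ideal_add[OF J ideal_mult[OF J jb(2)] ideal_mult[OF J m]])
  also have "?w * j + b * ((u - const c) * ?w) = ?w * (j + b * (u - const c))"
    by (simp add: algebra_simps)
  finally have "?w \<in> J" unfolding jb(1)[symmetric] by (simp only: mult_1_right)
  moreover have "1 \<in> adjoin J (u - const c)" if "poly q' c = 0" for c
    using that Suc.prems(2)[of c] by (simp add: q')
  ultimately show ?case using Suc.hyps(1)[OF deg nz] by blast
qed

text \<open>
  The factors of \<open>q(u)\<close> at the nonzero roots are units modulo \<open>J\<close>; a power of \<open>u\<close> remains.
\<close>

lemma nilpotent_modulo_ideal:
  fixes u :: "('i, 'k::alg_closed_field) mpoly"
  assumes J: "poly_ideal J" and q: "q \<noteq> 0" "peval q u \<in> J"
    and "\<And>c. c \<noteq> 0 \<Longrightarrow> 1 \<in> adjoin J (u - const c)"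
  shows "\<exists>n\<le>degree q. u ^ n \<in> J"
proof -
  obtain q' where q': "q = [:0, 1:] ^ order 0 q * q'" "\<not> [:0, 1:] dvd q'"
    using order_decomp[OF q(1), of 0] by auto
  have "peval q' u * u ^ order 0 q \<in> J"
    using q(2) by (subst (asm) q'(1)) (simp add: mult.commute)
  moreover have "1 \<in> adjoin J (u - const c)" if "poly q' c = 0" for c
    using that q'(2) assms(4)[of c] by (cases "c = 0") (auto simp: poly_eq_0_iff_dvd)
  moreover have "q' \<noteq> 0" using q'(2) by auto
  ultimately have "u ^ order 0 q \<in> J" using strip_units_from_relation[OF J] by blast
  then show ?thesis using order_degree[OF q(1)] by blast
qed

lemma eval_mpoly_mod:
  assumes J: "poly_ideal J" and c: "\<And>i. var i - const (c i) \<in> J"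
  shows "p - const (eval_mpoly c p) \<in> J"
proof (induction p rule: mpoly_induct)
  case (const a)
  then show ?case by (simp add: eval_mpoly_subst ideal_0 J)
next
  case (var i)
  then show ?case using c by (simp add: eval_mpoly_subst)
next
  case (add p q)
  then have "(p - const (eval_mpoly c p)) + (q - const (eval_mpoly c q)) \<in> J"
    by (rule ideal_add[OF J])
  then show ?case by (simp add: eval_mpoly_subst const_add algebra_simps)
next
  case (mult p q)
  have "q * (p - const (eval_mpoly c p)) + const (eval_mpoly c p) * (q - const (eval_mpoly c q)) \<in> J"
    using mult by (intro ideal_add ideal_mult J)
  then show ?case by (simp add: eval_mpoly_subst const_mult algebra_simps)
qed

text \<open>
  The coordinates of the zero are found one at a time. If adjoining \<open>var i - a\<close> gave the unit ideal
  for every root \<open>a\<close> of the relation of \<open>var i\<close>, then cancelling these units in the relation would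
  put 1 into the ideal.
\<close>

lemma zero_of_algebraic_ideal:
  fixes J :: "('i::finite, 'k::alg_closed_field) mpoly set"
  assumes J: "poly_ideal J" "1 \<notin> J" and alg: "\<And>i. \<exists>q. q \<noteq> 0 \<and> peval q (var i) \<in> J"
  shows "\<exists>c. \<forall>p\<in>J. eval_mpoly c p = 0"
proof -
  have "\<exists>c J'. poly_ideal J' \<and> J \<subseteq> J' \<and> 1 \<notin> J' \<and> (\<forall>i\<in>S. var i - const (c i) \<in> J')" if "finite S" for S
    using that
  proof (induction S rule: finite_induct)
    case empty
    then show ?case using J by auto
  next
    case (insert i S)
    then obtain c J' where J': "poly_ideal J'" "J \<subseteq> J'" "1 \<notin> J'" "\<forall>i\<in>S. var i - const (c i) \<in> J'"
      by auto
    obtain q where q: "q \<noteq> 0" "peval q (var i) \<in> J'" using alg[of i] J'(2) by blast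
    have "\<exists>a. 1 \<notin> adjoin J' (var i - const a)"
      using strip_units_from_relation[OF J'(1) q(1), of "var i" 1] q(2) J'(3) by auto
    then obtain a where a: "1 \<notin> adjoin J' (var i - const a)" by blast
    show ?case
      using J' a insert.hyps adjoin_superset[of J'] gen_in_adjoin[OF J'(1)]
      by (intro exI[of _ "c(i := a)"] exI[of _ "adjoin J' (var i - const a)"])
        (auto simp: adjoin_ideal)
  qed
  from this[of UNIV] obtain c J' where J': "poly_ideal J'" "J \<subseteq> J'" "1 \<notin> J'"
      "\<And>i. var i - const (c i) \<in> J'" by auto
  have "eval_mpoly c p = 0" if "p \<in> J" for p
  proof (rule ccontr)
    assume nz: "eval_mpoly c p \<noteq> 0"
    have "p - (p - const (eval_mpoly c p)) \<in> J'"
      using that J'(2) by (intro ideal_diff[OF J'(1) _ eval_mpoly_mod[OF J'(1,4)]]) auto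
    then have "const (eval_mpoly c p) * 1 \<in> J'" by simp
    then show False using ideal_cancel_const[OF J'(1) nz] J'(3) by blast
  qed
  then show ?thesis by blast
qed

subsection \<open>Setting a linear form equal to one\<close>

lemma homog_Suc_subset:
  fixes V :: "('a, 'b::field) mpoly set"
  assumes V: "K_space.subspace V" and "\<And>i q. q \<in> homog e \<Longrightarrow> var i * q \<in> V"
  shows "homog (Suc e) \<subseteq> V"
proof
  fix p :: "('a, 'b::field) mpoly" assume p: "p \<in> homog (Suc e)"
  have "single m (lookup p m) \<in> V" if m: "m \<in> keys p" for m
  proof -
    have deg: "mdeg m = Suc e" using m p by (auto simp: homog_def)
    then obtain i where i: "lookup m i > 0" by (metis mdeg_0 neq0_conv not_less_eq poly_mapping_eqI lookup_zero zero_less_Suc)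
    let ?m = "m - single i 1"
    have m_eq: "m = single i 1 + ?m"
      using i by (intro poly_mapping_eqI) (auto simp: lookup_add lookup_minus lookup_single when_def)
    then have "mdeg m = 1 + mdeg ?m" using mdeg_add[of "single i 1" ?m] by simp
    then have "single ?m (lookup p m) \<in> homog e" using deg by (intro homog_single) simp
    moreover have "single m (lookup p m) = var i * single ?m (lookup p m)"
      unfolding var_def mult_single m_eq[symmetric] by simp
    ultimately show ?thesis using assms(2) by simp
  qed
  then have "(\<Sum>m\<in>keys p. single m (lookup p m)) \<in> V" by (intro K_space.subspace_sum V)
  then show "p \<in> V" by (simp flip: poly_mapping_sum_single)
qed

lemma homog_subset_mono:
  assumes "poly_ideal A" "homog d \<subseteq> A" "d \<le> e"
  shows "homog e \<subseteq> A"
  using assms(3)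
proof (induction e rule: dec_induct)
  case (step e)
  then show ?case
    using ideal_mult[OF assms(1)] by (intro homog_Suc_subset subspace_ideal assms(1)) blast
qed (rule assms(2))

lemma homog_subset_adjoinD:
  assumes A: "homogeneous_ideal A" and h: "h \<in> homog 1" and sub: "homog d \<subseteq> adjoin A h" "d \<le> e"
    and p: "p \<in> homog (Suc e)"
  obtains a b where "p = a + b * h" "a \<in> A" "b \<in> homog e"
proof -
  have "homog (Suc e) \<subseteq> adjoin A h"
    using sub by (intro homog_subset_mono[OF _ sub(1)] adjoin_ideal homogeneous_ideal_ideal A) auto
  then obtain a b where ab: "p = a + b * h" "a \<in> A" using p by (auto simp: adjoin_def)
  have "p = hom_comp (Suc e) (a + b * h)" using p ab by (simp add: hom_comp_of_homog)
  also have "\<dots> = hom_comp (Suc e) a + hom_comp e b * h"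
    by (simp add: hom_comp_add hom_comp_mult_homog_cases[OF h])
  finally show ?thesis
    using that homogeneous_ideal_comp[OF A ab(2)] hom_comp_homog by blast
qed

text \<open>Comparing homogeneous components in \<open>p = a + b (h - 1)\<close> gives \<open>b\<close> degree by degree.\<close>

lemma homog_in_dehomogenized_ideal:
  assumes A: "homogeneous_ideal A" and h: "h \<in> homog 1" and p: "p \<in> homog k"
    and mem: "p \<in> adjoin A (h - 1)"
  shows "\<exists>n. h ^ n * p \<in> A"
proof -
  note I = homogeneous_ideal_ideal[OF A]
  obtain a b where ab: "p = a + b * (h - 1)" "a \<in> A" using mem by (auto simp: adjoin_def)
  have rec: "hom_comp d b = hom_comp d a + (if d < 1 then 0 else hom_comp (d - 1) b * h) - hom_comp d p" for d
  proof -
    have "b = a + b * h - p" by (simp add: ab algebra_simps)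
    then have "hom_comp d b = hom_comp d (a + b * h - p)" by simp
    then show ?thesis
      by (simp add: hom_comp_add hom_comp_diff hom_comp_mult_homog_cases[OF h])
  qed
  have a: "hom_comp d a \<in> A" for d using homogeneous_ideal_comp[OF A ab(2)] .
  have low: "hom_comp d b \<in> A" if "d < k" for d
    using that
  proof (induction d)
    case 0
    then show ?case by (subst rec) (simp add: a hom_comp_of_homog[OF p])
  next
    case (Suc d)
    then show ?case
      by (subst rec) (simp add: a hom_comp_of_homog[OF p] ideal_add ideal_mult_right I)
  qed
  have high: "hom_comp (k + n) b + h ^ n * p \<in> A" for n
  proof (induction n)
    case 0
    have "hom_comp k b + p = hom_comp k a + (if k < 1 then 0 else hom_comp (k - 1) b * h)"
      by (subst rec) (simp add: hom_comp_of_homog[OF p])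
    then show ?case using low[of "k - 1"] by (auto simp: a ideal_add ideal_mult_right I)
  next
    case (Suc n)
    have "hom_comp (k + Suc n) b + h ^ Suc n * p = hom_comp (k + Suc n) a + (hom_comp (k + n) b + h ^ n * p) * h"
      by (subst rec) (simp add: hom_comp_of_homog[OF p] algebra_simps)
    then show ?case using Suc by (simp add: a ideal_add ideal_mult_right I)
  qed
  have "hom_comp (k + Suc (tdeg b)) b = 0" by (rule hom_comp_above) simp
  then show ?thesis using high[of "Suc (tdeg b)"] by (auto simp only: add_0)
qed

lemma power_minus_one_in_adjoin:
  assumes "poly_ideal A" shows "h ^ n * p - p \<in> adjoin A (h - 1)"
proof (induction n)
  case 0
  then show ?case by (simp add: ideal_0 adjoin_ideal assms)
next
  case (Suc n)
  have "h ^ Suc n * p - p = (h ^ n * p) * (h - 1) + (h ^ n * p - p)" by (simp add: algebra_simps)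
  show ?case unfolding \<open>h ^ Suc n * p - p = _\<close>
    by (rule ideal_add[OF adjoin_ideal[OF assms] mult_gen_in_adjoin[OF assms] Suc])
qed

text \<open>
  Modulo \<open>h - 1\<close>, a form of low degree may be multiplied by powers of \<open>h\<close>; a form of high degree is
  a multiple of \<open>h\<close> up to an element of \<open>A\<close>, so its degree can be lowered.
\<close>

lemma congruent_to_homog:
  assumes A: "homogeneous_ideal A" and h: "h \<in> homog 1" and sub: "homog d \<subseteq> adjoin A h"
  shows "\<exists>r\<in>homog d. p - r \<in> adjoin A (h - 1)"
proof -
  note I = homogeneous_ideal_ideal[OF A]
  note J = adjoin_ideal[OF I, of "h - 1"]
  have hom: "\<exists>r\<in>homog d. p - r \<in> adjoin A (h - 1)" if "p \<in> homog e" for p e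
  proof (cases "e \<le> d")
    case True
    have "h ^ (d - e) * p \<in> homog (d - e + e)"
      using homog_mult[OF homog_power[OF h, of "d - e"] that] by simp
    moreover have "- (h ^ (d - e) * p - p) \<in> adjoin A (h - 1)"
      by (intro ideal_uminus J power_minus_one_in_adjoin I)
    ultimately show ?thesis using True by (intro bexI[of _ "h ^ (d - e) * p"]) auto
  next
    case False
    then have "d \<le> e" by simp
    then show ?thesis using that
    proof (induction e arbitrary: p rule: dec_induct)
      case base
      then show ?case by (intro bexI[of _ p]) (auto simp: ideal_0 J)
    next
      case (step e)
      obtain a b where ab: "p = a + b * h" "a \<in> A" "b \<in> homog e"
        using homog_subset_adjoinD[OF A h sub step.hyps(1) step.prems] .
      obtain r where r: "r \<in> homog d" "b - r \<in> adjoin A (h - 1)" using step.IH[OF ab(3)] by blast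
      have eq: "p - r = (a + b * (h - 1)) + (b - r)" by (simp add: ab algebra_simps)
      have "p - r \<in> adjoin A (h - 1)"
        unfolding eq by (rule ideal_add[OF J adjoinI[OF ab(2)] r(2)])
      then show ?case using r by blast
    qed
  qed
  have "\<forall>e. \<exists>s. s \<in> homog d \<and> hom_comp e p - s \<in> adjoin A (h - 1)"
    using hom[OF hom_comp_homog] by blast
  from choice[OF this] obtain r
    where r: "\<And>e. r e \<in> homog d" "\<And>e. hom_comp e p - r e \<in> adjoin A (h - 1)" by auto
  have "(\<Sum>e\<le>tdeg p. hom_comp e p - r e) \<in> adjoin A (h - 1)" by (intro ideal_sum J r)
  then have "p - (\<Sum>e\<le>tdeg p. r e) \<in> adjoin A (h - 1)" by (simp add: sum_subtractf sum_hom_comp)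
  then show ?thesis using homog_sum[of "{..tdeg p}" r d] r(1) by blast
qed

text \<open>
  The powers of \<open>u\<close> are represented in the space of forms of degree \<open>d\<close>, which has finite
  dimension, so some of them are dependent.
\<close>

lemma algebraic_modulo_dehomogenized_ideal:
  fixes A :: "('i::finite, 'k::field) mpoly set"
  assumes A: "homogeneous_ideal A" and h: "h \<in> homog 1" and sub: "homog d \<subseteq> adjoin A h"
  shows "\<exists>q. q \<noteq> 0 \<and> peval q u \<in> adjoin A (h - 1)"
proof -
  note J = adjoin_ideal[OF homogeneous_ideal_ideal[OF A], of "h - 1"]
  have "\<forall>n. \<exists>s. s \<in> homog d \<and> u ^ n - s \<in> adjoin A (h - 1)"
    using congruent_to_homog[OF A h sub] by blast
  from choice[OF this] obtain r where r: "\<And>n. r n \<in> homog d" "\<And>n. u ^ n - r n \<in> adjoin A (h - 1)"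
    by auto
  let ?M = "{m :: 'i mon. mdeg m = d}"
  obtain c where c: "\<exists>n\<in>{..card ?M}. c n \<noteq> 0"
      "\<forall>m\<in>?M. (\<Sum>n\<in>{..card ?M}. c n * lookup (r n) m) = 0"
    using underdetermined_system[OF finite_mdeg, of "{..card ?M}" d "\<lambda>n m. lookup (r n) m"] by auto
  have zero: "(\<Sum>n\<le>card ?M. smul (c n) (r n)) = 0"
  proof (rule poly_mapping_eqI)
    fix m show "lookup (\<Sum>n\<le>card ?M. smul (c n) (r n)) m = lookup 0 m"
      using c(2) homogD[OF r(1), of _ m]
      by (cases "mdeg m = d") (fastforce simp: lookup_sum intro!: sum.neutral)+
  qed
  have "(\<Sum>n\<le>card ?M. smul (c n) (u ^ n - r n)) \<in> adjoin A (h - 1)"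
    by (intro ideal_sum ideal_smul J r)
  then have mem: "(\<Sum>n\<le>card ?M. smul (c n) (u ^ n)) \<in> adjoin A (h - 1)"
    using zero by (simp add: K_space.scale_right_diff_distrib sum_subtractf)
  define q where "q = (\<Sum>n\<le>card ?M. monom (c n) n)"
  have "coeff q n = c n" if "n \<le> card ?M" for n using that by (simp add: q_def coeff_sum)
  then have "q \<noteq> 0" using c(1) by force
  moreover have "peval q u \<in> adjoin A (h - 1)" using mem by (simp add: q_def smul_conv)
  ultimately show ?thesis by blast
qed

text \<open>
  Variables are adjoined to \<open>A\<close> as long as the resulting ideal does not contain all forms of some
  degree. When no further variable can be adjoined, let \<open>h\<close> be a variable outside \<open>A\<close>. Modulo \<open>A\<close>, all
  forms of large degree are multiples of \<open>h\<close>. Hence the ideal generated by \<open>A\<close> and \<open>h - 1\<close> is proper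
  with algebraic residue ring, and it has a zero, at which \<open>h\<close> is 1.
\<close>

theorem projective_Nullstellensatz:
  fixes A :: "('i::finite, 'k::alg_closed_field) mpoly set"
  assumes "homogeneous_ideal A" "\<And>d. \<not> homog d \<subseteq> A"
  shows "\<exists>c. (\<exists>i. c i \<noteq> 0) \<and> (\<forall>p\<in>A. eval_mpoly c p = 0)"
  using assms
proof (induction "card {i. var i \<notin> A}" arbitrary: A rule: less_induct)
  case less
  note A = less.prems(1)
  note I = homogeneous_ideal_ideal[OF A]
  show ?case
  proof (cases "\<exists>i. var i \<notin> A \<and> (\<forall>d. \<not> homog d \<subseteq> adjoin A (var i))")
    case True
    then obtain i where i: "var i \<notin> A" "\<And>d. \<not> homog d \<subseteq> adjoin A (var i)" by blast
    have sub: "{j. var j \<notin> adjoin A (var i)} \<subset> {j. var j \<notin> A}"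
      using i(1) adjoin_superset[of A "var i"] gen_in_adjoin[OF I, of "var i"] by auto
    have "card {j. var j \<notin> adjoin A (var i)} < card {j. var j \<notin> A}"
      by (rule psubset_card_mono[OF _ sub]) simp
    from less.hyps[OF this adjoin_homogeneous[OF A homog_var] i(2)] show ?thesis
      using adjoin_superset[of A "var i"] by blast
  next
    case False
    have "\<exists>i. var i \<notin> A"
    proof (rule ccontr)
      assume "\<not> ?thesis"
      then have "homog (Suc 0) \<subseteq> A"
        by (intro homog_Suc_subset subspace_ideal I) (auto intro: ideal_mult_right I)
      then show False using less.prems(2) by blast
    qed
    then obtain i d where i: "var i \<notin> A" and d: "homog d \<subseteq> adjoin A (var i)" using False by blast
    define h :: "('i, 'k) mpoly" where "h = var i"
    have h: "h \<in> homog 1" and d: "homog d \<subseteq> adjoin A h" using d by (simp_all add: h_def)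
    have "1 \<notin> adjoin A (h - 1)"
    proof
      assume "1 \<in> adjoin A (h - 1)"
      then obtain n where n: "h ^ n \<in> A"
        using homog_in_dehomogenized_ideal[OF A h, of 1 0] homog_const[of 1] by auto
      have "\<exists>a b. p = a + b * h ^ k \<and> a \<in> A" if "p \<in> homog (d + k)" for p k
        using that
      proof (induction k arbitrary: p)
        case 0
        then show ?case using ideal_0[OF I] by (intro exI[of _ 0] exI[of _ p]) simp
      next
        case (Suc k)
        then have "p \<in> homog (Suc (d + k))" by simp
        then obtain a b where ab: "p = a + b * h" "a \<in> A" "b \<in> homog (d + k)"
          using homog_subset_adjoinD[OF A h d, of "d + k"] by (metis le_add1)
        obtain a' b' where "b = a' + b' * h ^ k" "a' \<in> A" using Suc.IH[OF ab(3)] by blast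
        then have "p = (a + a' * h) + b' * h ^ Suc k" "a + a' * h \<in> A"
          using ab by (auto simp: algebra_simps intro: ideal_add ideal_mult_right ideal_mult I)
        then show ?case by blast
      qed
      then have "homog (d + n) \<subseteq> A"
        using n by (force intro: ideal_add ideal_mult I)
      then show False using less.prems(2) by blast
    qed
    then obtain c where c: "\<forall>p\<in>adjoin A (h - 1). eval_mpoly c p = 0"
      using zero_of_algebraic_ideal[OF adjoin_ideal[OF I]]
        algebraic_modulo_dehomogenized_ideal[OF A h d] by blast
    have "eval_mpoly c (h - 1) = 0" using c gen_in_adjoin[OF I] by blast
    then have "c i = 1" by (simp add: eval_mpoly_subst h_def)
    then show ?thesis
      using c adjoin_superset[of A "h - 1"] by (intro exI[of _ c] conjI exI[of _ i]) auto
  qed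
qed

section \<open>Two forms in four variables have a common zero\<close>

lemma UNIV_4_eq: "(UNIV :: 4 set) = {0, 1, 2, 3}"
proof -
  have "{0, 1, 2, 3 :: 4} = UNIV" by (rule card_subset_eq) simp_all
  then show ?thesis by (rule sym)
qed

lemma sum_4_eq: "(\<Sum>i\<in>UNIV. f (i :: 4)) = f 0 + f 1 + f 2 + f 3"
  unfolding UNIV_4_eq by (simp add: ac_simps)

definition mon4 :: "nat \<Rightarrow> nat \<times> nat \<times> nat \<Rightarrow> 4 mon" where
  "mon4 n = (\<lambda>(a, b, c). single 0 a + single 1 b + single 2 c + single 3 (n - a - b - c))"

lemma card_mon_le:
  assumes "\<And>a b c. (a, b, c) \<in> S \<Longrightarrow> a + b + c \<le> n"
  shows "card S \<le> card {m :: 4 mon. mdeg m = n}"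
proof (rule card_inj_on_le)
  show "inj_on (mon4 n) S"
  proof (rule inj_onI)
    fix s s' assume eq: "mon4 n s = mon4 n s'"
    obtain a b c a' b' c' where s: "s = (a, b, c)" "s' = (a', b', c')" by (cases s, cases s') auto
    have "lookup (mon4 n (a, b, c)) i = lookup (mon4 n (a', b', c')) i" for i using eq by (simp add: s)
    from this[of 0] this[of 1] this[of 2] show "s = s'"
      by (simp add: s mon4_def lookup_add lookup_single when_def)
  qed
  show "mon4 n ` S \<subseteq> {m. mdeg m = n}" using assms by (fastforce simp: mon4_def)
qed (rule finite_mdeg)

lemma independent_monomials:
  fixes M :: "'a set"
  assumes M: "finite M"
  shows "K_space.independent ((\<lambda>m. single m (1::'k::field)) ` M)"
proof (rule K_space.independent_if_scalars_zero)
  fix f :: "('a \<Rightarrow>\<^sub>0 'k) \<Rightarrow> 'k" and x :: "'a \<Rightarrow>\<^sub>0 'k"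
  assume sum: "(\<Sum>x\<in>(\<lambda>m. single m 1) ` M. smul (f x) x) = 0"
    and "x \<in> (\<lambda>m. single m 1) ` M"
  then obtain m where m: "m \<in> M" "x = single m 1" by auto
  have inj: "inj_on (\<lambda>m. single m (1::'k)) M"
    by (rule inj_onI) (metis keys_single singleton_inject zero_neq_one)
  have "0 = lookup (\<Sum>n\<in>M. smul (f (single n 1)) (single n 1)) m"
    using sum by (simp add: sum.reindex[OF inj])
  also have "\<dots> = (\<Sum>n\<in>M. if n = m then f (single n 1) else 0)"
    unfolding lookup_sum by (intro sum.cong) (auto simp: lookup_single when_def)
  also have "\<dots> = f x" using m M by simp
  finally show "f x = 0" ..
qed (simp add: M)

text \<open>
  If all forms of large degree were combinations of \<open>G\<close> and \<open>H\<close>, repeated expansion would write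
  every form of degree \<open>e\<close> in terms of \<open>O(e\<^sup>2)\<close> products of powers of \<open>G\<close> and \<open>H\<close> with monomials of
  bounded degree, while there are of the order of \<open>e\<^sup>3\<close> monomials of degree \<open>e\<close>.
\<close>

theorem two_forms_common_zero:
  fixes G H :: "(4, 'k::alg_closed_field) mpoly"
  assumes G: "G \<in> homog a" "0 < a" and H: "H \<in> homog b" "0 < b"
  shows "\<exists>c. (\<exists>i. c i \<noteq> 0) \<and> eval_mpoly c G = 0 \<and> eval_mpoly c H = 0"
proof -
  define A where "A = adjoin (adjoin {0} G) H"
  have id0: "homogeneous_ideal {0 :: (4, 'k) mpoly}"
    by (simp add: homogeneous_ideal_def poly_ideal_def)
  have A: "homogeneous_ideal A"
    unfolding A_def by (intro adjoin_homogeneous[of _ _ b] adjoin_homogeneous[of _ _ a] id0 G H)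
  have GH: "G \<in> A" "H \<in> A"
    using adjoin_superset gen_in_adjoin adjoin_ideal homogeneous_ideal_ideal[OF id0]
    unfolding A_def by blast+
  have "\<not> homog d \<subseteq> A" for d
  proof
    assume d: "homog d \<subseteq> A"
    define S where "S e = (\<lambda>(i, j, m). G ^ i * H ^ j * single m 1) ` ({..e} \<times> {..e} \<times> {m. mdeg m < d})" for e
    have S_mult: "p * Q \<in> K_space.span (S e)"
      if "p \<in> K_space.span (S e')" "Q = G \<or> Q = H" "e' < e" for p Q e e'
      using that(1)
    proof (induction rule: K_space.span_induct)
      case base
      have "smul c x * Q = smul c (x * Q)" for c x by (simp add: smul_conv mult.assoc)
      then show ?case
        by (simp add: K_space.subspace_def K_space.span_zero K_space.span_add K_space.span_scale
            distrib_right)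
    next
      case (step x)
      then obtain i j m where x: "x = G ^ i * H ^ j * single m 1" "i \<le> e'" "j \<le> e'" "mdeg m < d"
        by (auto simp: S_def)
      have "x * Q = G ^ Suc i * H ^ j * single m 1 \<or> x * Q = G ^ i * H ^ Suc j * single m 1"
        using that(2) by (auto simp: x(1) algebra_simps)
      then have "x * Q \<in> S e"
        unfolding S_def image_iff using x(2-4) that(3)
        by (elim disjE) (rule bexI[of _ "(Suc i, j, m)"] bexI[of _ "(i, Suc j, m)"]; simp; fail)+
      then show ?case by (rule K_space.span_base)
    qed
    have span: "p \<in> K_space.span (S e)" if "p \<in> homog e" for p e
      using that
    proof (induction e arbitrary: p rule: less_induct)
      case (less e)
      show ?case
      proof (cases "e < d")
        case True
        have "single m (lookup p m) \<in> K_space.span (S e)" if "m \<in> keys p" for m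
        proof -
          have "mdeg m < d" using less.prems that True by (auto simp: homog_def)
          then have "single m 1 \<in> S e" unfolding S_def by force
          then have "smul (lookup p m) (single m 1) \<in> K_space.span (S e)"
            by (intro K_space.span_scale K_space.span_base)
          then show ?thesis by (simp add: smul_conv const_def mult_single)
        qed
        then have "(\<Sum>m\<in>keys p. single m (lookup p m)) \<in> K_space.span (S e)"
          by (intro K_space.span_sum)
        then show ?thesis by (simp flip: poly_mapping_sum_single)
      next
        case False
        then have "homog e \<subseteq> A"
          by (intro homog_subset_mono[OF homogeneous_ideal_ideal[OF A] d]) simp
        then obtain g h where gh: "p = g * G + h * H"
          using less.prems by (auto simp: A_def adjoin_def)
        have "p = hom_comp e (g * G + h * H)" using less.prems gh by (simp add: hom_comp_of_homog)
        then have p: "p = (if e < a then 0 else hom_comp (e - a) g * G) + (if e < b then 0 else hom_comp (e - b) h * H)"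
          by (simp add: hom_comp_add hom_comp_mult_homog_cases[OF G(1)] hom_comp_mult_homog_cases[OF H(1)])
        have "hom_comp (e - a) g * G \<in> K_space.span (S e)" if "\<not> e < a"
          using that G(2) by (intro S_mult[OF less.IH[OF _ hom_comp_homog]]) auto
        moreover have "hom_comp (e - b) h * H \<in> K_space.span (S e)" if "\<not> e < b"
          using that H(2) by (intro S_mult[OF less.IH[OF _ hom_comp_homog]]) auto
        ultimately show ?thesis
          by (subst p) (auto intro!: K_space.span_add K_space.span_zero)
      qed
    qed
    have "{m :: 4 mon. mdeg m < d} = (\<Union>k<d. {m. mdeg m = k})" by auto
    then have fin: "finite {m :: 4 mon. mdeg m < d}" by (simp add: finite_mdeg)
    define N where "N = card {m :: 4 mon. mdeg m < d}"
    have cardS: "finite (S e)" "card (S e) \<le> (e + 1) * ((e + 1) * N)" for e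
      using card_image_le[of "{..e} \<times> {..e} \<times> {m :: 4 mon. mdeg m < d}"] fin
      by (auto simp: S_def card_cartesian_product N_def)
    have bound: "card {m :: 4 mon. mdeg m = e} \<le> (e + 1) * ((e + 1) * N)" for e
    proof -
      let ?T = "(\<lambda>m. single m (1::'k)) ` {m :: 4 mon. mdeg m = e}"
      have inj: "inj_on (\<lambda>m. single m (1::'k)) {m :: 4 mon. mdeg m = e}"
        by (rule inj_onI) (metis keys_single singleton_inject zero_neq_one)
      have "?T \<subseteq> K_space.span (S e)" by (auto intro!: span homog_single)
      then have "card ?T \<le> card (S e)"
        using K_space.independent_span_bound[OF cardS(1) independent_monomials[OF finite_mdeg]] by blast
      then show ?thesis using cardS(2)[of e] card_image[OF inj] by simp
    qed
    define n where "n = 9 * N"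
    have "(n + 1) ^ 3 = card ({..n} \<times> {..n} \<times> {..n})"
      by (simp add: card_cartesian_product power3_eq_cube)
    also have "\<dots> \<le> card {m :: 4 mon. mdeg m = 3 * n}" by (rule card_mon_le) auto
    also have "\<dots> \<le> (3 * n + 1) * ((3 * n + 1) * N)" by (rule bound)
    also have "\<dots> \<le> (3 * (n + 1)) * ((3 * (n + 1)) * N)" by (intro mult_mono) auto
    also have "\<dots> = (n + 1) ^ 2 * n" by (simp add: n_def power2_eq_square algebra_simps)
    also have "\<dots> < (n + 1) ^ 2 * (n + 1)" by simp
    also have "\<dots> = (n + 1) ^ 3" by (simp only: power3_eq_cube power2_eq_square)
    finally show False by simp
  qed
  from projective_Nullstellensatz[OF A this] show ?thesis using GH by blast
qed

section \<open>Polynomial images of low dimension lie on hypersurfaces\<close>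

text \<open>
  Functions instead of polynomials, so that polynomial expressions in the components of a
  parametrization are formed pointwise. The bound \<open>E\<close> holds for each exponent separately.
\<close>

definition polyfun_deg :: "'p set \<Rightarrow> nat \<Rightarrow> (('p \<Rightarrow> 'k::field) \<Rightarrow> 'k) set" where
  "polyfun_deg X E = {f. \<exists>c. \<forall>x. f x = (\<Sum>\<beta>\<in>PiE X (\<lambda>_. {..E}). c \<beta> * (\<Prod>i\<in>X. x i ^ \<beta> i))}"

definition polyfun :: "'p set \<Rightarrow> (('p \<Rightarrow> 'k::field) \<Rightarrow> 'k) set" where
  "polyfun X = (\<Union>E. polyfun_deg X E)"

context
  fixes X :: "'p set"
  assumes X: "finite X"
begin

lemma polyfun_deg_add: "f \<in> polyfun_deg X E \<Longrightarrow> g \<in> polyfun_deg X E \<Longrightarrow> (\<lambda>x. f x + g x) \<in> polyfun_deg X E"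
proof -
  assume "f \<in> polyfun_deg X E" "g \<in> polyfun_deg X E"
  then obtain c d where
    "\<forall>x. f x = (\<Sum>\<beta>\<in>PiE X (\<lambda>_. {..E}). c \<beta> * (\<Prod>i\<in>X. x i ^ \<beta> i))"
    "\<forall>x. g x = (\<Sum>\<beta>\<in>PiE X (\<lambda>_. {..E}). d \<beta> * (\<Prod>i\<in>X. x i ^ \<beta> i))"
    by (auto simp: polyfun_deg_def)
  then show ?thesis unfolding polyfun_deg_def
    by (intro CollectI exI[of _ "\<lambda>\<beta>. c \<beta> + d \<beta>"]) (simp add: distrib_right sum.distrib)
qed

lemma polyfun_deg_scale: "f \<in> polyfun_deg X E \<Longrightarrow> (\<lambda>x. a * f x) \<in> polyfun_deg X E"
proof -
  assume "f \<in> polyfun_deg X E"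
  then obtain c where "\<forall>x. f x = (\<Sum>\<beta>\<in>PiE X (\<lambda>_. {..E}). c \<beta> * (\<Prod>i\<in>X. x i ^ \<beta> i))"
    by (auto simp: polyfun_deg_def)
  then show ?thesis unfolding polyfun_deg_def
    by (intro CollectI exI[of _ "\<lambda>\<beta>. a * c \<beta>"]) (simp add: sum_distrib_left mult.assoc)
qed

lemma polyfun_deg_0: "(\<lambda>x. 0) \<in> polyfun_deg X E"
  unfolding polyfun_deg_def by (intro CollectI exI[of _ "\<lambda>_. 0"]) simp

lemma polyfun_deg_sum:
  "(\<And>s. s \<in> S \<Longrightarrow> f s \<in> polyfun_deg X E) \<Longrightarrow> (\<lambda>x. \<Sum>s\<in>S. f s x) \<in> polyfun_deg X E"
  by (induction S rule: infinite_finite_induct) (auto simp: polyfun_deg_0 polyfun_deg_add)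

lemma polyfun_deg_monomial:
  assumes "\<And>i. i \<in> X \<Longrightarrow> \<beta> i \<le> E"
  shows "(\<lambda>x :: 'p \<Rightarrow> 'a::field. \<Prod>i\<in>X. x i ^ \<beta> i) \<in> polyfun_deg X E"
proof -
  let ?B = "PiE X (\<lambda>_. {..E})"
  have fin: "finite ?B" using X by (intro finite_PiE) auto
  have mem: "restrict \<beta> X \<in> ?B" using assms by auto
  have "(\<Sum>\<gamma>\<in>?B. (if \<gamma> = restrict \<beta> X then 1 else 0) * (\<Prod>i\<in>X. x i ^ \<gamma> i)) = (\<Prod>i\<in>X. x i ^ \<beta> i)" for x :: "'p \<Rightarrow> 'a"
  proof -
    have "(\<Sum>\<gamma>\<in>?B. (if \<gamma> = restrict \<beta> X then 1 else 0) * (\<Prod>i\<in>X. x i ^ \<gamma> i)) =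
        (\<Sum>\<gamma>\<in>?B. if \<gamma> = restrict \<beta> X then (\<Prod>i\<in>X. x i ^ restrict \<beta> X i) else 0)"
      by (intro sum.cong) auto
    also have "\<dots> = (\<Prod>i\<in>X. x i ^ restrict \<beta> X i)" using fin mem by simp
    also have "\<dots> = (\<Prod>i\<in>X. x i ^ \<beta> i)" by (intro prod.cong) auto
    finally show ?thesis .
  qed
  then show ?thesis unfolding polyfun_deg_def
    by (intro CollectI exI[of _ "\<lambda>\<gamma>. if \<gamma> = restrict \<beta> X then 1 else 0"]) (simp only: simp_thms)
qed

lemma polyfun_deg_mult:
  assumes "f \<in> polyfun_deg X E" "g \<in> polyfun_deg X E'"
  shows "(\<lambda>x. f x * g x) \<in> polyfun_deg X (E + E')"
proof -
  obtain c d where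
    f: "\<And>x. f x = (\<Sum>\<beta>\<in>PiE X (\<lambda>_. {..E}). c \<beta> * (\<Prod>i\<in>X. x i ^ \<beta> i))" and
    g: "\<And>x. g x = (\<Sum>\<beta>\<in>PiE X (\<lambda>_. {..E'}). d \<beta> * (\<Prod>i\<in>X. x i ^ \<beta> i))"
    using assms by (auto simp: polyfun_deg_def)
  have "(\<lambda>x. f x * g x) = (\<lambda>x. \<Sum>\<beta>\<in>PiE X (\<lambda>_. {..E}). \<Sum>\<gamma>\<in>PiE X (\<lambda>_. {..E'}).
      c \<beta> * d \<gamma> * (\<Prod>i\<in>X. x i ^ (\<beta> i + \<gamma> i)))"
    by (auto simp: f g sum_product power_add prod.distrib algebra_simps intro!: sum.cong)
  also have "\<dots> \<in> polyfun_deg X (E + E')"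
    by (intro polyfun_deg_sum polyfun_deg_scale polyfun_deg_monomial) (auto simp: PiE_def Pi_def intro!: add_mono)
  finally show ?thesis .
qed

lemma polyfun_deg_const: "(\<lambda>x. a) \<in> polyfun_deg X E"
  using polyfun_deg_scale[OF polyfun_deg_monomial[of "\<lambda>_. 0" E], of a] by simp

lemma polyfun_deg_mono: "E \<le> E' \<Longrightarrow> f \<in> polyfun_deg X E \<Longrightarrow> f \<in> polyfun_deg X E'"
  using polyfun_deg_mult[OF _ polyfun_deg_const, of f E 1 "E' - E"] by simp

lemma polyfun_deg_power: "f \<in> polyfun_deg X E \<Longrightarrow> (\<lambda>x. f x ^ n) \<in> polyfun_deg X (n * E)"
  by (induction n) (auto intro: polyfun_deg_const polyfun_deg_mult)

lemma polyfun_deg_prod: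
  "(\<And>s. s \<in> S \<Longrightarrow> f s \<in> polyfun_deg X E) \<Longrightarrow> (\<lambda>x. \<Prod>s\<in>S. f s x) \<in> polyfun_deg X (card S * E)"
  by (induction S rule: infinite_finite_induct) (auto intro: polyfun_deg_const polyfun_deg_mult)

lemma polyfun_const: "(\<lambda>x. a) \<in> polyfun X"
  using polyfun_deg_const by (auto simp: polyfun_def)

lemma polyfun_coord: "i \<in> X \<Longrightarrow> (\<lambda>x. x i :: 'a::field) \<in> polyfun X"
proof -
  assume i: "i \<in> X"
  have "(\<lambda>x. \<Prod>j\<in>X. x j ^ (if j = i then 1 else 0)) \<in> polyfun_deg X 1"
    by (intro polyfun_deg_monomial) auto
  also have "(\<lambda>x. \<Prod>j\<in>X. x j ^ (if j = i then 1 else 0)) = (\<lambda>x. x i :: 'a)"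
    using i X by (auto simp: if_distrib prod.delta cong: if_cong)
  finally show ?thesis by (auto simp: polyfun_def)
qed

lemma polyfun_mult: "f \<in> polyfun X \<Longrightarrow> g \<in> polyfun X \<Longrightarrow> (\<lambda>x. f x * g x) \<in> polyfun X"
  using polyfun_deg_mult by (fastforce simp: polyfun_def)

lemma polyfun_add: "f \<in> polyfun X \<Longrightarrow> g \<in> polyfun X \<Longrightarrow> (\<lambda>x. f x + g x) \<in> polyfun X"
proof -
  assume "f \<in> polyfun X" "g \<in> polyfun X"
  then obtain E E' where "f \<in> polyfun_deg X E" "g \<in> polyfun_deg X E'" by (auto simp: polyfun_def)
  then have "f \<in> polyfun_deg X (max E E')" "g \<in> polyfun_deg X (max E E')"
    using polyfun_deg_mono by (meson max.cobounded1 max.cobounded2)+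
  then show ?thesis using polyfun_deg_add by (auto simp: polyfun_def)
qed

lemma polyfun_uminus: "f \<in> polyfun X \<Longrightarrow> (\<lambda>x. - f x) \<in> polyfun X"
  using polyfun_mult[OF polyfun_const[of "- 1"]] by simp

lemma polyfun_sum: "(\<And>s. s \<in> S \<Longrightarrow> f s \<in> polyfun X) \<Longrightarrow> (\<lambda>x. \<Sum>s\<in>S. f s x) \<in> polyfun X"
  by (induction S rule: infinite_finite_induct) (auto simp: polyfun_const polyfun_add)

end

lemma polyfun_common_degree:
  assumes "finite S" "\<And>s. s \<in> S \<Longrightarrow> finite (X s)" "\<And>s. s \<in> S \<Longrightarrow> f s \<in> polyfun (X s)"
  shows "\<exists>E. \<forall>s\<in>S. f s \<in> polyfun_deg (X s) E"
proof -
  have "\<forall>s\<in>S. \<exists>E. f s \<in> polyfun_deg (X s) E" using assms(3) by (auto simp: polyfun_def)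
  then obtain E where E: "\<forall>s\<in>S. f s \<in> polyfun_deg (X s) (E s)" by metis
  have "f s \<in> polyfun_deg (X s) (Max (E ` S))" if "s \<in> S" for s
  proof -
    have "E s \<le> Max (E ` S)" using that assms(1) by simp
    with E that show ?thesis by (blast intro: polyfun_deg_mono[OF assms(2)[OF that]])
  qed
  then show ?thesis by blast
qed

text \<open>
  The \<open>D\<^sup>K\<close> monomials with exponents below \<open>D\<close> in \<open>K\<close> coordinates become, after substitution of
  a parametrization by fewer than \<open>K\<close> parameters, members of a space whose dimension is at most a
  constant times \<open>D\<^bsup>K-1\<^esup>\<close>; so they are dependent for large \<open>D\<close>, for finitely many
  parametrizations simultaneously.
\<close>

lemma polynomial_vanishing_on_images:
  fixes \<phi> :: "'i \<Rightarrow> 'm \<Rightarrow> ('p \<Rightarrow> 'k::field) \<Rightarrow> 'k"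
  assumes I: "finite I" and M: "finite M" and X: "\<And>i. i \<in> I \<Longrightarrow> finite (X i)" "\<And>i. i \<in> I \<Longrightarrow> card (X i) < card M"
    and \<phi>: "\<And>i m. i \<in> I \<Longrightarrow> m \<in> M \<Longrightarrow> \<phi> i m \<in> polyfun (X i)"
  shows "\<exists>D c. (\<exists>\<alpha>\<in>PiE M (\<lambda>_. {..<D::nat}). c \<alpha> \<noteq> 0) \<and>
    (\<forall>i\<in>I. \<forall>x. (\<Sum>\<alpha>\<in>PiE M (\<lambda>_. {..<D}). c \<alpha> * (\<Prod>m\<in>M. \<phi> i m x ^ \<alpha> m)) = 0)"
proof -
  define K where "K = card M"
  have "\<exists>E. \<forall>s\<in>I \<times> M. \<phi> (fst s) (snd s) \<in> polyfun_deg (X (fst s)) E"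
    using I M X \<phi> by (intro polyfun_common_degree) auto
  then obtain E where E: "\<And>i m. i \<in> I \<Longrightarrow> m \<in> M \<Longrightarrow> \<phi> i m \<in> polyfun_deg (X i) E" by auto
  define C where "C = card I * (K * E + 1) ^ (K - 1)"
  define D where "D = C + 1"
  define N where "N = K * (D * E)"
  let ?A = "PiE M (\<lambda>_. {..<D})"
  let ?B = "\<lambda>i. PiE (X i) (\<lambda>_. {..N})"
  have pf: "(\<lambda>x. \<Prod>m\<in>M. \<phi> i m x ^ \<alpha> m) \<in> polyfun_deg (X i) N" if "i \<in> I" "\<alpha> \<in> ?A" for i \<alpha>
    unfolding N_def K_def
  proof (intro polyfun_deg_prod X that)
    fix m assume m: "m \<in> M"
    have "\<alpha> m * E \<le> D * E" using that m by (intro mult_right_mono) (auto simp: PiE_def Pi_def less_imp_le)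
    then show "(\<lambda>x. \<phi> i m x ^ \<alpha> m) \<in> polyfun_deg (X i) (D * E)"
      by (rule polyfun_deg_mono[OF X(1)[OF that(1)] _
            polyfun_deg_power[OF X(1)[OF that(1)] E[OF that(1) m]]])
  qed

  define a where "a \<alpha> i = (SOME a. \<forall>x. (\<Prod>m\<in>M. \<phi> i m x ^ \<alpha> m) = (\<Sum>\<beta>\<in>?B i. a \<beta> * (\<Prod>j\<in>X i. x j ^ \<beta> j)))" for \<alpha> i
  have a: "(\<Prod>m\<in>M. \<phi> i m x ^ \<alpha> m) = (\<Sum>\<beta>\<in>?B i. a \<alpha> i \<beta> * (\<Prod>j\<in>X i. x j ^ \<beta> j))"
    if "i \<in> I" "\<alpha> \<in> ?A" for \<alpha> i x
  proof -
    have "\<exists>a. \<forall>x. (\<Prod>m\<in>M. \<phi> i m x ^ \<alpha> m) = (\<Sum>\<beta>\<in>?B i. a \<beta> * (\<Prod>j\<in>X i. x j ^ \<beta> j))"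
      using pf[OF that] by (simp add: polyfun_deg_def)
    from someI_ex[OF this] show ?thesis unfolding a_def by (rule spec)
  qed
  let ?Q = "Sigma I ?B"
  have finB: "finite (?B i)" if "i \<in> I" for i using X(1)[OF that] by (intro finite_PiE) auto
  then have finQ: "finite ?Q" using I by auto
  have finA: "finite ?A" using M by (intro finite_PiE) auto
  have "card ?Q < card ?A"
  proof (cases "I = {}")
    case True
    have "0 < D" by (simp add: D_def)
    then show ?thesis using True M by (simp add: card_PiE)
  next
    case False
    then have K: "0 < K" using X(2) unfolding K_def by fastforce
    have "card ?Q = (\<Sum>i\<in>I. card (?B i))" using I finB by simp
    also have "\<dots> = (\<Sum>i\<in>I. (N + 1) ^ card (X i))" using X by (intro sum.cong) (auto simp: card_PiE)
    also have "\<dots> \<le> (\<Sum>i\<in>I. (N + 1) ^ (K - 1))"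
    proof (intro sum_mono power_increasing)
      fix i assume "i \<in> I" then show "card (X i) \<le> K - 1" using X(2)[of i] unfolding K_def by simp
    qed simp
    also have "\<dots> = card I * (N + 1) ^ (K - 1)" by simp
    also have "\<dots> \<le> card I * (D * (K * E + 1)) ^ (K - 1)"
      by (intro mult_left_mono power_mono) (auto simp: N_def D_def algebra_simps)
    also have "\<dots> = C * D ^ (K - 1)"
      unfolding C_def power_mult_distrib by (simp only: mult_ac)
    also have "\<dots> < D * D ^ (K - 1)" by (simp add: D_def)
    also have "\<dots> = D ^ K" using K by (simp flip: power_Suc)
    also have "\<dots> = card ?A" using M by (simp add: card_PiE K_def)
    finally show ?thesis .
  qed
  from underdetermined_system[OF finQ finA this, of "\<lambda>\<alpha> (i, \<beta>). a \<alpha> i \<beta>"] obtain c where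
    c: "\<exists>\<alpha>\<in>?A. c \<alpha> \<noteq> 0" "\<And>i \<beta>. i \<in> I \<Longrightarrow> \<beta> \<in> ?B i \<Longrightarrow> (\<Sum>\<alpha>\<in>?A. c \<alpha> * a \<alpha> i \<beta>) = 0" by auto
  have "(\<Sum>\<alpha>\<in>?A. c \<alpha> * (\<Prod>m\<in>M. \<phi> i m x ^ \<alpha> m)) = 0" if i: "i \<in> I" for i x
  proof -
    have "(\<Sum>\<alpha>\<in>?A. c \<alpha> * (\<Prod>m\<in>M. \<phi> i m x ^ \<alpha> m)) =
        (\<Sum>\<alpha>\<in>?A. \<Sum>\<beta>\<in>?B i. c \<alpha> * a \<alpha> i \<beta> * (\<Prod>j\<in>X i. x j ^ \<beta> j))"
      by (intro sum.cong refl) (simp add: a[OF i] sum_distrib_left mult.assoc)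
    also have "\<dots> = (\<Sum>\<beta>\<in>?B i. (\<Sum>\<alpha>\<in>?A. c \<alpha> * a \<alpha> i \<beta>) * (\<Prod>j\<in>X i. x j ^ \<beta> j))"
      by (subst sum.swap) (simp add: sum_distrib_right)
    also have "\<dots> = 0" using c(2)[OF i] by (intro sum.neutral) auto
    finally show ?thesis .
  qed
  then show ?thesis using c(1) by blast
qed

lemma infinite_field_poly_zero:
  assumes "\<forall>t::'k::field_char_0. poly p t = 0" shows "p = 0"
  using poly_roots_finite[of p] assms infinite_UNIV_char_0 by auto

lemma nonzero_polynomial_value:
  fixes c :: "('m \<Rightarrow> nat) \<Rightarrow> 'k::field_char_0"
  assumes "finite M" "\<exists>\<alpha>\<in>PiE M (\<lambda>_. {..<D}). c \<alpha> \<noteq> 0"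
  shows "\<exists>x. (\<Sum>\<alpha>\<in>PiE M (\<lambda>_. {..<D}). c \<alpha> * (\<Prod>m\<in>M. x m ^ \<alpha> m)) \<noteq> 0"
  using assms
proof (induction M arbitrary: c rule: finite_induct)
  case empty
  then show ?case by simp
next
  case (insert m M)
  have split: "(\<Sum>\<alpha>\<in>PiE (insert m M) (\<lambda>_. {..<D}). c \<alpha> * (\<Prod>m\<in>insert m M. x m ^ \<alpha> m)) =
    (\<Sum>k<D. x m ^ k * (\<Sum>\<alpha>\<in>PiE M (\<lambda>_. {..<D}). c (\<alpha>(m := k)) * (\<Prod>m\<in>M. x m ^ \<alpha> m)))" for x :: "'m \<Rightarrow> 'k"
  proof -
    have "(\<Sum>\<alpha>\<in>PiE (insert m M) (\<lambda>_. {..<D}). c \<alpha> * (\<Prod>m\<in>insert m M. x m ^ \<alpha> m)) =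
      (\<Sum>(k, \<alpha>)\<in>{..<D} \<times> PiE M (\<lambda>_. {..<D}). c (\<alpha>(m := k)) * (\<Prod>m'\<in>insert m M. x m' ^ (\<alpha>(m := k)) m'))"
      using inj_combinator[OF insert.hyps(2), of "\<lambda>_. {..<D}"]
      by (simp only: PiE_insert_eq sum.reindex) (auto intro!: sum.cong)
    also have "\<dots> = (\<Sum>(k, \<alpha>)\<in>{..<D} \<times> PiE M (\<lambda>_. {..<D}). x m ^ k * (c (\<alpha>(m := k)) * (\<Prod>m\<in>M. x m ^ \<alpha> m)))"
    proof (intro sum.cong refl, clarify)
      fix k \<alpha>
      have "(\<Prod>m'\<in>M. x m' ^ (\<alpha>(m := k)) m') = (\<Prod>m\<in>M. x m ^ \<alpha> m)"
        using insert.hyps by (intro prod.cong) auto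
      then show "c (\<alpha>(m := k)) * (\<Prod>m'\<in>insert m M. x m' ^ (\<alpha>(m := k)) m') =
          x m ^ k * (c (\<alpha>(m := k)) * (\<Prod>m\<in>M. x m ^ \<alpha> m))"
        using insert.hyps by simp
    qed
    finally show ?thesis by (simp add: sum.cartesian_product sum_distrib_left)
  qed
  obtain \<alpha> where \<alpha>: "\<alpha> \<in> PiE (insert m M) (\<lambda>_. {..<D})" "c \<alpha> \<noteq> 0" using insert.prems by blast
  then obtain k \<alpha>' where k: "k < D" "\<alpha>' \<in> PiE M (\<lambda>_. {..<D})" "\<alpha> = \<alpha>'(m := k)"
    by (auto simp: PiE_insert_eq)
  from insert.IH[of "\<lambda>\<alpha>. c (\<alpha>(m := k))"] k \<alpha>(2) obtain x where
    x: "(\<Sum>\<alpha>\<in>PiE M (\<lambda>_. {..<D}). c (\<alpha>(m := k)) * (\<Prod>m\<in>M. x m ^ \<alpha> m)) \<noteq> 0" by auto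
  define q where "q = (\<Sum>k<D. monom (\<Sum>\<alpha>\<in>PiE M (\<lambda>_. {..<D}). c (\<alpha>(m := k)) * (\<Prod>m\<in>M. x m ^ \<alpha> m)) k)"
  have "coeff q k \<noteq> 0" using x k(1) by (simp add: q_def coeff_sum)
  then have "q \<noteq> 0" by auto
  then have "\<not> (\<forall>t. poly q t = 0)" by (meson infinite_field_poly_zero)
  then obtain t where t: "poly q t \<noteq> 0" by blast
  have "(\<Prod>m'\<in>M. (x(m := t)) m' ^ \<alpha> m') = (\<Prod>m\<in>M. x m ^ \<alpha> m)" for \<alpha>
    using insert.hyps by (intro prod.cong) auto
  then have "(\<Sum>\<alpha>\<in>PiE (insert m M) (\<lambda>_. {..<D}). c \<alpha> * (\<Prod>m'\<in>insert m M. (x(m := t)) m' ^ \<alpha> m')) = poly q t"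
    unfolding split by (simp add: q_def poly_sum poly_monom mult.commute)
  then show ?case using t by (intro exI[of _ "x(m := t)"]) simp
qed

text \<open>
  A polynomial vanishing on all images vanishes on \<open>Bad\<close>. Since \<open>Bad\<close> is a cone, the homogeneous
  components of that polynomial vanish on it, too, and one of them is not zero.
\<close>

lemma open_set_avoiding_parametrized_cone:
  fixes Bad :: "('v::finite, 'k::field_char_0) dpoly set" and \<phi> :: "'i \<Rightarrow> 'v mon \<Rightarrow> ('p \<Rightarrow> 'k) \<Rightarrow> 'k"
  assumes I: "finite I" and X: "\<And>i. i \<in> I \<Longrightarrow> finite (X i)" "\<And>i. i \<in> I \<Longrightarrow> card (X i) < card {m :: 'v mon. mdeg m = e}"
    and \<phi>: "\<And>i m. i \<in> I \<Longrightarrow> mdeg m = e \<Longrightarrow> \<phi> i m \<in> polyfun (X i)"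
    and Bad: "\<And>F. F \<in> Bad \<Longrightarrow> \<exists>i\<in>I. \<exists>x. \<forall>m. mdeg m = e \<longrightarrow> lookup F m = \<phi> i m x"
    and Bad0: "0 \<in> Bad" and cone: "\<And>F s. F \<in> Bad \<Longrightarrow> smul s F \<in> Bad"
  shows "\<exists>U. zariski_open_forms e U \<and> U \<noteq> {} \<and> U \<inter> Bad = {}"
proof -
  let ?M = "{m :: 'v mon. mdeg m = e}"
  have "\<exists>D c. (\<exists>\<alpha>\<in>PiE ?M (\<lambda>_. {..<D::nat}). c \<alpha> \<noteq> 0) \<and>
    (\<forall>i\<in>I. \<forall>x. (\<Sum>\<alpha>\<in>PiE ?M (\<lambda>_. {..<D}). c \<alpha> * (\<Prod>m\<in>?M. \<phi> i m x ^ \<alpha> m)) = 0)"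
    by (rule polynomial_vanishing_on_images[where X = X]) (use I X \<phi> finite_mdeg in auto)
  then obtain D c where c: "\<exists>\<alpha>\<in>PiE ?M (\<lambda>_. {..<D::nat}). c \<alpha> \<noteq> 0"
    "\<And>i x. i \<in> I \<Longrightarrow> (\<Sum>\<alpha>\<in>PiE ?M (\<lambda>_. {..<D}). c \<alpha> * (\<Prod>m\<in>?M. \<phi> i m x ^ \<alpha> m)) = 0"
    by auto
  let ?A = "PiE ?M (\<lambda>_. {..<D})"
  have finA: "finite ?A" using finite_mdeg by (intro finite_PiE) auto
  obtain \<alpha>0 where \<alpha>0: "\<alpha>0 \<in> ?A" "c \<alpha>0 \<noteq> 0" using c(1) by blast
  define wt where "wt \<alpha> = (\<Sum>m\<in>?M. \<alpha> m)" for \<alpha> :: "'v mon \<Rightarrow> nat"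
  define d where "d = wt \<alpha>0"
  define c' where "c' \<alpha> = (if wt \<alpha> = d then c \<alpha> else 0)" for \<alpha>
  define P where "P = (\<Sum>\<alpha>\<in>?A. const (c' \<alpha>) * (\<Prod>m\<in>?M. var m ^ \<alpha> m))"
  have eval: "eval_mpoly a P = (\<Sum>\<alpha>\<in>?A. c' \<alpha> * (\<Prod>m\<in>?M. a m ^ \<alpha> m))" for a
    by (simp add: P_def eval_mpoly_subst)
  have P: "P \<in> homog d"
    unfolding P_def
  proof (rule homog_sum)
    fix \<alpha>
    have "(\<Prod>m\<in>?M. var m ^ \<alpha> m) \<in> homog (\<Sum>m\<in>?M. \<alpha> m * 1)"
      by (intro homog_prod finite_mdeg homog_power homog_var)
    then show "const (c' \<alpha>) * (\<Prod>m\<in>?M. var m ^ \<alpha> m) \<in> homog d"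
      by (cases "wt \<alpha> = d") (auto simp: c'_def wt_def intro: homog_const_mult)
  qed
  have vanish: "eval_mpoly (lookup F) P = 0" if F: "F \<in> Bad" for F
  proof -
    \<comment> \<open>The values along the line of multiples of \<open>F\<close>, as a polynomial in the multiplier.\<close>
    define q where "q = (\<Sum>\<alpha>\<in>?A. monom (c \<alpha> * (\<Prod>m\<in>?M. lookup F m ^ \<alpha> m)) (wt \<alpha>))"
    have "poly q s = 0" for s
    proof -
      obtain i x where ix: "i \<in> I" "\<And>m. mdeg m = e \<Longrightarrow> lookup (smul s F) m = \<phi> i m x"
        using Bad[OF cone[OF F]] by blast
      have "poly q s = (\<Sum>\<alpha>\<in>?A. c \<alpha> * (\<Prod>m\<in>?M. (s * lookup F m) ^ \<alpha> m))"
        by (simp add: q_def poly_sum poly_monom wt_def power_mult_distrib prod.distrib power_sum mult_ac)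
      also have "\<dots> = (\<Sum>\<alpha>\<in>?A. c \<alpha> * (\<Prod>m\<in>?M. \<phi> i m x ^ \<alpha> m))"
        using ix(2) by (intro sum.cong refl arg_cong2[where f = "(*)"] prod.cong) auto
      also have "\<dots> = 0" by (rule c(2)[OF ix(1)])
      finally show ?thesis .
    qed
    then have "q = 0" by (intro infinite_field_poly_zero allI)
    then have "0 = coeff q d" by simp
    also have "\<dots> = (\<Sum>\<alpha>\<in>?A. c' \<alpha> * (\<Prod>m\<in>?M. lookup F m ^ \<alpha> m))"
      by (auto simp: q_def coeff_sum c'_def intro!: sum.cong)
    finally show ?thesis by (simp add: eval)
  qed
  define U where "U = {F \<in> homog e. F \<noteq> 0 \<and> (\<exists>P'\<in>{P}. eval_mpoly (lookup F) P' \<noteq> 0)}"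
  have "zariski_open_forms e U"
    unfolding zariski_open_forms_def U_def using P by (intro exI[of _ "{P}"]) auto
  moreover have "U \<noteq> {}"
  proof -
    have "\<exists>\<alpha>\<in>?A. c' \<alpha> \<noteq> 0" using \<alpha>0 by (auto simp: c'_def d_def)
    then obtain x where x: "(\<Sum>\<alpha>\<in>?A. c' \<alpha> * (\<Prod>m\<in>?M. x m ^ \<alpha> m)) \<noteq> 0"
      using nonzero_polynomial_value[OF finite_mdeg] by blast
    define F where "F = (\<Sum>m\<in>?M. single m (x m))"
    have look: "lookup F m = (if mdeg m = e then x m else 0)" for m
      by (simp add: F_def lookup_sum lookup_single when_def finite_mdeg)
    have "eval_mpoly (lookup F) P \<noteq> 0" using x by (simp add: eval look)
    moreover from this have "F \<noteq> 0" using vanish[OF Bad0] by auto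
    moreover have "F \<in> homog e" by (rule homogI) (auto simp: look split: if_splits)
    ultimately show ?thesis by (auto simp: U_def)
  qed
  moreover have "U \<inter> Bad = {}" using vanish by (auto simp: U_def)
  ultimately show ?thesis by blast
qed

section \<open>Contraction and pairing\<close>

lemma linear_form_eqI:
  assumes "linear_form f" "linear_form g" "\<And>m. f (single m 1) = g (single m 1)"
  shows "f p = g p"
proof -
  have single: "single m a = smul a (single m 1)" for m and a :: 'b
    by (rule poly_mapping_eqI) (simp add: lookup_single when_def)
  have eq: "f (single m a) = g (single m a)" for m a
    using assms(3)[of m] linear_form_smul[OF assms(1), of a "single m 1"]
      linear_form_smul[OF assms(2), of a "single m 1"] by (simp flip: single)
  have "f (\<Sum>m\<in>keys p. single m (lookup p m)) = g (\<Sum>m\<in>keys p. single m (lookup p m))"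
    by (simp add: linear_form_sum assms(1,2) eq)
  then show ?thesis by (simp flip: poly_mapping_sum_single)
qed

lemma lookup_contract_sum:
  "lookup (contract p F) \<gamma> = (\<Sum>\<alpha>\<in>keys p. lookup p \<alpha> * lookup F (\<alpha> + \<gamma>))"
  for F :: "('i, 'k::field) dpoly"
proof -
  have "(\<Sum>\<beta>\<in>keys F. lookup (if \<forall>i. lookup \<alpha> i \<le> lookup \<beta> i
       then single (\<beta> - \<alpha>) (lookup p \<alpha> * lookup F \<beta>) else 0) \<gamma>) = lookup p \<alpha> * lookup F (\<alpha> + \<gamma>)" for \<alpha>
  proof -
    have iff: "(\<forall>i. lookup \<alpha> i \<le> lookup \<beta> i) \<and> \<beta> - \<alpha> = \<gamma> \<longleftrightarrow> \<beta> = \<alpha> + \<gamma>" for \<beta>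
      by (auto simp: lookup_add lookup_minus poly_mapping_eq_iff fun_eq_iff) (metis le_add_diff_inverse)
    have "(\<Sum>\<beta>\<in>keys F. lookup (if \<forall>i. lookup \<alpha> i \<le> lookup \<beta> i
        then single (\<beta> - \<alpha>) (lookup p \<alpha> * lookup F \<beta>) else 0) \<gamma>) =
      (\<Sum>\<beta>\<in>keys F. if \<beta> = \<alpha> + \<gamma> then lookup p \<alpha> * lookup F (\<alpha> + \<gamma>) else 0)"
    proof (intro sum.cong refl)
      fix \<beta>
      have "lookup (if C then single (\<beta> - \<alpha>) v else 0) \<gamma> = (if C \<and> \<beta> - \<alpha> = \<gamma> then v else (0::'k))" for C v
        by (simp add: lookup_single when_def)
      then show "lookup (if \<forall>i. lookup \<alpha> i \<le> lookup \<beta> i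
          then single (\<beta> - \<alpha>) (lookup p \<alpha> * lookup F \<beta>) else 0) \<gamma> =
        (if \<beta> = \<alpha> + \<gamma> then lookup p \<alpha> * lookup F (\<alpha> + \<gamma>) else 0)"
        by (simp only: iff) auto
    qed
    then show ?thesis by (simp add: in_keys_iff)
  qed
  then show ?thesis by (simp add: contract_def lookup_sum)
qed

lemma pairing_sum: "pairing p F = (\<Sum>\<alpha>\<in>keys p. lookup p \<alpha> * lookup F \<alpha>)"
  by (simp add: pairing_def lookup_contract_sum)

lemma linear_form_pairing: "linear_form (\<lambda>p. pairing p F)"
  by (simp add: linear_form_def pairing_def contract_add contract_smul lookup_add)

lemmas pairing_simps = linear_form_add[OF linear_form_pairing] linear_form_smul[OF linear_form_pairing]
  linear_form_0[OF linear_form_pairing] linear_form_minus[OF linear_form_pairing]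
  linear_form_diff[OF linear_form_pairing] linear_form_sum[OF linear_form_pairing]

lemma pairing_const_mult [simp]: "pairing (const c * p) F = c * pairing p F"
  by (simp add: pairing_simps flip: smul_conv)

lemma pairing_single [simp]: "pairing (single m 1) F = lookup F m"
  by (simp add: pairing_sum)

lemma linear_form_mult:
  fixes q :: "('i, 'k::field) mpoly"
  shows "linear_form f \<Longrightarrow> linear_form (\<lambda>p. f (q * p))"
proof -
  have "q * smul c v = smul c (q * v)" for c v by (simp add: smul_conv mult.left_commute)
  then show "linear_form f \<Longrightarrow> linear_form (\<lambda>p. f (q * p))"
    by (simp add: linear_form_def distrib_left)
qed

lemma lookup_contract: "lookup (contract p F) \<gamma> = pairing (single \<gamma> 1 * p) F"
proof (rule linear_form_eqI[of "\<lambda>p. lookup (contract p F) \<gamma>" "\<lambda>p. pairing (single \<gamma> 1 * p) F"])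
  show "linear_form (\<lambda>p. lookup (contract p F) \<gamma>)"
    by (simp add: linear_form_def contract_add contract_smul lookup_add)
  show "linear_form (\<lambda>p. pairing (single \<gamma> 1 * p) F)"
    by (rule linear_form_mult[OF linear_form_pairing])
  show "lookup (contract (single m 1) F) \<gamma> = pairing (single \<gamma> 1 * single m 1) F" for m
    by (simp add: lookup_contract_sum mult_single add.commute)
qed

lemma pairing_right_add: "pairing p (F + G) = pairing p F + pairing p G"
  and pairing_right_smul: "pairing p (smul c F) = c * pairing p F"
  and pairing_right_0 [simp]: "pairing p 0 = 0"
  by (simp_all add: pairing_sum lookup_add algebra_simps sum.distrib sum_distrib_left)

lemma pairing_right_diff: "pairing p (F - G) = pairing p F - pairing p G"
  by (simp add: pairing_sum lookup_minus algebra_simps sum_subtractf)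

lemma pairing_right_sum: "pairing p (\<Sum>x\<in>A. f x) = (\<Sum>x\<in>A. pairing p (f x))"
  by (induction A rule: infinite_finite_induct) (auto simp: pairing_right_add)

lemma pairing_contract: "pairing q (contract p F) = pairing (q * p) F"
proof (rule linear_form_eqI[of "\<lambda>q. pairing q (contract p F)" "\<lambda>q. pairing (q * p) F"])
  show "linear_form (\<lambda>q. pairing (q * p) F)"
    using linear_form_mult[OF linear_form_pairing, of p F] by (simp add: mult.commute)
qed (simp_all add: linear_form_pairing lookup_contract)

lemma contract_eq_0_iff: "contract p F = 0 \<longleftrightarrow> (\<forall>q. pairing (q * p) F = 0)"
proof
  assume "\<forall>q. pairing (q * p) F = 0"
  then show "contract p F = 0" by (intro poly_mapping_eqI) (simp add: lookup_contract)
qed (simp flip: pairing_contract)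

lemma pairing_degree: "F \<in> homog d \<Longrightarrow> p \<in> homog e \<Longrightarrow> d \<noteq> e \<Longrightarrow> pairing p F = 0"
  unfolding pairing_sum by (intro sum.neutral) (metis homogD mult_eq_0_iff)

lemma pairing_hom_comp:
  assumes "F \<in> homog d" shows "pairing (hom_comp d p) F = pairing p F"
proof -
  have "pairing p F = pairing (\<Sum>e\<le>max d (tdeg p). hom_comp e p) F" by (simp add: sum_hom_comp)
  also have "\<dots> = (\<Sum>e\<le>max d (tdeg p). if e = d then pairing (hom_comp d p) F else 0)"
    unfolding pairing_simps by (intro sum.cong) (auto simp: pairing_degree[OF assms hom_comp_homog])
  finally show ?thesis by simp
qed

lemma pairing_var [simp]: "pairing (var i) l = lin_coeff l i"
  by (simp add: var_def lin_coeff_def)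

lemma pairing_linear:
  assumes "\<Psi> \<in> homog 1"
  shows "pairing \<Psi> l = (\<Sum>i\<in>UNIV. lin_coeff \<Psi> i * lin_coeff l (i::'i::finite))"
  by (subst homog_1_conv[OF assms]) (simp add: pairing_simps)

lemma pairing_var3: "pairing (var a * var b * var c) F = lookup F (single a 1 + single b 1 + single c 1)"
  by (simp add: var_def mult_single)

section \<open>Two conditions on cubic forms, and a generic form satisfies neither\<close>

text \<open>
  For \<open>\<Psi>\<close> in the plane \<open>l\<close>, all of whose products with two elements of the plane pair to zero
  with \<open>F\<close>, the section by \<open>l\<close> is a cone with vertex \<open>\<Psi>\<close>: three concurrent lines if \<open>\<Psi>\<close> is an
  Eckardt point of a smooth surface.
\<close>

definition eckardt :: "(4, 'k::field) dpoly \<Rightarrow> bool" where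
  "eckardt F \<longleftrightarrow> (\<exists>\<Psi>\<in>homog 1. \<exists>l\<in>homog 1. \<Psi> \<noteq> 0 \<and> l \<noteq> 0 \<and> pairing \<Psi> l = 0 \<and>
     (\<forall>z\<in>plane l. \<forall>z'\<in>plane l. pairing (\<Psi> * z * z') F = 0))"

text \<open>
  \<open>F\<close>, as a functional on cubics, factors through restriction to a curve germ
  \<open>t \<mapsto> (A 0, \<dots>, A 3)\<close> modulo \<open>t\<^sup>6\<close>, which is normalised by making one coordinate 1 and
  another \<open>c + t\<close>. This leaves 12 coefficients of the other coordinates, \<open>c\<close>, and the 6 values
  of the functional: 19 parameters, one fewer than the number of coefficients of a cubic form.
\<close>

definition curvilinear :: "(4, 'k::field) dpoly \<Rightarrow> bool" where
  "curvilinear F \<longleftrightarrow> (\<exists>j0 j1 c \<mu> A. j0 \<noteq> j1 \<and> A j0 = 1 \<and> A j1 = [:c, 1:] \<and> (\<forall>j. degree (A j) < 6) \<and>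
     (\<forall>\<beta>. mdeg \<beta> = 3 \<longrightarrow> lookup F \<beta> = (\<Sum>n<6. \<mu> n * coeff (\<Prod>j\<in>UNIV. A j ^ lookup \<beta> j) n)))"

lemma mon_degree_3:
  assumes "mdeg m = 3" shows "\<exists>a b c. m = single a 1 + single b 1 + single c 1"
proof -
  have step: "\<exists>i m'. m = single i 1 + m' \<and> mdeg m' = d" if "mdeg m = Suc d" for m :: "'a mon" and d
  proof -
    have "\<exists>i. lookup m i > 0"
    proof (rule ccontr)
      assume "\<not> ?thesis"
      then have "m = 0" by (intro poly_mapping_eqI) auto
      then show False using that by simp
    qed
    then obtain i where i: "lookup m i > 0" ..
    have "m = single i 1 + (m - single i 1)"
      using i by (intro poly_mapping_eqI) (auto simp: lookup_add lookup_minus lookup_single when_def)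
    moreover from this have "mdeg m = 1 + mdeg (m - single i 1)" by (metis mdeg_add mdeg_single)
    ultimately show ?thesis using that by (metis Suc_eq_plus1_left nat.inject)
  qed
  from assms obtain a m1 where 1: "m = single a 1 + m1" "mdeg m1 = 2" using step[of m 2] by auto
  then obtain b m2 where 2: "m1 = single b 1 + m2" "mdeg m2 = 1" using step[of m1 1] by auto
  then obtain c m3 where 3: "m2 = single c 1 + m3" "mdeg m3 = 0" using step[of m2 0] by auto
  show ?thesis using 1 2 3 by (auto simp: add.assoc)
qed

definition factors3 :: "4 mon \<Rightarrow> 4 \<times> 4 \<times> 4" where
  "factors3 m = (SOME (a, b, c). m = single a 1 + single b 1 + single c 1)"

lemma factors3: "mdeg m = 3 \<Longrightarrow> factors3 m = (a, b, c) \<Longrightarrow> m = single a 1 + single b 1 + single c 1"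
  using mon_degree_3[of m] someI_ex[of "\<lambda>(a, b, c). m = single a 1 + single b 1 + single c 1"]
  by (auto simp: factors3_def)

type_synonym param = "nat \<times> 4 + 4 mon"

text \<open>
  Parameters for \<open>eckardt\<close>, given \<open>i\<close> with \<open>\<Psi>\<^sub>i = 1\<close> and \<open>j \<noteq> i\<close> with \<open>l\<^sub>j = 1\<close>: the other
  coefficients of \<open>\<Psi>\<close>; those of \<open>l\<close>, of which the \<open>i\<close>-th is determined by \<open>\<Psi>(l) = 0\<close>; the
  linear form \<open>m\<close> with \<open>\<Psi>(F) = l m\<close>; and the coefficients of \<open>F\<close> not involving the variable \<open>i\<close>.
  The remaining coefficients of \<open>F\<close> follow by writing the variable \<open>i\<close> as \<open>\<Psi>\<close> minus a
  combination of the others.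
\<close>

definition eck_point :: "4 \<Rightarrow> (param \<Rightarrow> 'k::field) \<Rightarrow> 4 \<Rightarrow> 'k" where
  "eck_point i x k = (if k = i then 1 else x (Inl (0, k)))"

definition eck_plane :: "4 \<Rightarrow> 4 \<Rightarrow> (param \<Rightarrow> 'k::field) \<Rightarrow> 4 \<Rightarrow> 'k" where
  "eck_plane i j x k = (if k = j then 1
     else if k = i then - (\<Sum>k'\<in>UNIV - {i}. eck_point i x k' * (if k' = j then 1 else x (Inl (1, k'))))
     else x (Inl (1, k)))"

definition eck_quad :: "4 \<Rightarrow> 4 \<Rightarrow> (param \<Rightarrow> 'k::field) \<Rightarrow> 4 \<Rightarrow> 4 \<Rightarrow> 'k" where
  "eck_quad i j x a b = eck_plane i j x a * x (Inl (2, b)) + eck_plane i j x b * x (Inl (2, a))"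

definition eck_red :: "4 \<Rightarrow> (param \<Rightarrow> 'k::field) \<Rightarrow> 4 \<Rightarrow> 4 \<Rightarrow> 'k" where
  "eck_red i x a k = (if a = i then - eck_point i x k else if a = k then 1 else 0)"

definition eck_coeff :: "4 \<Rightarrow> 4 \<Rightarrow> 4 \<times> 4 \<times> 4 \<Rightarrow> (param \<Rightarrow> 'k::field) \<Rightarrow> 'k" where
  "eck_coeff i j = (\<lambda>(a, b, c) x.
     (if a = i then eck_quad i j x b c else 0) +
     (if b = i then (\<Sum>k\<in>UNIV - {i}. eck_red i x a k * eck_quad i j x k c) else 0) +
     (if c = i then (\<Sum>k\<in>UNIV - {i}. \<Sum>k'\<in>UNIV - {i}. eck_red i x a k * eck_red i x b k' * eck_quad i j x k k') else 0) +
     (\<Sum>k\<in>UNIV - {i}. \<Sum>k'\<in>UNIV - {i}. \<Sum>k''\<in>UNIV - {i}.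
        eck_red i x a k * eck_red i x b k' * eck_red i x c k'' * x (Inr (single k 1 + single k' 1 + single k'' 1))))"

definition eck_params :: "4 \<Rightarrow> 4 \<Rightarrow> param set" where
  "eck_params i j = Inl ` ({0} \<times> (UNIV - {i}) \<union> {1} \<times> (UNIV - {i, j}) \<union> {2} \<times> UNIV) \<union>
     Inr ` {m. mdeg m = 3 \<and> lookup m i = 0}"

lemma finite_mdeg_and: "finite {m :: 'i::finite mon. mdeg m = d \<and> P m}"
  by (rule finite_subset[OF _ finite_mdeg[of d]]) auto

lemma finite_eck_params: "finite (eck_params i j)"
  by (auto simp: eck_params_def finite_mdeg_and)

lemma eck_coeff_polyfun:
  assumes "i \<noteq> j" shows "eck_coeff i j abc \<in> polyfun (eck_params i j)"
proof -
  let ?X = "eck_params i j"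
  note fin = finite_eck_params[of i j]
  note intros = polyfun_mult[OF fin] polyfun_add[OF fin] polyfun_uminus[OF fin] polyfun_sum[OF fin]
    polyfun_const[OF fin] polyfun_coord[OF fin]
  have mem: "k \<noteq> i \<Longrightarrow> Inl (0, k) \<in> ?X" "k \<noteq> i \<Longrightarrow> k \<noteq> j \<Longrightarrow> Inl (1, k) \<in> ?X" "Inl (2, k) \<in> ?X" for k
    by (auto simp: eck_params_def)
  have pt: "(\<lambda>x. eck_point i x k) \<in> polyfun ?X" for k
    by (cases "k = i") (auto simp: eck_point_def intro!: intros mem)
  have quot: "(\<lambda>x. if k = j then 1 else x (Inl (1, k))) \<in> polyfun ?X" if "k \<noteq> i" for k
    using that mem(2)[of k] by (cases "k = j") (auto intro!: intros)
  have pl: "(\<lambda>x. eck_plane i j x k) \<in> polyfun ?X" for k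
  proof (cases "k = j \<or> k \<noteq> i")
    case True
    then show ?thesis using quot[of k] assms by (cases "k = j") (auto simp: eck_plane_def)
  next
    case False
    then have eq: "(\<lambda>x. eck_plane i j x k) = (\<lambda>x. - (\<Sum>k'\<in>UNIV - {i}.
        eck_point i x k' * (if k' = j then 1 else x (Inl (1, k')))))"
      by (auto simp: eck_plane_def fun_eq_iff)
    show ?thesis unfolding eq by (intro intros pt quot) auto
  qed
  have q: "(\<lambda>x. eck_quad i j x a b) \<in> polyfun ?X" for a b
    unfolding eck_quad_def by (intro intros pl mem)
  have r: "(\<lambda>x. eck_red i x a k) \<in> polyfun ?X" for a k
    unfolding eck_red_def by (cases "a = i"; cases "a = k") (auto intro!: intros pt)
  obtain a b c where abc: "abc = (a, b, c)" by (cases abc)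
  have t1: "(\<lambda>x. if a = i then eck_quad i j x b c else 0) \<in> polyfun ?X"
    by (cases "a = i") (auto intro!: intros q)
  have t2: "(\<lambda>x. if b = i then (\<Sum>k\<in>UNIV - {i}. eck_red i x a k * eck_quad i j x k c) else 0) \<in> polyfun ?X"
    by (cases "b = i") (auto intro!: intros q r)
  have t3: "(\<lambda>x. if c = i then (\<Sum>k\<in>UNIV - {i}. \<Sum>k'\<in>UNIV - {i}.
      eck_red i x a k * eck_red i x b k' * eck_quad i j x k k') else 0) \<in> polyfun ?X"
    by (cases "c = i") (auto intro!: intros q r)
  have t4: "(\<lambda>x. \<Sum>k\<in>UNIV - {i}. \<Sum>k'\<in>UNIV - {i}. \<Sum>k''\<in>UNIV - {i}.
      eck_red i x a k * eck_red i x b k' * eck_red i x c k'' *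
      x (Inr (single k 1 + single k' 1 + single k'' 1))) \<in> polyfun ?X"
    by (intro intros r) (auto simp: eck_params_def lookup_add lookup_single when_def)
  show ?thesis unfolding eck_coeff_def abc prod.case
    by (intro polyfun_add[OF fin] t1 t2 t3 t4)
qed

lemma card_eck_params:
  assumes "i \<noteq> j" shows "card (eck_params i j) < card {m :: 4 mon. mdeg m = 3}"
proof -
  let ?M0 = "{m :: 4 mon. mdeg m = 3 \<and> lookup m i = 0}" and ?M1 = "{m :: 4 mon. mdeg m = 3 \<and> lookup m i \<noteq> 0}"
  let ?Q = "{0::nat} \<times> (UNIV - {i}) \<union> {1} \<times> (UNIV - {i, j}) \<union> {2} \<times> UNIV"
  have "card ?Q \<le> card ({0::nat} \<times> (UNIV - {i})) + card ({1::nat} \<times> (UNIV - {i, j})) + card ({2::nat} \<times> (UNIV :: 4 set))"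
    by (intro order_trans[OF card_Un_le] add_right_mono card_Un_le)
  also have "\<dots> = 9" using assms by (simp add: card_cartesian_product card_Diff_subset)
  finally have Q: "card ?Q \<le> 9" .
  have "card (eck_params i j) \<le> card (Inl ` ?Q :: param set) + card (Inr ` ?M0 :: param set)"
    unfolding eck_params_def by (rule card_Un_le)
  also have "card (Inl ` ?Q :: param set) \<le> card ?Q" by (rule card_image_le) auto
  also have "card (Inr ` ?M0 :: param set) \<le> card ?M0" by (rule card_image_le) (rule finite_mdeg_and)
  finally have le: "card (eck_params i j) \<le> 9 + card ?M0" using Q by simp
  have "10 = card (set [(a, b, c). a \<leftarrow> [0..<3::nat], b \<leftarrow> [0..<3::nat], c \<leftarrow> [0..<3::nat], a + b + c \<le> 2])"
    by code_simp
  also have "\<dots> \<le> card {m :: 4 mon. mdeg m = 2}" by (rule card_mon_le) auto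
  also have "\<dots> \<le> card ?M1"
    by (rule card_inj_on_le[of "\<lambda>m. m + single i 1"])
      (auto intro!: inj_onI simp: finite_mdeg_and lookup_add)
  finally have M1: "10 \<le> card ?M1" .
  have "{m :: 4 mon. mdeg m = 3} = ?M0 \<union> ?M1" by auto
  then have "card {m :: 4 mon. mdeg m = 3} = card ?M0 + card ?M1"
    by (simp add: card_Un_disjoint finite_mdeg_and disjoint_iff)
  then show ?thesis using le M1 by simp
qed

lemma eckardt_parametrized:
  assumes "eckardt (F :: (4, 'k::field_char_0) dpoly)"
  shows "\<exists>i j x. i \<noteq> j \<and> (\<forall>m. mdeg m = 3 \<longrightarrow> lookup F m = eck_coeff i j (factors3 m) x)"
proof -
  obtain \<Psi>0 l0 where 0: "\<Psi>0 \<in> homog 1" "l0 \<in> homog 1" "\<Psi>0 \<noteq> 0" "l0 \<noteq> 0" "pairing \<Psi>0 l0 = 0"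
    "\<And>z z'. z \<in> plane l0 \<Longrightarrow> z' \<in> plane l0 \<Longrightarrow> pairing (\<Psi>0 * z * z') F = 0"
    using assms by (auto simp: eckardt_def)
  obtain i where i: "lin_coeff \<Psi>0 i \<noteq> 0"
    using homog_1_eqI[OF 0(1) homog_0] 0(3) by auto
  define \<Psi> where "\<Psi> = const (inverse (lin_coeff \<Psi>0 i)) * \<Psi>0"
  have \<Psi>: "\<Psi> \<in> homog 1" "lin_coeff \<Psi> i = 1" using 0 i by (auto simp: \<Psi>_def homog_const_mult)
  have "\<exists>j. j \<noteq> i \<and> lin_coeff l0 j \<noteq> 0"
  proof (rule ccontr)
    assume "\<not> ?thesis"
    then have z: "lin_coeff l0 j = 0" if "j \<noteq> i" for j using that by blast
    have "pairing \<Psi>0 l0 = (\<Sum>k\<in>UNIV. if k = i then lin_coeff \<Psi>0 i * lin_coeff l0 i else 0)"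
      unfolding pairing_linear[OF 0(1)] by (intro sum.cong) (auto simp: z)
    then have "lin_coeff l0 i = 0" using 0(5) i by simp
    then have "l0 = 0" using z by (intro homog_1_eqI[OF 0(2) homog_0]) (metis lin_coeff_simps(5))
    then show False using 0 by simp
  qed
  then obtain j where j: "j \<noteq> i" "lin_coeff l0 j \<noteq> 0" by blast
  define l where "l = smul (inverse (lin_coeff l0 j)) l0"
  have l: "l \<in> homog 1" "lin_coeff l j = 1" using 0 j by (auto simp: l_def homog_smul)
  have \<Psi>l: "pairing \<Psi> l = 0" by (simp add: \<Psi>_def l_def pairing_right_smul 0)
  have plane: "z \<in> plane l0" if "z \<in> plane l" for z
    using that j by (simp add: plane_def l_def pairing_right_smul)
  have van: "pairing (\<Psi> * z * z') F = 0" if "z \<in> plane l" "z' \<in> plane l" for z z'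
    using 0(6)[OF plane[OF that(1)] plane[OF that(2)]] by (simp add: \<Psi>_def mult.assoc)
  define h :: "(4, 'k) mpoly" where "h = var j"
  \<comment> \<open>The quadratic form \<open>\<Psi>(F)\<close> vanishes on the plane \<open>l\<close>, so it is \<open>l M\<close>; the summand with \<open>h * h\<close> is shared evenly by the two factors of a product.\<close>
  define M where "M v = pairing (\<Psi> * h * v) F - pairing v l * pairing (\<Psi> * h * h) F / 2" for v
  have lh: "pairing h l = 1" using l by (simp add: h_def)
  have prod: "pairing (\<Psi> * u * v) F = pairing u l * M v + pairing v l * M u"
    if "u \<in> homog 1" "v \<in> homog 1" for u v
  proof -
    have "pairing (\<Psi> * (u - const (pairing u l) * h) * (v - const (pairing v l) * h)) F = 0"
      using that lh homog_var[of j]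
      by (intro van) (auto simp: plane_def pairing_simps h_def intro!: homog_diff homog_const_mult)
    moreover have "\<Psi> * (u - const (pairing u l) * h) * (v - const (pairing v l) * h) =
        \<Psi> * u * v - const (pairing u l) * (\<Psi> * h * v) - const (pairing v l) * (\<Psi> * h * u)
          + const (pairing u l * pairing v l) * (\<Psi> * h * h)"
      by (simp add: algebra_simps const_mult)
    ultimately have "pairing (\<Psi> * u * v - const (pairing u l) * (\<Psi> * h * v) - const (pairing v l) * (\<Psi> * h * u)
          + const (pairing u l * pairing v l) * (\<Psi> * h * h)) F = 0" by metis
    then have eq: "pairing (\<Psi> * u * v) F - pairing u l * pairing (\<Psi> * h * v) F - pairing v l * pairing (\<Psi> * h * u) F
          + pairing u l * pairing v l * pairing (\<Psi> * h * h) F = 0"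
      by (simp only: pairing_simps pairing_const_mult)
    define w where "w = pairing (\<Psi> * h * h) F / 2"
    then have w: "pairing (\<Psi> * h * h) F = 2 * w" by (simp add: mult.commute)
    have M: "M u = pairing (\<Psi> * h * u) F - pairing u l * w" for u by (simp add: M_def w_def)
    show ?thesis using eq unfolding M w by algebra
  qed
  define x :: "param \<Rightarrow> 'k" where "x p = (case p of
      Inl (n, k) \<Rightarrow> if n = 0 then lin_coeff \<Psi> k else if n = 1 then lin_coeff l k else M (var k)
    | Inr m \<Rightarrow> lookup F m)" for p
  have pt: "eck_point i x k = lin_coeff \<Psi> k" for k by (simp add: eck_point_def x_def \<Psi>)
  have pl: "eck_plane i j x k = lin_coeff l k" for k
  proof -
    have "0 = (\<Sum>k\<in>UNIV. lin_coeff \<Psi> k * lin_coeff l k)" using \<Psi>l pairing_linear[OF \<Psi>(1)] by metis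
    also have "\<dots> = lin_coeff l i + (\<Sum>k\<in>UNIV - {i}. lin_coeff \<Psi> k * lin_coeff l k)"
      by (subst sum.remove[of _ i]) (auto simp: \<Psi>)
    finally have "lin_coeff l i = - (\<Sum>k\<in>UNIV - {i}. lin_coeff \<Psi> k * lin_coeff l k)"
      by (simp add: eq_neg_iff_add_eq_0)
    moreover have "(if k' = j then 1 else x (Inl (1, k'))) = lin_coeff l k'" for k' by (simp add: x_def l)
    ultimately show ?thesis by (auto simp: eck_plane_def pt x_def l)
  qed
  have quad: "eck_quad i j x a b = pairing (\<Psi> * var a * var b) F" for a b
    by (simp add: eck_quad_def pl prod x_def)
  define r where "r a = (\<Sum>k\<in>UNIV - {i}. const (eck_red i x a k) * var k)" for a
  have var_eq: "var a = (if a = i then \<Psi> else 0) + r a" for a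
  proof (cases "a = i")
    case True
    have "\<Psi> = (\<Sum>k\<in>UNIV. const (lin_coeff \<Psi> k) * var k)"
      using homog_1_conv[OF \<Psi>(1)] by (simp add: smul_conv)
    also have "\<dots> = var i + (\<Sum>k\<in>UNIV - {i}. const (lin_coeff \<Psi> k) * var k)"
      by (subst sum.remove[of _ i]) (auto simp: \<Psi>)
    finally have "var i = \<Psi> - (\<Sum>k\<in>UNIV - {i}. const (lin_coeff \<Psi> k) * var k)"
      by (simp only: eq_diff_eq)
    then show ?thesis using True
      by (simp add: r_def eck_red_def pt const_minus sum_negf)
  next
    case False
    have "r a = (\<Sum>k\<in>UNIV - {i}. if a = k then var k else 0)"
      unfolding r_def using False by (intro sum.cong) (auto simp: eck_red_def)
    then show ?thesis using False by simp
  qed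
  have main: "pairing (var a * var b * var c) F = eck_coeff i j (a, b, c) x" for a b c
  proof -
    have e: "var a * var b * var c = (if a = i then \<Psi> * var b * var c else 0) +
        (if b = i then \<Psi> * r a * var c else 0) + (if c = i then \<Psi> * r a * r b else 0) + r a * r b * r c"
    proof -
      define e where "e a = (if a = i then \<Psi> else 0)" for a
      have "var a = e a + r a" "var b = e b + r b" "var c = e c + r c"
        using var_eq by (simp_all add: e_def)
      then have "var a * var b * var c =
          e a * var b * var c + e b * r a * var c + e c * r a * r b + r a * r b * r c" by algebra
      then show ?thesis by (simp add: e_def if_distrib[of "\<lambda>p. p * _"] cong: if_cong)
    qed
    have rl: "pairing (r a * q) F = (\<Sum>k\<in>UNIV - {i}. eck_red i x a k * pairing (var k * q) F)" for a q
      by (simp add: r_def sum_distrib_right pairing_simps mult.assoc)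
    have "\<Psi> * r a * var c = r a * (\<Psi> * var c)" by (simp only: mult_ac)
    then have "pairing (\<Psi> * r a * var c) F = pairing (r a * (\<Psi> * var c)) F" by (rule arg_cong)
    then have p2: "pairing (\<Psi> * r a * var c) F = (\<Sum>k\<in>UNIV - {i}. eck_red i x a k * eck_quad i j x k c)"
      unfolding rl by (simp only: quad mult_ac)
    have "\<Psi> * r a * r b = r a * (r b * \<Psi>)" by (simp only: mult_ac)
    then have "pairing (\<Psi> * r a * r b) F = pairing (r a * (r b * \<Psi>)) F" by (rule arg_cong)
    also have "\<dots> = (\<Sum>k\<in>UNIV - {i}. eck_red i x a k * pairing (r b * (var k * \<Psi>)) F)"
      unfolding rl[of a] by (simp only: mult.left_commute)
    finally have p3: "pairing (\<Psi> * r a * r b) F = (\<Sum>k\<in>UNIV - {i}. \<Sum>k'\<in>UNIV - {i}.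
        eck_red i x a k * eck_red i x b k' * eck_quad i j x k k')"
      unfolding rl by (simp add: sum_distrib_left quad mult_ac)
    have "r a * r b * r c = r a * (r b * r c)" by (simp only: mult_ac)
    then have "pairing (r a * r b * r c) F = pairing (r a * (r b * r c)) F" by (rule arg_cong)
    also have "\<dots> = (\<Sum>k\<in>UNIV - {i}. eck_red i x a k * pairing (r b * (r c * var k)) F)"
      unfolding rl[of a] by (simp only: mult_ac)
    also have "\<dots> = (\<Sum>k\<in>UNIV - {i}. eck_red i x a k *
        (\<Sum>k'\<in>UNIV - {i}. eck_red i x b k' * pairing (r c * (var k * var k')) F))"
      unfolding rl[of b] by (simp only: mult_ac)
    also have "\<dots> = (\<Sum>k\<in>UNIV - {i}. \<Sum>k'\<in>UNIV - {i}. \<Sum>k''\<in>UNIV - {i}.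
        eck_red i x a k * eck_red i x b k' * eck_red i x c k'' * pairing (var k * var k' * var k'') F)"
      unfolding rl[of c] by (simp add: sum_distrib_left mult_ac)
    finally have p4: "pairing (r a * r b * r c) F = (\<Sum>k\<in>UNIV - {i}. \<Sum>k'\<in>UNIV - {i}. \<Sum>k''\<in>UNIV - {i}.
        eck_red i x a k * eck_red i x b k' * eck_red i x c k'' *
        x (Inr (single k 1 + single k' 1 + single k'' 1)))"
      unfolding pairing_var3 by (simp add: x_def)
    show ?thesis unfolding e eck_coeff_def prod.case
      by (simp add: pairing_simps p2 p3 p4 quad)
  qed
  have "lookup F m = eck_coeff i j (factors3 m) x" if m: "mdeg m = 3" for m
  proof -
    obtain a b c where abc: "factors3 m = (a, b, c)" by (cases "factors3 m")
    show ?thesis unfolding abc using main[of a b c] factors3[OF m abc] by (simp add: pairing_var3)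
  qed
  then show ?thesis using j(1) by (intro exI[of _ i] exI[of _ j] exI[of _ x]) auto
qed

definition curv_germ :: "4 \<Rightarrow> 4 \<Rightarrow> (param \<Rightarrow> 'k::field) \<Rightarrow> 4 \<Rightarrow> 'k poly" where
  "curv_germ j0 j1 x j = (if j = j0 then 1 else if j = j1 then [:x (Inl (0, j1)), 1:]
     else (\<Sum>n<6. monom (x (Inl (n, j))) n))"

definition curv_coeff :: "4 \<Rightarrow> 4 \<Rightarrow> 4 mon \<Rightarrow> (param \<Rightarrow> 'k::field) \<Rightarrow> 'k" where
  "curv_coeff j0 j1 m x = (\<Sum>n<6. x (Inl (n, j0)) * coeff (\<Prod>j\<in>UNIV. curv_germ j0 j1 x j ^ lookup m j) n)"

definition curv_params :: "4 \<Rightarrow> 4 \<Rightarrow> param set" where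
  "curv_params j0 j1 = Inl ` ({..<6} \<times> (UNIV - {j1}) \<union> {(0, j1)})"

lemma curv_coeff_polyfun:
  assumes "j0 \<noteq> j1"
  shows "(curv_coeff j0 j1 m :: (param \<Rightarrow> 'k::field) \<Rightarrow> 'k) \<in> polyfun (curv_params j0 j1)"
proof -
  let ?X = "curv_params j0 j1"
  have fin: "finite ?X" by (simp add: curv_params_def)
  note intros = polyfun_mult[OF fin] polyfun_add[OF fin] polyfun_sum[OF fin]
    polyfun_const[OF fin] polyfun_coord[OF fin]
  have mem: "n < 6 \<Longrightarrow> j \<noteq> j1 \<Longrightarrow> Inl (n, j) \<in> ?X" "Inl (0, j1) \<in> ?X" for n j
    by (auto simp: curv_params_def)
  have germ: "(\<lambda>x. coeff (curv_germ j0 j1 x j) n :: 'k) \<in> polyfun ?X" for j n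
  proof (cases "j = j0 \<or> j = j1")
    case True
    consider "n = 0" | "n = 1" | k where "n = Suc (Suc k)" by (cases n; cases "n - 1") auto
    then show ?thesis using True assms mem(2)
      by cases (auto simp: curv_germ_def coeff_pCons intro!: intros)
  next
    case False
    have "(\<lambda>x. \<Sum>k<6. if k = n then x (Inl (k, j)) else 0) \<in> polyfun ?X"
    proof (intro intros)
      fix k assume "k \<in> {..<6::nat}"
      then show "(\<lambda>x. if k = n then x (Inl (k, j)) else 0) \<in> polyfun ?X"
        using False mem(1)[of k j] by (cases "k = n") (auto intro!: intros)
    qed
    then show ?thesis using False by (simp add: curv_germ_def coeff_sum)
  qed
  have mult: "(\<lambda>x. coeff (p x * q x) n) \<in> polyfun ?X"
    if "\<And>n. (\<lambda>x. coeff (p x) n) \<in> polyfun ?X" "\<And>n. (\<lambda>x. coeff (q x) n) \<in> polyfun ?X"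
    for p q :: "(param \<Rightarrow> 'k) \<Rightarrow> 'k poly" and n
    unfolding coeff_mult by (intro intros that)
  have one: "(\<lambda>x. coeff (1 :: 'k poly) n) \<in> polyfun ?X" for n by (intro intros)
  have pow: "(\<lambda>x. coeff (curv_germ j0 j1 x j ^ e) n :: 'k) \<in> polyfun ?X" for j e n
  proof (induction e arbitrary: n)
    case 0
    show ?case unfolding power_0 by (rule one)
  next
    case (Suc e)
    show ?case unfolding power_Suc by (rule mult[OF germ Suc.IH])
  qed
  have prod: "(\<lambda>x. coeff (\<Prod>j\<in>S. curv_germ j0 j1 x j ^ lookup m j) n :: 'k) \<in> polyfun ?X" if "finite S" for S n
    using that by (induction S arbitrary: n rule: finite_induct) (auto intro!: intros mult pow)
  show ?thesis unfolding curv_coeff_def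
    using assms by (intro intros prod mem) auto
qed

lemma card_curv_params: "card (curv_params j0 j1) < card {m :: 4 mon. mdeg m = 3}"
proof -
  have "card (curv_params j0 j1) \<le> card ({..<6::nat} \<times> (UNIV - {j1}) \<union> {(0, j1)})"
    unfolding curv_params_def by (rule card_image_le) auto
  also have "\<dots> \<le> card ({..<6::nat} \<times> (UNIV - {j1})) + card {(0::nat, j1)}" by (rule card_Un_le)
  also have "\<dots> = 19" by (simp add: card_cartesian_product card_Diff_subset)
  also have "19 < card (set [(a, b, c). a \<leftarrow> [0..<4::nat], b \<leftarrow> [0..<4::nat], c \<leftarrow> [0..<4::nat], a + b + c \<le> 3])"
    by code_simp
  also have "\<dots> \<le> card {m :: 4 mon. mdeg m = 3}" by (rule card_mon_le) auto
  finally show ?thesis .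
qed

lemma curvilinear_parametrized:
  assumes "curvilinear F"
  shows "\<exists>i j x. i \<noteq> j \<and> (\<forall>m. mdeg m = 3 \<longrightarrow> lookup F m = curv_coeff i j m x)"
proof -
  obtain j0 j1 c \<mu> A where A: "j0 \<noteq> j1" "A j0 = 1" "A j1 = [:c, 1:]" "\<And>j. degree (A j) < 6"
    "\<And>\<beta>. mdeg \<beta> = 3 \<Longrightarrow> lookup F \<beta> = (\<Sum>n<6. \<mu> n * coeff (\<Prod>j\<in>UNIV. A j ^ lookup \<beta> j) n)"
    using assms by (auto simp: curvilinear_def)
  define x where "x p = (case p of Inl (n, j) \<Rightarrow> if j = j0 then \<mu> n else if j = j1 then c else coeff (A j) n
    | Inr m \<Rightarrow> 0)" for p :: param
  have "curv_germ j0 j1 x j = A j" for j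
  proof -
    have "(\<Sum>n<6. monom (coeff (A j) n) n) = A j"
      using A(4)[of j] by (intro poly_eqI) (auto simp: coeff_sum intro: coeff_eq_0)
    then show ?thesis using A(1-3) by (auto simp: curv_germ_def x_def)
  qed
  then have "lookup F m = curv_coeff j0 j1 m x" if "mdeg m = 3" for m
    using A(5)[OF that] by (simp add: curv_coeff_def x_def)
  then show ?thesis using A(1) by blast
qed

text \<open>
  For each choice of two distinct coordinates to be normalised, either condition gives a family with
  19 parameters; both conditions are invariant under scaling and hold for 0.
\<close>

theorem generic_not_eckardt_nor_curvilinear:
  "\<exists>U :: (4, 'k::field_char_0) dpoly set. zariski_open_forms 3 U \<and> U \<noteq> {} \<and>
     (\<forall>F\<in>U. \<not> eckardt F \<and> \<not> curvilinear F)"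
proof -
  define Bad :: "(4, 'k) dpoly set" where "Bad = {F \<in> homog 3. eckardt F \<or> curvilinear F}"
  define I where "I = {(e :: bool, i :: 4, j :: 4). i \<noteq> j}"
  define X where "X = (\<lambda>(e, i, j). if e then eck_params i j else curv_params i j)"
  define \<phi> :: "bool \<times> 4 \<times> 4 \<Rightarrow> 4 mon \<Rightarrow> (param \<Rightarrow> 'k) \<Rightarrow> 'k" where
    "\<phi> = (\<lambda>(e, i, j) m. if e then eck_coeff i j (factors3 m) else curv_coeff i j m)"
  have "\<exists>U. zariski_open_forms 3 U \<and> U \<noteq> {} \<and> U \<inter> Bad = {}"
  proof (rule open_set_avoiding_parametrized_cone[of I X 3 \<phi>])
    show "finite I" by (rule finite_subset[OF subset_UNIV]) simp
    show "finite (X i)" for i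
      by (auto simp: X_def finite_eck_params curv_params_def split: prod.splits)
    show "card (X i) < card {m :: 4 mon. mdeg m = 3}" if "i \<in> I" for i
      using that card_eck_params card_curv_params by (auto simp: X_def I_def)
    show "\<phi> i m \<in> polyfun (X i)" if "i \<in> I" for i m
      using that by (auto simp: X_def I_def \<phi>_def intro!: eck_coeff_polyfun curv_coeff_polyfun)
    show "\<exists>i\<in>I. \<exists>x. \<forall>m. mdeg m = 3 \<longrightarrow> lookup F m = \<phi> i m x" if "F \<in> Bad" for F
    proof -
      have "eckardt F \<or> curvilinear F" using that by (simp add: Bad_def)
      then show ?thesis
      proof
        assume "eckardt F"
        from eckardt_parametrized[OF this] obtain i j x where
          "i \<noteq> j" "\<forall>m. mdeg m = 3 \<longrightarrow> lookup F m = eck_coeff i j (factors3 m) x" by blast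
        then show ?thesis by (intro bexI[of _ "(True, i, j)"] exI[of _ x]) (auto simp: I_def \<phi>_def)
      next
        assume "curvilinear F"
        from curvilinear_parametrized[OF this] obtain i j x where
          "i \<noteq> j" "\<forall>m. mdeg m = 3 \<longrightarrow> lookup F m = curv_coeff i j m x" by blast
        then show ?thesis by (intro bexI[of _ "(False, i, j)"] exI[of _ x]) (auto simp: I_def \<phi>_def)
      qed
    qed
    have "var 0 \<noteq> (0 :: (4, 'k) mpoly)" "var 1 \<noteq> (0 :: (4, 'k) mpoly)"
      by (metis lin_coeff_simps(5,6) zero_neq_one)+
    then have "eckardt (0 :: (4, 'k) dpoly)"
      unfolding eckardt_def by (intro bexI[of _ "var 0"] bexI[of _ "var 1"]) auto
    then show "0 \<in> Bad" by (simp add: Bad_def)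
    show "smul s F \<in> Bad" if "F \<in> Bad" for F s
    proof -
      have "eckardt (smul s F)" if "eckardt F"
        using that by (fastforce simp: eckardt_def pairing_right_smul)
      moreover have "curvilinear (smul s F)" if "curvilinear F"
      proof -
        obtain j0 j1 c \<mu> A where A: "j0 \<noteq> j1" "A j0 = 1" "A j1 = [:c, 1:]" "\<forall>j. degree (A j) < 6"
          "\<forall>\<beta>. mdeg \<beta> = 3 \<longrightarrow> lookup F \<beta> = (\<Sum>n<6. \<mu> n * coeff (\<Prod>j\<in>UNIV. A j ^ lookup \<beta> j) n)"
          using \<open>curvilinear F\<close> unfolding curvilinear_def by blast
        then show ?thesis unfolding curvilinear_def
          by (intro exI[of _ j0] exI[of _ j1] exI[of _ c] exI[of _ "\<lambda>n. s * \<mu> n"] exI[of _ A])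
            (simp add: sum_distrib_left mult.assoc)
      qed
      ultimately show ?thesis using that by (auto simp: Bad_def homog_smul)
    qed
  qed
  then obtain U where U: "zariski_open_forms 3 U" "U \<noteq> {}" "U \<inter> Bad = {}" by blast
  moreover have "U \<subseteq> homog 3" using U(1) by (auto simp: zariski_open_forms_def)
  ultimately show ?thesis unfolding Bad_def by (intro exI[of _ U]) blast
qed

section \<open>Short local schemes apolar to a cubic form\<close>

interpretation K_pair: vector_space_pair "smul :: 'k::field \<Rightarrow> ('x \<Rightarrow>\<^sub>0 'k) \<Rightarrow> _" "(*) :: 'k \<Rightarrow> 'k \<Rightarrow> 'k"
  by unfold_locales (auto simp: algebra_simps)

text \<open>
  A basis of \<open>J\<close> is extended by elements of \<open>V\<close> to a basis of \<open>J + V\<close>; \<open>g\<close> is 0 on the former and \<open>f\<close>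
  on the latter.
\<close>

lemma linear_form_extension:
  fixes V J :: "('x \<Rightarrow>\<^sub>0 'k::field) set"
  assumes V: "K_space.subspace V" and J: "K_space.subspace J" and f: "linear_form f"
    and zero: "\<And>v. v \<in> V \<Longrightarrow> v \<in> J \<Longrightarrow> f v = 0"
  shows "\<exists>g. linear_form g \<and> (\<forall>v\<in>V. g v = f v) \<and> (\<forall>v\<in>J. g v = 0)"
proof -
  obtain BJ where BJ: "BJ \<subseteq> J" "K_space.independent BJ" "J \<subseteq> K_space.span BJ"
    using K_space.maximal_independent_subset[of J] by auto
  have spanJ: "K_space.span BJ = J"
    using BJ K_space.span_minimal[OF BJ(1) J] by auto
  obtain B where B: "BJ \<subseteq> B" "B \<subseteq> J \<union> V" "K_space.independent B" "J \<union> V \<subseteq> K_space.span B"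
    using K_space.maximal_independent_subset_extend[of BJ "J \<union> V"] BJ by blast
  have disj: "b \<notin> J" if "b \<in> B - BJ" for b
  proof
    assume "b \<in> J"
    then have "b \<in> K_space.span (B - {b})"
      using spanJ K_space.span_mono[of BJ "B - {b}"] B(1) that by blast
    then show False using B(3) that by (auto simp: K_space.dependent_def)
  qed
  then have BV: "B - BJ \<subseteq> V" using B(2) by blast
  obtain g where g: "Vector_Spaces.linear smul (*) g" "\<forall>b\<in>B. g b = (if b \<in> BJ then 0 else f b)"
    using K_pair.linear_independent_extend[OF B(3), of "\<lambda>b. if b \<in> BJ then 0 else f b"] by blast
  have lin: "linear_form g"
    using g(1) by (simp add: linear_form_def Vector_Spaces.linear_iff)
  have gJ: "g v = 0" if "v \<in> J" for v
  proof -
    have "v \<in> K_space.span BJ" using that spanJ by simp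
    then show ?thesis
    proof (induction rule: K_space.span_induct)
      case base
      then show ?case by (simp add: K_space.subspace_def linear_form_simps lin)
    next
      case (step x)
      then show ?case using g(2) B(1) by auto
    qed
  qed
  have gf: "g y = f y" if "y \<in> K_space.span (B - BJ)" for y
    using that
  proof (induction rule: K_space.span_induct)
    case base
    then show ?case by (simp add: K_space.subspace_def linear_form_simps lin f)
  next
    case (step x)
    then show ?case using g(2) by auto
  qed
  have "g v = f v" if v: "v \<in> V" for v
  proof -
    have "BJ \<union> (B - BJ) = B" using B(1) by blast
    then have "v \<in> K_space.span (BJ \<union> (B - BJ))" using v B(4) by auto
    then obtain x y where xy: "v = x + y" "x \<in> K_space.span BJ" "y \<in> K_space.span (B - BJ)"
      unfolding K_space.span_Un by auto
    have "y \<in> V" using xy(3) K_space.span_minimal[OF BV V] by blast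
    then have "v - y \<in> V" using v K_space.subspace_diff[OF V] by blast
    moreover have "v - y = x" by (simp add: xy(1))
    ultimately have "f x = 0" using zero xy(2) spanJ by auto
    then show ?thesis
      using gf[OF xy(3)] gJ xy(2) spanJ by (simp add: xy(1) linear_form_simps lin f)
  qed
  then show ?thesis using lin gJ by blast
qed

lemma peval_altdef: "peval q u = (\<Sum>n\<le>degree q. const (coeff q n) * u ^ n)"
  by (subst (1) poly_as_sum_of_monoms[symmetric]) simp

lemma peval_cong_mod:
  assumes "poly_ideal J" "t ^ 6 \<in> J" "linear_form \<phi>" "\<And>p. p \<in> J \<Longrightarrow> \<phi> p = 0"
  shows "\<phi> (peval q t) = (\<Sum>n<6. coeff q n * \<phi> (t ^ n))"
proof -
  have "\<phi> (t ^ n) = 0" if "6 \<le> n" for n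
    using assms(4)[OF ideal_mult[OF assms(1,2), of "t ^ (n - 6)"]] that by (simp flip: power_add)
  then have "coeff q n * \<phi> (t ^ n) = 0" if "n \<ge> 6 \<or> n > degree q" for n
    using that by (auto simp: coeff_eq_0)
  then have "(\<Sum>n\<le>degree q. coeff q n * \<phi> (t ^ n)) = (\<Sum>n<6. coeff q n * \<phi> (t ^ n))"
    by (intro sum.mono_neutral_cong) auto
  then show ?thesis
    by (simp add: peval_altdef linear_form_simps assms(3) flip: smul_conv)
qed

subsection \<open>Powers of the maximal ideal\<close>

text \<open>\<open>mpow J z k\<close> is \<open>J + m\<^sup>k\<close>, where \<open>m\<close> is the ideal generated by the \<open>z b\<close>.\<close>

primrec mpow :: "('i, 'k::field) mpoly set \<Rightarrow> ('b::finite \<Rightarrow> ('i, 'k) mpoly) \<Rightarrow> nat \<Rightarrow> ('i, 'k) mpoly set" where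
  "mpow J z 0 = UNIV"
| "mpow J z (Suc k) = {j + (\<Sum>b\<in>UNIV. p b * z b) |j p. j \<in> J \<and> (\<forall>b. p b \<in> mpow J z k)}"

context
  fixes J :: "('i, 'k::field) mpoly set" and z :: "'b::finite \<Rightarrow> ('i, 'k) mpoly"
  assumes J: "poly_ideal J"
begin

lemma mpow_SucI:
  "x = j + (\<Sum>b\<in>UNIV. p b * z b) \<Longrightarrow> j \<in> J \<Longrightarrow> \<forall>b. p b \<in> mpow J z k \<Longrightarrow> x \<in> mpow J z (Suc k)"
  by auto

lemma mpow_ideal: "poly_ideal (mpow J z k)"
proof (induction k)
  case 0
  show ?case by (simp add: poly_ideal_def)
next
  case (Suc k)
  have "0 \<in> mpow J z (Suc k)"
    using ideal_0[OF J] ideal_0[OF Suc] by (auto intro!: exI[of _ 0] exI[of _ "\<lambda>_. 0"])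
  moreover have "x + y \<in> mpow J z (Suc k)" if xy: "x \<in> mpow J z (Suc k)" "y \<in> mpow J z (Suc k)" for x y
  proof -
    obtain j p j' p' where "x = j + (\<Sum>b\<in>UNIV. p b * z b)" "j \<in> J" "\<forall>b. p b \<in> mpow J z k"
      "y = j' + (\<Sum>b\<in>UNIV. p' b * z b)" "j' \<in> J" "\<forall>b. p' b \<in> mpow J z k"
      using xy by auto
    then have "x + y = (j + j') + (\<Sum>b\<in>UNIV. (p b + p' b) * z b)" "j + j' \<in> J"
      "\<forall>b. p b + p' b \<in> mpow J z k"
      by (auto simp: distrib_right sum.distrib intro: ideal_add J Suc)
    then show ?thesis by (rule mpow_SucI)
  qed
  moreover have "q * x \<in> mpow J z (Suc k)" if x: "x \<in> mpow J z (Suc k)" for q x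
  proof -
    obtain j p where "x = j + (\<Sum>b\<in>UNIV. p b * z b)" "j \<in> J" "\<forall>b. p b \<in> mpow J z k"
      using x by auto
    then have "q * x = q * j + (\<Sum>b\<in>UNIV. (q * p b) * z b)" "q * j \<in> J"
      "\<forall>b. q * p b \<in> mpow J z k"
      by (auto simp: distrib_left sum_distrib_left mult.assoc intro: ideal_mult J Suc)
    then show ?thesis by (rule mpow_SucI)
  qed
  ultimately show ?case by (simp only: poly_ideal_def) blast
qed

lemma mpow_superset: "J \<subseteq> mpow J z k"
  using ideal_0[OF mpow_ideal] by (cases k) (auto intro!: exI[of _ "\<lambda>_. 0"])

lemma mpow_gen_mult: "p \<in> mpow J z k \<Longrightarrow> p * z b \<in> mpow J z (Suc k)"
proof -
  assume p: "p \<in> mpow J z k"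
  have "(\<Sum>c\<in>UNIV. (if c = b then p else 0) * z c) = (\<Sum>c\<in>UNIV. if c = b then p * z c else 0)"
    by (intro sum.cong) auto
  then have eq: "p * z b = 0 + (\<Sum>c\<in>UNIV. (if c = b then p else 0) * z c)" by simp
  have "\<forall>c. (if c = b then p else 0) \<in> mpow J z k" using p ideal_0[OF mpow_ideal] by auto
  then show ?thesis by (rule mpow_SucI[OF eq ideal_0[OF J]])
qed

lemma mpow_subset:
  assumes "poly_ideal A" "J \<subseteq> A" "\<And>p b. p \<in> mpow J z k \<Longrightarrow> p * z b \<in> A"
  shows "mpow J z (Suc k) \<subseteq> A"
  using assms by (auto intro!: ideal_add ideal_sum)

lemma mpow_decreasing: "mpow J z (Suc k) \<subseteq> mpow J z k"
proof (induction k)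
  case (Suc k)
  then show ?case using mpow_gen_mult by (intro mpow_subset mpow_ideal mpow_superset) blast
qed simp

text \<open>
  In a product of sufficiently many generators, one of them occurs so often that its power is in \<open>J\<close>.
  The induction splits off the generators one by one into a monomial with exponents \<open>e\<close>.
\<close>

lemma mpow_nilpotent:
  assumes nil: "\<And>b. \<exists>n. z b ^ n \<in> J"
  shows "\<exists>k. mpow J z k \<subseteq> J"
proof -
  obtain n0 where n0: "\<And>b. z b ^ n0 b \<in> J" using nil by metis
  define n where "n = Max (range n0)"
  have n: "z b ^ e \<in> J" if "n \<le> e" for b e
  proof -
    have "n0 b \<le> e" using that by (simp add: n_def)
    then show ?thesis
      using ideal_mult[OF J n0[of b], of "z b ^ (e - n0 b)"] by (simp flip: power_add)
  qed
  have "q * (\<Prod>b\<in>UNIV. z b ^ e b) \<in> J"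
    if "q \<in> mpow J z k" "card (UNIV :: 'b set) * n \<le> k + (\<Sum>b\<in>UNIV. e b)" for q k e
    using that
  proof (induction k arbitrary: q e)
    case 0
    have "\<exists>b. n \<le> e b"
    proof (rule ccontr)
      assume "\<not> ?thesis"
      then have "(\<Sum>b\<in>UNIV. e b) < (\<Sum>b\<in>(UNIV :: 'b set). n)"
        by (intro sum_strict_mono) (auto simp: not_le)
      then show False using 0 by simp
    qed
    then obtain b where "n \<le> e b" ..
    moreover have "(\<Prod>b\<in>UNIV. z b ^ e b) = (\<Prod>b\<in>UNIV - {b}. z b ^ e b) * z b ^ e b"
      by (subst prod.remove[of _ b]) (auto simp: mult.commute)
    ultimately show ?case using n by (auto intro!: ideal_mult J)
  next
    case (Suc k)
    obtain j p where q: "q = j + (\<Sum>b\<in>UNIV. p b * z b)" "j \<in> J" "\<forall>b. p b \<in> mpow J z k"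
      using Suc.prems(1) by auto
    have "p b * z b * (\<Prod>c\<in>UNIV. z c ^ e c) \<in> J" for b
    proof -
      have "z b * (\<Prod>c\<in>UNIV. z c ^ e c) = (\<Prod>c\<in>UNIV. z c ^ (e(b := Suc (e b))) c)"
      proof -
        have "(\<Prod>c\<in>UNIV. z c ^ (e(b := Suc (e b))) c) = z b ^ Suc (e b) * (\<Prod>c\<in>UNIV - {b}. z c ^ (e(b := Suc (e b))) c)"
          by (subst prod.remove[of _ b]) auto
        also have "(\<Prod>c\<in>UNIV - {b}. z c ^ (e(b := Suc (e b))) c) = (\<Prod>c\<in>UNIV - {b}. z c ^ e c)"
          by (intro prod.cong) auto
        also have "z b ^ Suc (e b) * \<dots> = z b * (\<Prod>c\<in>UNIV. z c ^ e c)"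
          by (subst (2) prod.remove[of _ b]) (auto simp: mult.assoc)
        finally show ?thesis ..
      qed
      moreover have "(\<Sum>c\<in>UNIV. (e(b := Suc (e b))) c) = Suc (\<Sum>c\<in>UNIV. e c)"
      proof -
        have "(\<Sum>c\<in>UNIV. (e(b := Suc (e b))) c) = Suc (e b) + (\<Sum>c\<in>UNIV - {b}. (e(b := Suc (e b))) c)"
          by (subst sum.remove[of _ b]) auto
        also have "(\<Sum>c\<in>UNIV - {b}. (e(b := Suc (e b))) c) = (\<Sum>c\<in>UNIV - {b}. e c)"
          by (intro sum.cong) auto
        also have "Suc (e b) + \<dots> = Suc (\<Sum>c\<in>UNIV. e c)"
          by (subst (2) sum.remove[of _ b]) auto
        finally show ?thesis .
      qed
      ultimately show ?thesis
        using Suc.IH[of "p b" "e(b := Suc (e b))"] q(3) Suc.prems(2) by (simp add: mult.assoc)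
    qed
    then have "j * (\<Prod>c\<in>UNIV. z c ^ e c) + (\<Sum>b\<in>UNIV. p b * z b * (\<Prod>c\<in>UNIV. z c ^ e c)) \<in> J"
      by (intro ideal_add[OF J ideal_mult_right[OF J q(2)]] ideal_sum[OF J])
    then show ?case by (simp add: q(1) distrib_right sum_distrib_right)
  qed
  from this[where e = "\<lambda>_. 0"] have "mpow J z (card (UNIV :: 'b set) * n) \<subseteq> J" by auto
  then show ?thesis ..
qed

text \<open>Nakayama: a set of elements generating \<open>m\<close> modulo \<open>m\<^sup>2\<close> generates it, as \<open>m\<close> is nilpotent.\<close>

lemma mpow_nakayama:
  assumes nil: "\<And>b. \<exists>n. z b ^ n \<in> J"
    and gen: "\<And>b. \<exists>c. z b - const c * t \<in> mpow J z 2"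
  shows "mpow J z 1 \<subseteq> adjoin J t"
proof -
  let ?N = "adjoin J t"
  note N = adjoin_ideal[OF J, of t]
  define Q where "Q k = {x + y |x y. x \<in> ?N \<and> y \<in> mpow J z k}" for k
  have QI: "x + y \<in> Q k" if "x \<in> ?N" "y \<in> mpow J z k" for x y k using that by (auto simp: Q_def)
  have Q: "poly_ideal (Q k)" for k
    unfolding poly_ideal_def
  proof (intro conjI ballI allI)
    show "0 \<in> Q k" using QI[OF ideal_0[OF N] ideal_0[OF mpow_ideal]] by simp
    fix p q assume "p \<in> Q k" "q \<in> Q k"
    then obtain x y x' y' where "p = x + y" "q = x' + y'" "x \<in> ?N" "x' \<in> ?N" "y \<in> mpow J z k" "y' \<in> mpow J z k"
      by (auto simp: Q_def)
    then show "p + q \<in> Q k"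
      using QI[OF ideal_add[OF N] ideal_add[OF mpow_ideal], of x x' y k y'] by (simp add: ac_simps)
  next
    fix p q assume "p \<in> Q k"
    then show "q * p \<in> Q k"
      using QI[OF ideal_mult[OF N] ideal_mult[OF mpow_ideal]] by (auto simp: Q_def distrib_left)
  qed
  have JQ: "J \<subseteq> Q k" for k
    using QI[OF _ ideal_0[OF mpow_ideal]] adjoin_superset[of J t] by force
  have step: "mpow J z (Suc k) \<subseteq> Q (Suc (Suc k))" for k
  proof (induction k)
    case 0
    show ?case
    proof (intro mpow_subset Q JQ)
      fix p b
      obtain c where c: "z b - const c * t \<in> mpow J z 2" using gen by blast
      have "z b = const c * t + (z b - const c * t)" by simp
      also have "\<dots> \<in> Q 2" by (intro QI mult_gen_in_adjoin J c)
      finally show "p * z b \<in> Q (Suc (Suc 0))" by (intro ideal_mult Q) (simp add: numeral_2_eq_2)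
    qed
  next
    case (Suc k)
    show ?case
    proof (intro mpow_subset Q JQ)
      fix p b assume "p \<in> mpow J z (Suc k)"
      then have "p \<in> Q (Suc (Suc k))" using Suc by blast
      then obtain x y where "p = x + y" "x \<in> ?N" "y \<in> mpow J z (Suc (Suc k))" unfolding Q_def by blast
      then show "p * z b \<in> Q (Suc (Suc (Suc k)))"
        using QI[OF ideal_mult_right[OF N] mpow_gen_mult] by (simp add: distrib_right)
    qed
  qed
  have "mpow J z 1 \<subseteq> Q (Suc k)" for k
  proof (induction k)
    case 0
    show ?case using QI[OF ideal_0[OF N]] by force
  next
    case (Suc k)
    show ?case
    proof
      fix p assume "p \<in> mpow J z 1"
      then have "p \<in> Q (Suc k)" using Suc by blast
      then obtain x y where xy: "p = x + y" "x \<in> ?N" "y \<in> mpow J z (Suc k)" unfolding Q_def by blast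
      then have "y \<in> Q (Suc (Suc k))" using step[of k] by blast
      then obtain x' y' where "y = x' + y'" "x' \<in> ?N" "y' \<in> mpow J z (Suc (Suc k))"
        unfolding Q_def by blast
      then show "p \<in> Q (Suc (Suc k))"
        using xy QI[OF ideal_add[OF N]] by (simp add: add.assoc[symmetric])
    qed
  qed
  moreover obtain k where "mpow J z k \<subseteq> J" using mpow_nilpotent[OF nil] by blast
  have "Q (Suc k) \<subseteq> ?N"
  proof
    fix p assume "p \<in> Q (Suc k)"
    then obtain x y where "p = x + y" "x \<in> ?N" "y \<in> mpow J z (Suc k)" unfolding Q_def by blast
    moreover from this have "y \<in> ?N"
      using \<open>mpow J z k \<subseteq> J\<close> mpow_decreasing[of k] adjoin_superset[of J t] by blast
    ultimately show "p \<in> ?N" using ideal_add[OF N] by simp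
  qed
  ultimately show ?thesis by blast
qed

end

lemma lin_coeff_combination:
  "lin_coeff (\<Sum>i\<in>UNIV. smul (c i) (var i)) (j::'i::finite) = c j"
proof -
  have "lin_coeff (\<Sum>i\<in>UNIV. smul (c i) (var i)) j = (\<Sum>i\<in>UNIV. if j = i then c i else 0)"
    unfolding lin_coeff_sum by (intro sum.cong) auto
  then show ?thesis by simp
qed

text \<open>
  Let \<open>m\<close> be the maximal ideal of the local algebra modulo \<open>J\<close>. The functional \<open>\<phi>\<close> and its
  translates by a basis of the 3-dimensional space of the \<open>z b\<close> are independent on \<open>m\<^sup>2\<close>: in a
  relation \<open>c \<phi> + z \<phi> = 0\<close> with \<open>c \<noteq> 0\<close> the factor \<open>c + z\<close> is a unit, so that \<open>\<phi>\<close> would vanish on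
  \<open>m\<^sup>2\<close>; both this and a relation with \<open>c = 0\<close> contradict the nondegeneracy assumption. So \<open>m\<^sup>2\<close> has dimension at least 4, and \<open>m / m\<^sup>2\<close> at most
  \<open>6 - 1 - 4 = 1\<close>.
\<close>

lemma short_local_algebra_curvilinear:
  fixes J :: "(4, 'k::alg_closed_field) mpoly set" and z :: "4 \<Rightarrow> (4, 'k) mpoly"
  assumes J: "poly_ideal J"
    and dep: "\<And>(v :: 4 + nat \<Rightarrow> _) A. finite A \<Longrightarrow> 6 < card A \<Longrightarrow>
        \<exists>c. (\<exists>a\<in>A. c a \<noteq> 0) \<and> (\<Sum>a\<in>A. smul (c a) (v a)) \<in> J"
    and unit: "\<And>b c. c \<noteq> 0 \<Longrightarrow> 1 \<in> adjoin J (z b - const c)"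
    and res: "\<And>p. p - const (eval_mpoly a p) \<in> mpow J z 1"
    and res0: "\<And>p. p \<in> mpow J z 1 \<Longrightarrow> eval_mpoly a p = 0"
    and \<phi>: "linear_form \<phi>" "\<And>p. p \<in> J \<Longrightarrow> \<phi> p = 0"
    and z0: "z j0 = 0"
    and nondeg: "\<And>c. \<exists>b. b \<noteq> j0 \<and> c b \<noteq> 0 \<Longrightarrow>
        \<exists>b' b''. \<phi> ((\<Sum>b\<in>UNIV - {j0}. const (c b) * z b) * z b' * z b'') \<noteq> 0"
  shows "\<exists>j1. j1 \<noteq> j0 \<and> z j1 ^ 6 \<in> J \<and> (\<forall>p. \<exists>q. degree q < 6 \<and> p - peval q (z j1) \<in> J)"
proof -
  note mI = mpow_ideal[OF J, of z]
  have relation: "\<exists>q. q \<noteq> 0 \<and> degree q \<le> 6 \<and> peval q u \<in> J" for u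
  proof -
    let ?A = "Inr ` {..6} :: (4 + nat) set"
    have "card ?A = 7" by (simp add: card_image)
    then obtain c where c: "\<exists>a\<in>?A. c a \<noteq> 0" "(\<Sum>a\<in>?A. smul (c a) (u ^ projr a)) \<in> J"
      using dep[of ?A "\<lambda>s. u ^ projr s"] by auto
    define q where "q = (\<Sum>n\<le>6. monom (c (Inr n)) n)"
    have "peval q u = (\<Sum>a\<in>?A. smul (c a) (u ^ projr a))"
      by (simp add: q_def sum.reindex smul_conv)
    moreover have coeff: "coeff q n = (if n \<le> 6 then c (Inr n) else 0)" for n
      by (simp add: q_def coeff_sum)
    have "q \<noteq> 0"
    proof
      assume "q = 0"
      then have "c (Inr n) = 0" if "n \<le> 6" for n using coeff[of n] that by simp
      then show False using c(1) by auto
    qed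
    moreover have "degree q \<le> 6" using coeff by (auto intro: degree_le)
    ultimately show ?thesis using c(2) by auto
  qed
  have nil: "z b ^ 6 \<in> J" for b
  proof -
    obtain q where q: "q \<noteq> 0" "degree q \<le> 6" "peval q (z b) \<in> J" using relation by blast
    obtain n where n: "n \<le> 6" "z b ^ n \<in> J"
      using nilpotent_modulo_ideal[OF J q(1,3) unit] q(2) by (meson le_trans)
    then show ?thesis using ideal_mult[OF J n(2), of "z b ^ (6 - n)"] by (simp flip: power_add)
  qed
  have z1: "z b \<in> mpow J z 1" for b using mpow_gen_mult[OF J, of 1 z 0 b] by simp
  have z2: "z b * z b' \<in> mpow J z 2" for b b'
    using mpow_gen_mult[OF J z1[of b], of b'] by (simp add: numeral_2_eq_2)
  define Z where "Z c = (\<Sum>b\<in>UNIV - {j0}. const (c b) * z b)" for c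
  obtain K where K: "mpow J z K \<subseteq> J" using mpow_nilpotent[OF J] nil by blast
  have Zpow: "Z c ^ n \<in> mpow J z n" for c n
  proof (induction n)
    case (Suc n)
    have "Z c ^ Suc n = (\<Sum>b\<in>UNIV - {j0}. const (c b) * (Z c ^ n * z b))"
      by (subst power_Suc, subst (1) Z_def) (simp add: sum_distrib_left mult_ac)
    also have "\<dots> \<in> mpow J z (Suc n)"
      by (intro ideal_sum ideal_mult mI mpow_gen_mult J Suc)
    finally show ?case .
  qed simp
  define \<xi> where "\<xi> b p = (if b = j0 then \<phi> p else \<phi> (z b * p))" for b p
  have \<xi>_lin: "linear_form (\<xi> b)" for b
    using \<phi>(1) linear_form_mult[OF \<phi>(1)] by (cases "b = j0") (auto simp: \<xi>_def[abs_def])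
  have \<xi>_J: "\<xi> b p = 0" if "p \<in> J" for b p
    using that \<phi>(2) ideal_mult[OF J that] by (simp add: \<xi>_def)
  have \<xi>_sum: "(\<Sum>b\<in>UNIV. c b * \<xi> b p) = c j0 * \<phi> p + \<phi> (Z c * p)" for c p
  proof -
    have "(\<Sum>b\<in>UNIV. c b * \<xi> b p) = c j0 * \<phi> p + (\<Sum>b\<in>UNIV - {j0}. c b * \<phi> (z b * p))"
      by (subst sum.remove[of _ j0]) (auto simp: \<xi>_def intro!: sum.cong)
    moreover have "Z c * p = (\<Sum>b\<in>UNIV - {j0}. smul (c b) (z b * p))"
      by (simp add: Z_def sum_distrib_right smul_conv mult.assoc)
    then have "\<phi> (Z c * p) = (\<Sum>b\<in>UNIV - {j0}. c b * \<phi> (z b * p))"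
      by (simp add: linear_form_simps \<phi>(1))
    ultimately show ?thesis by simp
  qed
  have indep: "\<forall>b\<in>UNIV. c b = 0" if c: "\<forall>v\<in>mpow J z 2. (\<Sum>b\<in>UNIV. c b * \<xi> b v) = 0" for c
  proof -
    have rel: "c j0 * \<phi> v = - \<phi> (Z c * v)" if "v \<in> mpow J z 2" for v
      using c that unfolding \<xi>_sum by (auto simp: eq_neg_iff_add_eq_0)
    have c0: "c j0 = 0"
    proof (rule ccontr)
      assume nz: "c j0 \<noteq> 0"
      \<comment> \<open>Applying the relation repeatedly multiplies \<open>v\<close> by powers of an element of the nilpotent maximal ideal.\<close>
      have iter: "\<phi> v = (- 1 / c j0) ^ n * \<phi> (Z c ^ n * v)" if "v \<in> mpow J z 2" for v n
      proof (induction n)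
        case (Suc n)
        have "c j0 * \<phi> (Z c ^ n * v) = - \<phi> (Z c ^ Suc n * v)"
          using rel[OF ideal_mult[OF mI that], of "Z c ^ n"] by (simp add: mult.assoc)
        then have "\<phi> (Z c ^ n * v) = (- 1 / c j0) * \<phi> (Z c ^ Suc n * v)"
          using nz by (simp add: field_simps)
        then show ?case using Suc by simp
      qed simp
      have "\<phi> v = 0" if "v \<in> mpow J z 2" for v
        using iter[OF that, of K] \<phi>(2) ideal_mult_right[OF J, of "Z c ^ K" v] Zpow[of c K] K by auto
      moreover obtain b' b'' where "\<phi> (Z (\<lambda>_. 1) * z b' * z b'') \<noteq> 0"
      proof -
        have "card (UNIV - {j0}) = 3" by (simp add: card_Diff_subset)
        then have "UNIV - {j0} \<noteq> {}" by force
        then show ?thesis using that nondeg[of "\<lambda>_. 1"] unfolding Z_def by auto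
      qed
      ultimately show False
        using ideal_mult[OF mI z2, of "Z (\<lambda>_. 1)"] by (metis mult.assoc)
    qed
    have "\<phi> (Z c * z b' * z b'') = 0" for b' b''
      using rel[OF z2] c0 by (simp add: mult.assoc)
    then have "c b = 0" if "b \<noteq> j0" for b using nondeg[of c] that unfolding Z_def by blast
    then show ?thesis using c0 by metis
  qed
  have "\<exists>w. \<forall>s\<in>UNIV. w s \<in> mpow J z 2 \<and> (\<forall>t\<in>UNIV. \<xi> t (w s) = (if s = t then 1 else 0))"
    by (rule dual_vectors[OF finite subspace_ideal[OF mI] \<xi>_lin indep])
  then obtain w where w: "\<And>s. w s \<in> mpow J z 2" "\<And>s t. \<xi> t (w s) = (if s = t then 1 else 0)" by blast
  have pair: "\<exists>s s'. (s \<noteq> 0 \<or> s' \<noteq> 0) \<and> const s * z b + const s' * z b' \<in> mpow J z 2" for b b'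
  proof -
    \<comment> \<open>Of the 7 elements, 1 does not occur in the dependency, as all others vanish at the point; and the \<open>w b\<close> alone are independent.\<close>
    define v where "v i = (case i of Inl b \<Rightarrow> w b | Inr n \<Rightarrow> if n = 0 then 1 else if n = 1 then z b else z b')" for i :: "4 + nat"
    let ?A = "UNIV <+> {0, 1, 2} :: (4 + nat) set"
    have "card ?A = 7" by (simp add: card_Plus)
    then obtain c where c: "\<exists>a\<in>?A. c a \<noteq> 0" "(\<Sum>a\<in>?A. smul (c a) (v a)) \<in> J"
      using dep[of ?A v] by auto
    define s0 s s' where "s0 = c (Inr 0)" and "s = c (Inr 1)" and "s' = c (Inr 2)"
    define W where "W = (\<Sum>b\<in>UNIV. smul (c (Inl b)) (w b))"
    have W: "W \<in> mpow J z 2" unfolding W_def by (intro ideal_sum ideal_smul mI w)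
    have mem: "W + (const s0 + (const s * z b + const s' * z b')) \<in> J"
      using c(2) by (simp add: sum.Plus v_def W_def s0_def s_def s'_def smul_conv add.assoc)
    have "eval_mpoly a (const s * z b + const s' * z b') = 0"
      by (intro res0 ideal_add ideal_mult mI z1)
    moreover have "eval_mpoly a W = 0"
      using W mpow_decreasing[OF J, of z 1] by (intro res0) (auto simp: numeral_2_eq_2)
    moreover have "eval_mpoly a (W + (const s0 + (const s * z b + const s' * z b'))) = 0"
      using mem mpow_superset[OF J, of z 1] by (intro res0) auto
    ultimately have s0: "s0 = 0" by (simp add: eval_mpoly_subst)
    have "s \<noteq> 0 \<or> s' \<noteq> 0"
    proof (rule ccontr)
      assume "\<not> ?thesis"
      then have ss: "s = 0" "s' = 0" by auto
      then have "W \<in> J" using mem s0 by simp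
      then have "0 = \<xi> t W" for t by (simp add: \<xi>_J)
      also have "\<xi> t W = (\<Sum>b\<in>UNIV. if b = t then c (Inl b) else 0)" for t
        unfolding W_def by (simp add: linear_form_simps \<xi>_lin w(2) if_distrib cong: if_cong)
      finally have "c (Inl t) = 0" for t by simp
      then show False using c(1) ss s0 by (auto simp: s0_def s_def s'_def)
    qed
    moreover have "const s * z b + const s' * z b' \<in> mpow J z 2"
    proof -
      have "(W + (const s0 + (const s * z b + const s' * z b'))) - W \<in> mpow J z 2"
        using mem W mpow_superset[OF J, of z 2] by (intro ideal_diff mI) auto
      then show ?thesis by (simp add: s0)
    qed
    ultimately show ?thesis by blast
  qed
  have "\<exists>j1. z j1 \<notin> mpow J z 2"
  proof (rule ccontr)
    assume "\<not> ?thesis"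
    then have "\<exists>c. z b - const c * 0 \<in> mpow J z 2" for b by auto
    then have "mpow J z 1 \<subseteq> adjoin J 0" using mpow_nakayama[OF J, of z 0] nil by blast
    then have zJ: "z b \<in> J" for b using z1[of b] by (auto simp: adjoin_def)
    have "card (UNIV - {j0}) = 3" by (simp add: card_Diff_subset)
    then have "UNIV - {j0} \<noteq> {}" by force
    then obtain b' b'' where "\<phi> ((\<Sum>b\<in>UNIV - {j0}. const 1 * z b) * z b' * z b'') \<noteq> 0"
      using nondeg[of "\<lambda>_. 1"] by auto
    then show False using \<phi>(2)[OF ideal_mult[OF J zJ]] by blast
  qed
  then obtain j1 where j1: "z j1 \<notin> mpow J z 2" by blast
  define t where "t = z j1"
  have gen: "\<exists>c. z b - const c * t \<in> mpow J z 2" for b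
  proof -
    obtain s s' where s: "s \<noteq> 0 \<or> s' \<noteq> 0" "const s * t + const s' * z b \<in> mpow J z 2"
      using pair[of j1 b] unfolding t_def by blast
    have "s' \<noteq> 0"
    proof
      assume "s' = 0"
      then have "t \<in> mpow J z 2" using s ideal_cancel_const[OF mI, of s t] by auto
      then show False using j1 by (simp add: t_def)
    qed
    then have cs: "const s' * const (s / s') = const s" by (simp flip: const_mult)
    have "const s' * (z b - const (- s / s') * t) = const s' * z b + (const s' * const (s / s')) * t"
      by (simp add: distrib_left const_minus mult.assoc)
    then have "const s' * (z b - const (- s / s') * t) = const s * t + const s' * z b"
      unfolding cs by (simp add: add.commute)
    then show ?thesis using s(2) ideal_cancel_const[OF mI \<open>s' \<noteq> 0\<close>] by metis
  qed
  have m_sub: "mpow J z 1 \<subseteq> adjoin J t" using mpow_nakayama[OF J _ gen] nil by blast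
  have expand: "\<exists>c r. p - const c - r * t \<in> J" for p
  proof -
    have "p - const (eval_mpoly a p) \<in> adjoin J t" using res m_sub by blast
    then show ?thesis by (auto simp: adjoin_def) (metis add_diff_cancel_right')
  qed
  have power_expand: "\<exists>q r. (\<forall>i\<ge>n. coeff q i = 0) \<and> p - peval q t - r * t ^ n \<in> J" for p n
  proof (induction n)
    case 0
    show ?case by (intro exI[of _ 0] exI[of _ p]) (simp add: ideal_0 J)
  next
    case (Suc n)
    obtain q r where qr: "\<forall>i\<ge>n. coeff q i = 0" "p - peval q t - r * t ^ n \<in> J" using Suc by blast
    obtain c r' where r': "r - const c - r' * t \<in> J" using expand by blast
    have "(p - peval q t - r * t ^ n) + (r - const c - r' * t) * t ^ n \<in> J"
      by (intro ideal_add ideal_mult_right J qr r')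
    also have "(p - peval q t - r * t ^ n) + (r - const c - r' * t) * t ^ n =
        p - peval (q + monom c n) t - r' * t ^ Suc n" by (simp add: algebra_simps)
    finally show ?case using qr(1) by (intro exI[of _ "q + monom c n"] exI[of _ r']) auto
  qed
  have "\<exists>q. degree q < 6 \<and> p - peval q t \<in> J" for p
  proof -
    obtain q r where qr: "\<forall>i\<ge>6. coeff q i = 0" "p - peval q t - r * t ^ 6 \<in> J"
      using power_expand by blast
    have "(p - peval q t - r * t ^ 6) + r * t ^ 6 \<in> J"
      by (intro ideal_add ideal_mult J qr) (simp add: t_def nil)
    moreover have "degree q \<le> 5" using qr(1) by (intro degree_le) auto
    ultimately show ?thesis by (intro exI[of _ q]) auto
  qed
  moreover have "j1 \<noteq> j0" using j1 z0 ideal_0[OF mI] by auto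
  ultimately show ?thesis using nil t_def by blast
qed

subsection \<open>The local algebra of a local scheme\<close>

text \<open>
  By the Nullstellensatz, as the only point \<open>l\<close> of the scheme is not on the hyperplane.
\<close>

lemma hyperplane_missing_point:
  fixes I :: "(4, 'k::alg_closed_field) mpoly set"
  assumes I: "local_scheme_at l I" and l: "l \<in> homog 1" "lin_coeff l j \<noteq> 0"
  shows "\<exists>d. homog d \<subseteq> adjoin I (var j)"
proof (rule ccontr)
  assume neg: "\<not> ?thesis"
  have hI: "homogeneous_ideal I" using I by (simp add: local_scheme_at_def)
  obtain c where c: "\<exists>i. c i \<noteq> 0" "\<forall>p\<in>adjoin I (var j). eval_mpoly c p = 0"
    using projective_Nullstellensatz[OF adjoin_homogeneous[OF hI homog_var]] neg by blast
  define m where "m = (\<Sum>i\<in>UNIV. smul (c i) (var i))"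
  have lm: "lin_coeff m i = c i" for i by (simp only: m_def lin_coeff_combination)
  have "m \<in> homog 1" unfolding m_def by (intro homog_sum homog_smul homog_var)
  moreover have "m \<noteq> 0" using c(1) lm by force
  moreover have "eval_mpoly (lin_coeff m) p = 0" if "p \<in> I" for p
    using c(2) adjoin_superset that lm by (metis ext subsetD)
  ultimately have "m \<in> {smul c l |c. c \<noteq> 0}" using I unfolding local_scheme_at_def by blast
  then obtain s where "m = smul s l" "s \<noteq> 0" by blast
  then have "c j \<noteq> 0" using lm[of j] l(2) by auto
  moreover have "c j = 0"
    using c(2) gen_in_adjoin[OF homogeneous_ideal_ideal[OF hI], of "var j"]
    by (force simp: eval_mpoly_subst)
  ultimately show False by simp
qed

text \<open>
  Multiplication by the coordinate is onto in large degree, between spaces of the same dimension,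
  hence injective; saturation carries this down to small degrees.
\<close>

lemma coordinate_nonzerodivisor:
  fixes I :: "(4, 'k::alg_closed_field) mpoly set"
  assumes I: "local_scheme_at l I" and l: "l \<in> homog 1" "lin_coeff l j \<noteq> 0"
    and len: "scheme_length I r" and p: "p \<in> homog e" "var j * p \<in> I"
  shows "p \<in> I"
proof -
  have hI: "homogeneous_ideal I" using I by (simp add: local_scheme_at_def)
  note id = homogeneous_ideal_ideal[OF hI]
  obtain d0 where d0: "\<And>d. d0 \<le> d \<Longrightarrow> quot_dim (homog d) I r" using len by (auto simp: scheme_length_def)
  obtain d1 where d1: "homog d1 \<subseteq> adjoin I (var j)" using hyperplane_missing_point[OF I l] by blast
  have inj: "u \<in> I" if u: "u \<in> homog d" "var j * u \<in> I" and d: "d0 \<le> d" "d1 \<le> d" for u d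
  proof -
    obtain B where B: "B \<subseteq> homog (Suc d)" "finite B" "card B = r" and
      ex1: "\<forall>v\<in>homog (Suc d). \<exists>!c. (\<forall>b. b \<notin> B \<longrightarrow> c b = 0) \<and> v - (\<Sum>b\<in>B. smul (c b) b) \<in> I"
      using d0[of "Suc d"] d(1) unfolding quot_dim_def by auto
    have "\<forall>b\<in>B. \<exists>w. w \<in> homog d \<and> b - w * var j \<in> I"
    proof
      fix b assume "b \<in> B"
      then obtain x w where "b = x + w * var j" "x \<in> I" "w \<in> homog d"
        using homog_subset_adjoinD[OF hI homog_var d1 d(2)] B(1) by blast
      then show "\<exists>w. w \<in> homog d \<and> b - w * var j \<in> I" by (intro exI[of _ w]) simp
    qed
    then obtain w where w: "\<And>b. b \<in> B \<Longrightarrow> w b \<in> homog d" "\<And>b. b \<in> B \<Longrightarrow> b - w b * var j \<in> I" by metis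
    let ?A = "insert None (Some ` B)"
    define v where "v i = (case i of None \<Rightarrow> u | Some b \<Rightarrow> w b)" for i
    have "card ?A = Suc r" using B by (simp add: card_image)
    then obtain c where c: "\<exists>i\<in>?A. c i \<noteq> 0" "(\<Sum>i\<in>?A. smul (c i) (v i)) \<in> I"
    proof -
      have "v i \<in> homog d" if "i \<in> ?A" for i using that w(1) u(1) by (auto simp: v_def)
      from quot_dim_dependent[OF d0[OF d(1)], of ?A v, OF _ _ this subspace_ideal[OF id]]
      show ?thesis using that B(2) \<open>card ?A = Suc r\<close> by auto
    qed
    have eq: "(\<Sum>i\<in>?A. smul (c i) (v i)) = smul (c None) u + (\<Sum>b\<in>B. smul (c (Some b)) (w b))"
      using B(2) by (simp add: v_def sum.reindex)
    have "(\<Sum>b\<in>B. smul (c (Some b)) b) =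
        (smul (c None) u + (\<Sum>b\<in>B. smul (c (Some b)) (w b))) * var j - smul (c None) (var j * u)
        + (\<Sum>b\<in>B. smul (c (Some b)) (b - w b * var j))"
      by (simp add: smul_conv algebra_simps sum_subtractf sum_distrib_left)
    also have "\<dots> \<in> I"
    proof (intro ideal_add[OF id] ideal_diff[OF id] ideal_sum[OF id])
      show "(smul (c None) u + (\<Sum>b\<in>B. smul (c (Some b)) (w b))) * var j \<in> I"
        using c(2) unfolding eq by (rule ideal_mult_right[OF id])
    qed (use w(2) u(2) ideal_smul[OF id] in auto)
    finally have "- (\<Sum>b\<in>B. smul (c (Some b)) b) \<in> I" by (rule ideal_uminus[OF id])
    then have 1: "(\<forall>b. b \<notin> B \<longrightarrow> (if b \<in> B then c (Some b) else 0) = 0) \<and>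
        0 - (\<Sum>b\<in>B. smul (if b \<in> B then c (Some b) else 0) b) \<in> I" by simp
    have 2: "(\<forall>b. b \<notin> B \<longrightarrow> (0::'k) = 0) \<and> 0 - (\<Sum>b\<in>B. smul 0 b) \<in> I" by (simp add: ideal_0 id)
    note unique = the1_equality[OF bspec[OF ex1 homog_0]]
    have "(\<lambda>b. if b \<in> B then c (Some b) else 0) = (\<lambda>_. 0)"
      by (rule trans[OF unique[of "\<lambda>b. if b \<in> B then c (Some b) else 0", OF 1, symmetric]
            unique[of "\<lambda>_. 0", OF 2]])
    then have z: "c (Some b) = 0" if "b \<in> B" for b using that by (metis (full_types))
    then have "c None \<noteq> 0" using c(1) by auto
    moreover have "const (c None) * u \<in> I" using c(2) unfolding eq using z by (simp add: smul_conv)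
    ultimately show ?thesis using ideal_cancel_const[OF id] by blast
  qed
  have "q * p \<in> I" if "q \<in> homog (d0 + d1)" for q
  proof (rule inj)
    show "q * p \<in> homog (d0 + d1 + e)" using homog_mult[OF that p(1)] .
    show "var j * (q * p) \<in> I" using ideal_mult[OF id p(2), of q] by (simp add: mult.left_commute)
  qed auto
  then show ?thesis using I unfolding local_scheme_at_def saturated_def by blast
qed

text \<open>
  Setting a coordinate \<open>h\<close> that does not vanish at \<open>l\<close> to 1 turns \<open>I\<close> into an ideal \<open>J\<close> whose residue
  ring is a local algebra of dimension at most 6. As \<open>h\<close> is not a zero divisor modulo \<open>I\<close>, the cubic
  forms in \<open>J\<close> are those in \<open>I\<close>, so the pairing with \<open>F\<close> extends to a functional that vanishes on \<open>J\<close>.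
  Writing all coordinates as polynomials in one generator of the maximal ideal gives the curve germ.
\<close>

theorem short_local_apolar_scheme_curvilinear:
  fixes F :: "(4, 'k::alg_closed_field) dpoly"
  assumes I: "local_scheme_at l I" and len: "scheme_length I r" "r < 7" and apolar: "apolar I F"
    and l: "l \<in> homog 1" "l \<noteq> 0" and F: "F \<in> homog 3" "\<not> eckardt F"
  shows "curvilinear F"
proof -
  have hI: "homogeneous_ideal I" using I by (simp add: local_scheme_at_def)
  note id = homogeneous_ideal_ideal[OF hI]
  obtain j0 where j0: "lin_coeff l j0 \<noteq> 0" using homog_1_eqI[OF l(1) homog_0] l(2) by auto
  define a where "a i = lin_coeff l i / lin_coeff l j0" for i
  define h :: "(4, 'k) mpoly" where "h = var j0"
  have h: "h \<in> homog 1" by (simp add: h_def)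
  define J where "J = adjoin I (h - 1)"
  have J: "poly_ideal J" unfolding J_def by (rule adjoin_ideal[OF id])
  have hJ: "h - 1 \<in> J" unfolding J_def by (rule gen_in_adjoin[OF id])
  have IJ: "I \<subseteq> J" unfolding J_def by (rule adjoin_superset)
  have a0: "a j0 = 1" using j0 by (simp add: a_def)
  have points: "{m \<in> homog 1. m \<noteq> 0 \<and> (\<forall>p\<in>I. eval_mpoly (lin_coeff m) p = 0)} = {smul c l |c. c \<noteq> 0}"
    using I by (simp add: local_scheme_at_def)
  have I_a: "eval_mpoly a p = 0" if "p \<in> I" for p
  proof -
    have "smul (inverse (lin_coeff l j0)) l \<in> {smul c l |c. c \<noteq> 0}" using j0 by auto
    moreover have "lin_coeff (smul (inverse (lin_coeff l j0)) l) = a" by (auto simp: a_def divide_inverse mult.commute)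
    ultimately show ?thesis using that unfolding points[symmetric] by force
  qed
  have J_a: "eval_mpoly a p = 0" if "p \<in> J" for p
    using that I_a a0 by (auto simp: J_def adjoin_def eval_mpoly_subst h_def)
  have J_zero: "c = a" if c: "\<forall>p\<in>J. eval_mpoly c p = 0" for c
  proof -
    have c0: "c j0 = 1" using c hJ by (force simp: eval_mpoly_subst h_def)
    define m where "m = (\<Sum>i\<in>UNIV. smul (c i) (var i))"
    have lm: "lin_coeff m = c" by (simp add: m_def lin_coeff_combination fun_eq_iff)
    have "m \<in> homog 1" unfolding m_def by (intro homog_sum homog_smul homog_var)
    moreover have "m \<noteq> 0" using c0 lm by force
    ultimately have "m \<in> {smul c l |c. c \<noteq> 0}" unfolding points[symmetric] using c IJ lm by blast
    then obtain s where s: "m = smul s l" by blast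
    then have cs: "c i = s * lin_coeff l i" for i using lm by force
    then have "s = 1 / lin_coeff l j0" using c0 j0 by (metis nonzero_eq_divide_eq)
    then show "c = a" using cs by (auto simp: a_def)
  qed
  obtain d where d: "homog d \<subseteq> adjoin I h"
    using hyperplane_missing_point[OF I l(1) j0] by (auto simp: h_def)
  have J_homog: "p \<in> I" if p: "p \<in> homog k" "p \<in> J" for p k
  proof -
    obtain n where "h ^ n * p \<in> I"
      using homog_in_dehomogenized_ideal[OF hI h p(1) p(2)[unfolded J_def]] by blast
    then show ?thesis
    proof (induction n)
      case (Suc n)
      have "h ^ n * p \<in> homog (n * 1 + k)" by (intro homog_mult homog_power h p(1))
      moreover have "var j0 * (h ^ n * p) \<in> I" using Suc.prems by (simp add: h_def mult.assoc)
      ultimately have "h ^ n * p \<in> I" using coordinate_nonzerodivisor[OF I l(1) j0 len(1)] by blast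
      then show ?case by (rule Suc.IH)
    qed simp
  qed
  obtain d0 where d0: "\<And>d. d0 \<le> d \<Longrightarrow> quot_dim (homog d) I r"
    using len(1) by (auto simp: scheme_length_def)
  have dep: "\<exists>c. (\<exists>a\<in>A. c a \<noteq> 0) \<and> (\<Sum>a\<in>A. smul (c a) (v a)) \<in> J"
    if A: "finite A" "6 < card A" for v :: "4 + nat \<Rightarrow> _" and A
  proof -
    define N where "N = d0 + (\<Sum>a\<in>A. tdeg (v a))"
    have N: "tdeg (v a) \<le> N" if "a \<in> A" for a
      using member_le_sum[of a A "\<lambda>a. tdeg (v a)"] that A(1) by (simp add: N_def)
    \<comment> \<open>Homogenization to a common degree reduces a dependency modulo \<open>J\<close> to one modulo \<open>I\<close>.\<close>
    define v' where "v' a = (\<Sum>k\<le>N. h ^ (N - k) * hom_comp k (v a))" for a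
    have "v' a \<in> homog N" for a
      unfolding v'_def
    proof (rule homog_sum)
      fix k assume "k \<in> {..N}"
      then show "h ^ (N - k) * hom_comp k (v a) \<in> homog N"
        using homog_mult[OF homog_power[OF h, of "N - k"] hom_comp_homog[of k "v a"]] by simp
    qed
    then obtain c where c: "\<exists>a\<in>A. c a \<noteq> 0" "(\<Sum>a\<in>A. smul (c a) (v' a)) \<in> I"
      using quot_dim_dependent[OF d0[of N], of A v'] A len(2) subspace_ideal[OF id] by (auto simp: N_def)
    have "v' a - v a \<in> J" if "a \<in> A" for a
    proof -
      have "(\<Sum>k\<le>N. h ^ (N - k) * hom_comp k (v a) - hom_comp k (v a)) \<in> J"
        unfolding J_def by (intro ideal_sum adjoin_ideal power_minus_one_in_adjoin id)
      then show ?thesis using N[OF that] by (simp add: v'_def sum_subtractf sum_hom_comp)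
    qed
    then have "(\<Sum>a\<in>A. smul (c a) (v' a)) - (\<Sum>a\<in>A. smul (c a) (v' a - v a)) \<in> J"
      using c(2) IJ by (intro ideal_diff[OF J _ ideal_sum[OF J ideal_smul[OF J]]]) auto
    then have "(\<Sum>a\<in>A. smul (c a) (v a)) \<in> J"
      by (simp add: K_space.scale_right_diff_distrib sum_subtractf)
    then show ?thesis using c(1) by blast
  qed
  define z where "z b = var b - const (a b) * h" for b
  have z: "z b \<in> homog 1" for b unfolding z_def by (intro homog_diff homog_const_mult h homog_var)
  have z0: "z j0 = 0" by (simp add: z_def a0 h_def)
  have pair_l: "pairing p l = (\<Sum>b\<in>UNIV. lin_coeff p b * lin_coeff l b)" if "p \<in> homog 1" for p
    by (rule pairing_linear[OF that])
  have zl: "z b \<in> plane l" for b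
    using z[of b] j0 by (simp add: plane_def z_def pairing_simps h_def a_def)
  have unit: "1 \<in> adjoin J (z b - const c)" if "c \<noteq> 0" for b c
  proof (rule ccontr)
    assume neg: "1 \<notin> adjoin J (z b - const c)"
    have "\<exists>q. q \<noteq> 0 \<and> peval q (var i) \<in> adjoin J (z b - const c)" for i
      using algebraic_modulo_dehomogenized_ideal[OF hI h d, of "var i"] adjoin_superset J_def by blast
    then obtain c' where c': "\<forall>p\<in>adjoin J (z b - const c). eval_mpoly c' p = 0"
      using zero_of_algebraic_ideal[OF adjoin_ideal[OF J] neg] by blast
    then have "c' = a" using adjoin_superset[of J] by (intro J_zero) blast
    then have "eval_mpoly a (z b - const c) = 0" using c' gen_in_adjoin[OF J] by blast
    then show False using that a0 by (simp add: z_def eval_mpoly_subst h_def)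
  qed
  have var_res: "var i - const (a i) \<in> mpow J z 1" for i
  proof -
    have "z i + const (a i) * (h - 1) \<in> mpow J z 1"
      using mpow_gen_mult[OF J, of 1 z 0 i] mpow_superset[OF J, of z 1] hJ
      by (intro ideal_add ideal_mult mpow_ideal[OF J]) auto
    then show ?thesis by (simp add: z_def algebra_simps)
  qed
  have res0: "eval_mpoly a p = 0" if "p \<in> mpow J z 1" for p
    using that J_a by (auto simp: eval_mpoly_subst z_def h_def a0)
  obtain \<phi> where \<phi>: "linear_form \<phi>" "\<And>p. p \<in> homog 3 \<Longrightarrow> \<phi> p = pairing p F" "\<And>p. p \<in> J \<Longrightarrow> \<phi> p = 0"
  proof -
    have "pairing p F = 0" if "p \<in> homog 3" "p \<in> J" for p
    proof -
      have "contract p F = 0" using J_homog[OF that] apolar by (auto simp: apolar_def)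
      then show ?thesis by (simp add: pairing_def)
    qed
    from linear_form_extension[OF subspace_homog subspace_ideal[OF J] linear_form_pairing this]
    show ?thesis using that by blast
  qed
  have plane_span: "p = (\<Sum>b\<in>UNIV. const (lin_coeff p b) * z b)" if "p \<in> plane l" for p
  proof (rule homog_1_eqI)
    show p1: "p \<in> homog 1" using that by (simp add: plane_def)
    show "(\<Sum>b\<in>UNIV. const (lin_coeff p b) * z b) \<in> homog 1" by (intro homog_sum homog_const_mult z)
    fix i
    have "0 = (\<Sum>b\<in>UNIV. lin_coeff p b * lin_coeff l b)" using that pair_l[OF p1] by (simp add: plane_def)
    then have "0 = (\<Sum>b\<in>UNIV. lin_coeff p b * lin_coeff l b) / lin_coeff l j0" by simp
    then have s: "(\<Sum>b\<in>UNIV. lin_coeff p b * a b) = 0" by (simp add: a_def sum_divide_distrib)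
    have "lin_coeff (const (lin_coeff p b) * z b) i =
        (if i = b then lin_coeff p b else 0) - lin_coeff p b * a b * lin_coeff h i" for b
      by (simp add: z_def right_diff_distrib)
    then have "lin_coeff (\<Sum>b\<in>UNIV. const (lin_coeff p b) * z b) i =
        (\<Sum>b\<in>UNIV. (if i = b then lin_coeff p b else 0)) - (\<Sum>b\<in>UNIV. lin_coeff p b * a b) * lin_coeff h i"
      by (simp only: lin_coeff_sum sum_subtractf sum_distrib_right)
    then show "lin_coeff p i = lin_coeff (\<Sum>b\<in>UNIV. const (lin_coeff p b) * z b) i" using s by simp
  qed
  have nondeg: "\<exists>b' b''. \<phi> ((\<Sum>b\<in>UNIV - {j0}. const (c b) * z b) * z b' * z b'') \<noteq> 0"
    if c: "\<exists>b. b \<noteq> j0 \<and> c b \<noteq> 0" for c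
  proof (rule ccontr)
    assume neg: "\<not> ?thesis"
    define \<Psi> where "\<Psi> = (\<Sum>b\<in>UNIV - {j0}. const (c b) * z b)"
    have \<Psi>1: "\<Psi> \<in> homog 1" unfolding \<Psi>_def by (intro homog_sum homog_const_mult z)
    have "pairing (z b) l = 0" for b using zl[of b] by (simp add: plane_def)
    then have \<Psi>l: "pairing \<Psi> l = 0" by (simp add: \<Psi>_def pairing_simps)
    obtain b where b: "b \<noteq> j0" "c b \<noteq> 0" using c by blast
    have "lin_coeff \<Psi> b = (\<Sum>b'\<in>UNIV - {j0}. if b = b' then c b' else 0)"
      unfolding \<Psi>_def lin_coeff_sum using b(1) by (intro sum.cong) (auto simp: z_def h_def)
    then have "\<Psi> \<noteq> 0" using b by auto
    moreover have "pairing (\<Psi> * p * p') F = 0" if pp: "p \<in> plane l" "p' \<in> plane l" for p p'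
    proof -
      have "pairing (\<Psi> * z b' * z b'') F = 0" for b' b''
      proof -
        have "\<Psi> * z b' * z b'' \<in> homog (1 + 1 + 1)" by (intro homog_mult \<Psi>1 z)
        then have "\<phi> (\<Psi> * z b' * z b'') = pairing (\<Psi> * z b' * z b'') F" by (intro \<phi>(2)) (simp add: numeral_3_eq_3)
        moreover have "\<phi> (\<Psi> * z b' * z b'') = 0" using neg by (simp add: \<Psi>_def)
        ultimately show ?thesis by simp
      qed
      moreover have "\<Psi> * p * p' = (\<Sum>b'\<in>UNIV. \<Sum>b''\<in>UNIV.
          const (lin_coeff p b' * lin_coeff p' b'') * (\<Psi> * z b' * z b''))"
        by (subst plane_span[OF pp(1)], subst plane_span[OF pp(2)])
          (simp add: sum_product sum_distrib_left const_mult mult_ac)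
      ultimately show ?thesis by (simp add: pairing_simps)
    qed
    ultimately have "eckardt F" unfolding eckardt_def using \<Psi>1 \<Psi>l l by blast
    then show False using F by simp
  qed
  obtain j1 where j1: "j1 \<noteq> j0" "z j1 ^ 6 \<in> J" and
    rep: "\<And>p. \<exists>q. degree q < 6 \<and> p - peval q (z j1) \<in> J"
    using short_local_algebra_curvilinear[OF J dep unit eval_mpoly_mod[OF mpow_ideal[OF J] var_res]
        res0 \<phi>(1,3) z0 nondeg] by blast
  have "\<forall>j. \<exists>q. degree q < 6 \<and> var j - peval q (z j1) \<in> J" using rep by blast
  from choice[OF this] obtain A0
    where A0: "\<And>j. degree (A0 j) < 6" "\<And>j. var j - peval (A0 j) (z j1) \<in> J" by auto
  define A where "A j = (if j = j0 then 1 else if j = j1 then [:a j1, 1:] else A0 j)" for j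
  have A: "var j - peval (A j) (z j1) \<in> J" for j
  proof -
    have "var j0 - peval 1 (z j1) \<in> J" using hJ by (simp add: h_def one_pCons)
    moreover have "var j1 - peval [:a j1, 1:] (z j1) = const (a j1) * (h - 1)"
      by (simp add: z_def algebra_simps)
    then have "var j1 - peval [:a j1, 1:] (z j1) \<in> J" using hJ ideal_mult[OF J] by metis
    ultimately show ?thesis using A0(2) by (simp add: A_def)
  qed
  have prod_cong: "(\<Prod>j\<in>S. var j ^ e j) - peval (\<Prod>j\<in>S. A j ^ e j) (z j1) \<in> J" if "finite S" for S e
  proof -
    have mult: "p * p' - peval (q * q') (z j1) \<in> J"
      if "p - peval q (z j1) \<in> J" "p' - peval q' (z j1) \<in> J" for p p' q q'
    proof -
      have "p' * (p - peval q (z j1)) + peval q (z j1) * (p' - peval q' (z j1)) \<in> J"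
        using that by (intro ideal_add ideal_mult J)
      then show ?thesis by (simp add: algebra_simps)
    qed
    have one: "1 - peval 1 (z j1) \<in> J" by (simp add: one_pCons ideal_0 J)
    have pow: "var j ^ n - peval (A j ^ n) (z j1) \<in> J" for j n
    proof (induction n)
      case 0
      show ?case unfolding power_0 by (rule one)
    next
      case (Suc n)
      show ?case unfolding power_Suc by (rule mult[OF A Suc])
    qed
    show ?thesis using that
    proof (induction S rule: finite_induct)
      case empty
      show ?case unfolding prod.empty by (rule one)
    next
      case (insert j S)
      then show ?case using mult[OF pow insert.IH] by simp
    qed
  qed
  have "lookup F \<beta> = (\<Sum>n<6. \<phi> (z j1 ^ n) * coeff (\<Prod>j\<in>UNIV. A j ^ lookup \<beta> j) n)"
    if \<beta>: "mdeg \<beta> = 3" for \<beta>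
  proof -
    let ?q = "\<Prod>j\<in>UNIV. A j ^ lookup \<beta> j"
    have s: "single \<beta> (1::'k) = (\<Prod>j\<in>UNIV. var j ^ lookup \<beta> j)"
      using single_conv_vars_UNIV[of \<beta> "1::'k"] by simp
    have "lookup F \<beta> = \<phi> (single \<beta> 1)" using \<phi>(2)[OF homog_single[OF \<beta>]] by simp
    also have "\<dots> = \<phi> (peval ?q (z j1))"
      using \<phi>(3)[OF prod_cong[of UNIV "lookup \<beta>"]] by (simp add: s linear_form_simps \<phi>(1))
    also have "\<dots> = (\<Sum>n<6. coeff ?q n * \<phi> (z j1 ^ n))"
      by (rule peval_cong_mod[OF J j1(2) \<phi>(1,3)])
    finally show ?thesis by (simp add: mult.commute)
  qed
  moreover have "degree (A j) < 6" for j using A0(1) by (simp add: A_def)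
  ultimately show ?thesis unfolding curvilinear_def using j1(1)
    by (intro exI[of _ j0] exI[of _ j1] exI[of _ "a j1"] exI[of _ "\<lambda>n. \<phi> (z j1 ^ n)"] exI[of _ A])
      (auto simp: A_def)
qed

section \<open>Dehomogenization\<close>

lemma additive_eqI:
  fixes f g :: "('x \<Rightarrow>\<^sub>0 'k::field) \<Rightarrow> 'b::ab_group_add"
  assumes "\<And>u v. f (u + v) = f u + f v" "\<And>u v. g (u + v) = g u + g v"
    and "\<And>m a. f (single m a) = g (single m a)"
  shows "f p = g p"
proof -
  have 0: "f 0 = 0" "g 0 = 0" using assms(1)[of 0 0] assms(2)[of 0 0] by auto
  have "f (\<Sum>m\<in>A. single m (lookup p m)) = g (\<Sum>m\<in>A. single m (lookup p m))" for A
    by (induction A rule: infinite_finite_induct) (auto simp: 0 assms)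
  from this[of "keys p"] show ?thesis by (simp flip: poly_mapping_sum_single)
qed

lemma contract_left_0 [simp]: "contract 0 F = 0"
  by (simp add: contract_def)

lemma contract_right_add: "contract p (F + G) = contract p F + contract p G"
  and contract_right_0 [simp]: "contract p 0 = 0"
  by (rule poly_mapping_eqI, simp add: lookup_contract lookup_add pairing_right_add pairing_right_smul)+

lemma lookup_contract_var: "lookup (contract (var i) F) \<gamma> = lookup F (\<gamma> + single i 1)"
  by (simp add: lookup_contract var_def mult_single)

lemma contract_linear:
  fixes u :: "('i::finite, 'k::field) mpoly"
  assumes "u \<in> homog 1"
  shows "contract u F = (\<Sum>i\<in>UNIV. smul (lin_coeff u i) (contract (var i) F))"
proof -
  have sum: "contract (\<Sum>i\<in>A. f i) F = (\<Sum>i\<in>A. contract (f i) F)" for A and f :: "'i \<Rightarrow> _"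
    by (induction A rule: infinite_finite_induct) (auto simp: contract_add)
  show ?thesis by (subst homog_1_conv[OF assms]) (simp add: sum contract_smul)
qed

subsection \<open>Contraction by a linear form is a derivation of the divided power ring\<close>

lemma mon_decompose: "lookup \<alpha> i \<noteq> 0 \<Longrightarrow> \<alpha> = (\<alpha> - single i 1) + single i (1::nat)"
  by (intro poly_mapping_eqI) (auto simp: lookup_add lookup_minus lookup_single when_def)

definition dp_coeff :: "'i::finite mon \<Rightarrow> 'i mon \<Rightarrow> nat" where
  "dp_coeff \<alpha> \<beta> = (\<Prod>i\<in>UNIV. (lookup \<alpha> i + lookup \<beta> i) choose lookup \<alpha> i)"

lemma dp_mult_superset:
  assumes "finite A" "keys F \<subseteq> A" "finite B" "keys G \<subseteq> B"
  shows "dp_mult F G = (\<Sum>\<alpha>\<in>A. \<Sum>\<beta>\<in>B. single (\<alpha> + \<beta>) (of_nat (dp_coeff \<alpha> \<beta>) * lookup F \<alpha> * lookup G \<beta>))"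
proof -
  have "dp_mult F G = (\<Sum>\<alpha>\<in>keys F. \<Sum>\<beta>\<in>B. single (\<alpha> + \<beta>) (of_nat (dp_coeff \<alpha> \<beta>) * lookup F \<alpha> * lookup G \<beta>))"
    unfolding dp_mult_def dp_coeff_def using assms
    by (intro sum.cong refl sum.mono_neutral_left) (auto simp: in_keys_iff)
  also have "\<dots> = (\<Sum>\<alpha>\<in>A. \<Sum>\<beta>\<in>B. single (\<alpha> + \<beta>) (of_nat (dp_coeff \<alpha> \<beta>) * lookup F \<alpha> * lookup G \<beta>))"
    using assms by (intro sum.mono_neutral_left) (auto simp: in_keys_iff)
  finally show ?thesis .
qed

lemma dp_mult_add_left: "dp_mult (F + F') G = dp_mult F G + dp_mult F' G"
proof -
  let ?A = "keys F \<union> keys F'"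
  have "keys (F + F') \<subseteq> ?A" by (rule Poly_Mapping.keys_add)
  then show ?thesis
    by (simp add: dp_mult_superset[of ?A _ "keys G"] lookup_add distrib_left distrib_right single_add
        sum.distrib)
qed

lemma dp_mult_add_right: "dp_mult F (G + G') = dp_mult F G + dp_mult F G'"
proof -
  let ?B = "keys G \<union> keys G'"
  have "keys (G + G') \<subseteq> ?B" by (rule Poly_Mapping.keys_add)
  then show ?thesis
    by (simp add: dp_mult_superset[of "keys F" _ ?B] lookup_add distrib_left single_add sum.distrib)
qed

lemma dp_mult_0 [simp]: "dp_mult 0 G = 0" "dp_mult F 0 = 0"
  by (simp_all add: dp_mult_def)

lemma dp_mult_smul_left: "dp_mult (smul c F) G = smul c (dp_mult F G)"
  and dp_mult_smul_right: "dp_mult F (smul c G) = smul c (dp_mult F G)"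
proof -
  have s: "smul c (single m a) = single m (c * a)" for m :: "'a mon" and a
    by (rule poly_mapping_eqI) (simp add: lookup_single when_def)
  have "keys (smul c F) \<subseteq> keys F" "keys (smul c G) \<subseteq> keys G" by (auto simp: in_keys_iff)
  then show "dp_mult (smul c F) G = smul c (dp_mult F G)" "dp_mult F (smul c G) = smul c (dp_mult F G)"
    by (simp_all add: dp_mult_superset[of "keys F" _ "keys G"] K_space.scale_sum_right s mult_ac)
qed

lemma dp_mult_sum_left: "dp_mult (\<Sum>x\<in>A. f x) G = (\<Sum>x\<in>A. dp_mult (f x) G)"
  by (induction A rule: infinite_finite_induct) (auto simp: dp_mult_add_left)

lemma dp_mult_sum_right: "dp_mult F (\<Sum>x\<in>A. f x) = (\<Sum>x\<in>A. dp_mult F (f x))"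
  by (induction A rule: infinite_finite_induct) (auto simp: dp_mult_add_right)

lemma dp_mult_single: "dp_mult (single \<alpha> a) (single \<beta> b) = single (\<alpha> + \<beta>) (of_nat (dp_coeff \<alpha> \<beta>) * a * b)"
  by (subst dp_mult_superset[of "{\<alpha>}" _ "{\<beta>}"]) auto

lemma dp_mult_homog: "F \<in> homog d \<Longrightarrow> G \<in> homog e \<Longrightarrow> dp_mult F G \<in> homog (d + e)"
  unfolding dp_mult_def by (intro homog_sum homog_single) (auto simp: homog_def)

lemma contract_var_single:
  "contract (var i) (single \<gamma> a) = (if lookup \<gamma> i = 0 then 0 else single (\<gamma> - single i 1) a)"
proof (rule poly_mapping_eqI)
  fix \<delta>
  have "\<gamma> = \<delta> + single i 1 \<longleftrightarrow> lookup \<gamma> i \<noteq> 0 \<and> \<gamma> - single i 1 = \<delta>"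
  proof
    assume "\<gamma> = \<delta> + single i 1"
    then show "lookup \<gamma> i \<noteq> 0 \<and> \<gamma> - single i 1 = \<delta>" by (simp add: lookup_add)
  next
    assume "lookup \<gamma> i \<noteq> 0 \<and> \<gamma> - single i 1 = \<delta>"
    then show "\<gamma> = \<delta> + single i 1"
      by (intro poly_mapping_eqI) (auto simp: lookup_add lookup_minus lookup_single when_def)
  qed
  then show "lookup (contract (var i) (single \<gamma> a)) \<delta> =
      lookup (if lookup \<gamma> i = 0 then 0 else single (\<gamma> - single i 1) a) \<delta>"
    by (simp add: lookup_contract_var lookup_single when_def)
qed

lemma dp_coeff_split:
  "dp_coeff \<alpha> \<beta> = ((lookup \<alpha> i + lookup \<beta> i) choose lookup \<alpha> i) *
    (\<Prod>j\<in>UNIV - {i}. (lookup \<alpha> j + lookup \<beta> j) choose lookup \<alpha> j)"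
  unfolding dp_coeff_def by (subst prod.remove[of _ i]) auto

text \<open>
  Pascal's rule in the coordinate \<open>i\<close> is what makes contraction by a variable a derivation.
\<close>

lemma dp_coeff_pascal:
  "dp_coeff (\<alpha> + single i 1) (\<beta> + single i 1) = dp_coeff \<alpha> (\<beta> + single i 1) + dp_coeff (\<alpha> + single i 1) \<beta>"
  and dp_coeff_left_0: "lookup \<alpha> i = 0 \<Longrightarrow> dp_coeff \<alpha> (\<beta> + single i 1) = dp_coeff \<alpha> \<beta>"
  and dp_coeff_right_0: "lookup \<beta> i = 0 \<Longrightarrow> dp_coeff (\<alpha> + single i 1) \<beta> = dp_coeff \<alpha> \<beta>"
proof -
  let ?P = "\<lambda>\<alpha> \<beta>. \<Prod>j\<in>UNIV - {i}. (lookup \<alpha> j + lookup \<beta> j) choose lookup \<alpha> j"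
  have P: "?P (\<alpha> + single i 1) \<beta>' = ?P \<alpha> \<beta>'" "?P \<alpha>' (\<beta> + single i 1) = ?P \<alpha>' \<beta>" for \<alpha>' \<beta>'
    by (intro prod.cong; simp add: lookup_add lookup_single when_def)+
  show "dp_coeff (\<alpha> + single i 1) (\<beta> + single i 1) = dp_coeff \<alpha> (\<beta> + single i 1) + dp_coeff (\<alpha> + single i 1) \<beta>"
    unfolding dp_coeff_split[of _ _ i] P by (simp add: lookup_add algebra_simps)
  show "lookup \<alpha> i = 0 \<Longrightarrow> dp_coeff \<alpha> (\<beta> + single i 1) = dp_coeff \<alpha> \<beta>"
    unfolding dp_coeff_split[of _ _ i] P by (simp add: lookup_add)
  show "lookup \<beta> i = 0 \<Longrightarrow> dp_coeff (\<alpha> + single i 1) \<beta> = dp_coeff \<alpha> \<beta>"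
    unfolding dp_coeff_split[of _ _ i] P by (simp add: lookup_add)
qed

lemma contract_var_dp_mult_single:
  "contract (var i) (dp_mult (single \<alpha> a) (single \<beta> b)) =
    dp_mult (contract (var i) (single \<alpha> a)) (single \<beta> b) + dp_mult (single \<alpha> a) (contract (var i) (single \<beta> b))"
proof -
  have dec: "\<exists>\<alpha>'. \<alpha> = \<alpha>' + single i 1" if "lookup \<alpha> i \<noteq> 0" for \<alpha> :: "'a mon"
    using mon_decompose[OF that] by blast
  consider "lookup \<alpha> i = 0" "lookup \<beta> i = 0"
    | \<beta>' where "lookup \<alpha> i = 0" "\<beta> = \<beta>' + single i 1"
    | \<alpha>' where "\<alpha> = \<alpha>' + single i 1" "lookup \<beta> i = 0"
    | \<alpha>' \<beta>' where "\<alpha> = \<alpha>' + single i 1" "\<beta> = \<beta>' + single i 1"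
    using dec by blast
  then show ?thesis
  proof cases
    case 1
    then show ?thesis by (simp add: dp_mult_single contract_var_single lookup_add)
  next
    case 2
    have e: "\<alpha> + (\<beta>' + single i 1) - single i 1 = \<alpha> + \<beta>'" by (simp flip: add.assoc)
    show ?thesis unfolding 2(2) using 2(1) dp_coeff_left_0[OF 2(1)] e
      by (simp add: dp_mult_single contract_var_single lookup_add)
  next
    case 3
    have e: "\<alpha>' + single i 1 + \<beta> - single i 1 = \<alpha>' + \<beta>" by (simp add: add.commute flip: add.assoc)
    show ?thesis unfolding 3(1) using 3(2) dp_coeff_right_0[OF 3(2)] e
      by (simp add: dp_mult_single contract_var_single lookup_add)
  next
    case 4
    have "\<alpha>' + single i 1 + (\<beta>' + single i 1) = (\<alpha>' + (\<beta>' + single i 1)) + single i 1"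
      by (simp only: ac_simps)
    then have e: "\<alpha>' + single i 1 + (\<beta>' + single i 1) - single i 1 = \<alpha>' + (\<beta>' + single i 1)"
      "\<alpha>' + single i 1 + \<beta>' = \<alpha>' + (\<beta>' + single i 1)"
      by (simp, simp only: ac_simps)
    show ?thesis unfolding 4 dp_mult_single contract_var_single e dp_coeff_pascal
      using e by (simp add: lookup_add dp_mult_single algebra_simps flip: single_add)
  qed
qed

lemma contract_var_dp_mult:
  "contract (var i) (dp_mult F G) = dp_mult (contract (var i) F) G + dp_mult F (contract (var i) G)"
proof (rule additive_eqI[of "\<lambda>F. contract (var i) (dp_mult F G)"
      "\<lambda>F. dp_mult (contract (var i) F) G + dp_mult F (contract (var i) G)"])
  fix \<alpha> a
  show "contract (var i) (dp_mult (single \<alpha> a) G) =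
      dp_mult (contract (var i) (single \<alpha> a)) G + dp_mult (single \<alpha> a) (contract (var i) G)"
    by (rule additive_eqI[of "\<lambda>G. contract (var i) (dp_mult (single \<alpha> a) G)"
          "\<lambda>G. dp_mult (contract (var i) (single \<alpha> a)) G + dp_mult (single \<alpha> a) (contract (var i) G)"])
      (simp_all only: dp_mult_add_right contract_right_add contract_var_dp_mult_single ac_simps)
qed (simp_all only: dp_mult_add_left contract_right_add ac_simps)

lemma contract_linear_dp_mult:
  assumes "u \<in> homog 1"
  shows "contract u (dp_mult F G) = dp_mult (contract u F) G + dp_mult F (contract u G)"
  unfolding contract_linear[OF assms] contract_var_dp_mult
  by (simp add: K_space.scale_right_distrib sum.distrib dp_mult_sum_left dp_mult_sum_right
      dp_mult_smul_left dp_mult_smul_right)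

lemma lookup_dp_power:
  "lookup (dp_power l n) \<beta> = (if mdeg \<beta> = n then \<Prod>i\<in>UNIV. lin_coeff l i ^ lookup \<beta> i else 0)"
  by (simp add: dp_power_def lookup_sum lookup_single when_def finite_mdeg)

lemma dp_power_homog: "dp_power l n \<in> homog n"
  by (rule homogI) (auto simp: lookup_dp_power split: if_splits)

lemma contract_var_dp_power:
  "contract (var i) (dp_power l (Suc n)) = smul (lin_coeff l i) (dp_power l n)"
proof (rule poly_mapping_eqI)
  fix \<gamma>
  have "(\<Prod>j\<in>UNIV. lin_coeff l j ^ lookup (\<gamma> + single i 1) j) =
      lin_coeff l i * (\<Prod>j\<in>UNIV. lin_coeff l j ^ lookup \<gamma> j)"
  proof -
    have "(\<Prod>j\<in>UNIV. lin_coeff l j ^ lookup (\<gamma> + single i 1) j) =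
        (\<Prod>j\<in>UNIV. (if j = i then lin_coeff l i else 1) * lin_coeff l j ^ lookup \<gamma> j)"
      by (intro prod.cong) (auto simp: lookup_add lookup_single when_def)
    then show ?thesis by (simp add: prod.distrib)
  qed
  then show "lookup (contract (var i) (dp_power l (Suc n))) \<gamma> = lookup (smul (lin_coeff l i) (dp_power l n)) \<gamma>"
    by (simp add: lookup_contract_var lookup_dp_power)
qed

lemma contract_linear_dp_power:
  assumes "u \<in> homog 1"
  shows "contract u (dp_power l n) = (if n = 0 then 0 else smul (pairing u l) (dp_power l (n - 1)))"
proof (cases n)
  case 0
  have "contract (var i) (dp_power l 0) = 0" for i
    by (rule poly_mapping_eqI) (simp add: lookup_contract_var lookup_dp_power)
  then show ?thesis using 0 by (simp add: contract_linear[OF assms])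
next
  case (Suc m)
  show ?thesis
    by (simp add: Suc contract_linear[OF assms] contract_var_dp_power pairing_linear[OF assms]
        K_space.scale_sum_left)
qed

subsection \<open>The divided power monomials of a basis\<close>

lemma dual_basis:
  assumes B: "linear_basis (B :: 4 \<Rightarrow> (4, 'k::field) dpoly)"
  shows "\<exists>u. (\<forall>j. u j \<in> homog 1) \<and> (\<forall>j k. pairing (u j) (B k) = (if j = k then 1 else 0)) \<and>
    (\<forall>i. var i = (\<Sum>j\<in>UNIV. const (lin_coeff (B j) i) * u j))"
proof -
  have inj: "inj B" and ind: "K_space.independent (range B)" and sp: "K_space.span (range B) = homog 1"
    using B by (auto simp: linear_basis_def)
  have B1: "B j \<in> homog 1" for j using sp K_space.span_base[of "B j" "range B"] by auto
  have "\<exists>d. var k = (\<Sum>j\<in>UNIV. smul (d j) (B j))" for k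
  proof -
    have "var k \<in> K_space.span (range B)" unfolding sp by simp
    then obtain e where "var k = (\<Sum>v\<in>range B. smul (e v) v)"
      using K_space.span_finite[of "range B"] by auto
    then show ?thesis by (auto simp: sum.reindex[OF inj])
  qed
  then obtain d where d: "\<And>k. var k = (\<Sum>j\<in>UNIV. smul (d k j) (B j))" by metis
  define u where "u j = (\<Sum>k\<in>UNIV. smul (d k j) (var k))" for j
  have u1: "u j \<in> homog 1" for j unfolding u_def by (intro homog_sum homog_smul homog_var)
  have lu: "lin_coeff (u j) k = d k j" for j k by (simp add: u_def lin_coeff_combination)
  have dual: "pairing (u j) (B i) = (if j = i then 1 else 0)" for i j
  proof -
    define c where "c j = (\<Sum>k\<in>UNIV. lin_coeff (B i) k * d k j)" for j
    have "B i = (\<Sum>k\<in>UNIV. smul (lin_coeff (B i) k) (\<Sum>j\<in>UNIV. smul (d k j) (B j)))"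
      using homog_1_conv[OF B1[of i]] d by simp
    also have "\<dots> = (\<Sum>k\<in>UNIV. \<Sum>j\<in>UNIV. smul (lin_coeff (B i) k * d k j) (B j))"
      by (simp add: K_space.scale_sum_right)
    also have "\<dots> = (\<Sum>j\<in>UNIV. \<Sum>k\<in>UNIV. smul (lin_coeff (B i) k * d k j) (B j))"
      by (rule sum.swap)
    also have "\<dots> = (\<Sum>j\<in>UNIV. smul (c j) (B j))"
      by (simp add: K_space.scale_sum_left c_def)
    finally have "(\<Sum>j\<in>UNIV. smul (c j - (if j = i then 1 else 0)) (B j)) = 0"
      by (simp add: K_space.scale_left_diff_distrib sum_subtractf if_distrib[of "\<lambda>x. smul x _"] cong: if_cong)
    then have "(\<Sum>v\<in>range B. smul (c (inv B v) - (if inv B v = i then 1 else 0)) v) = 0"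
      by (simp add: sum.reindex[OF inj] inv_f_f[OF inj])
    from K_space.independentD[OF ind _ subset_refl this, of "B j"]
    have "c j = (if j = i then 1 else 0)" by (simp add: inv_f_f[OF inj])
    then show ?thesis by (simp add: pairing_linear[OF u1] lu c_def mult.commute)
  qed
  have "var i = (\<Sum>j\<in>UNIV. const (lin_coeff (B j) i) * u j)" for i
  proof (rule homog_1_eqI)
    show "(\<Sum>j\<in>UNIV. const (lin_coeff (B j) i) * u j) \<in> homog 1" by (intro homog_sum homog_const_mult u1)
    fix k
    have "lin_coeff (var k) i = lin_coeff (\<Sum>j\<in>UNIV. smul (d k j) (B j)) i" using d by simp
    also have "\<dots> = lin_coeff (\<Sum>j\<in>UNIV. const (lin_coeff (B j) i) * u j) k"
      unfolding lin_coeff_sum lin_coeff_simps lu by (simp only: mult.commute)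
    finally show "lin_coeff (var i) k = lin_coeff (\<Sum>j\<in>UNIV. const (lin_coeff (B j) i) * u j) k" by auto
  qed simp
  then show ?thesis using u1 dual by blast
qed

context
  fixes B :: "4 \<Rightarrow> (4, 'k::field) dpoly" and u :: "4 \<Rightarrow> (4, 'k) mpoly"
  assumes u1: "\<And>j. u j \<in> homog 1" and dual: "\<And>j k. pairing (u j) (B k) = (if j = k then 1 else 0)"
    and var_u: "\<And>i. var i = (\<Sum>j\<in>UNIV. const (lin_coeff (B j) i) * u j)"
begin

definition upow :: "4 mon \<Rightarrow> (4, 'k) mpoly" where
  "upow \<alpha> = (\<Prod>j\<in>UNIV. u j ^ lookup \<alpha> j)"

lemma upow_add: "upow (\<alpha> + \<beta>) = upow \<alpha> * upow \<beta>"
  by (simp add: upow_def lookup_add power_add prod.distrib)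

lemma upow_single: "upow (single j n) = u j ^ n"
proof -
  have "upow (single j n) = (\<Prod>k\<in>UNIV. if k = j then u j ^ n else 1)"
    unfolding upow_def by (intro prod.cong) (auto simp: lookup_single when_def)
  then show ?thesis by simp
qed

lemma upow_0: "upow 0 = 1" by (simp add: upow_def)

lemma upow_homog: "upow \<alpha> \<in> homog (mdeg \<alpha>)"
  using homog_prod[of UNIV "\<lambda>j. u j ^ lookup \<alpha> j" "lookup \<alpha>"] homog_power[OF u1]
  by (simp add: upow_def mdeg_UNIV)

lemma dp_monomial_homog: "dp_monomial B \<alpha> \<in> homog (mdeg \<alpha>)"
proof -
  have "mdeg \<alpha> = lookup \<alpha> 0 + (lookup \<alpha> 1 + (lookup \<alpha> 2 + lookup \<alpha> 3))"
    by (simp add: mdeg_UNIV sum_4_eq add.assoc)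
  then show ?thesis unfolding dp_monomial_def by (simp only:) (intro dp_mult_homog dp_power_homog)
qed

lemma contract_dp_monomial:
  "contract (u j) (dp_monomial B \<alpha>) =
    (if lookup \<alpha> j = 0 then 0 else dp_monomial B (\<alpha> - single j 1))"
proof -
  have D: "contract (u j) (dp_power (B k) n) = (if n = 0 \<or> j \<noteq> k then 0 else dp_power (B k) (n - 1))" for j k n
    by (simp add: contract_linear_dp_power[OF u1] dual)
  have "j \<in> {0, 1, 2, 3}" using UNIV_4_eq by blast
  then show ?thesis
    by (elim insertE emptyE)
      (simp_all add: dp_monomial_def contract_linear_dp_mult[OF u1] D lookup_minus lookup_single when_def)
qed

lemma lookup_dp_monomial_0: "lookup (dp_monomial B \<alpha>) 0 = (if \<alpha> = 0 then 1 else 0)"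
proof (cases "\<alpha> = 0")
  case True
  have "dp_power l 0 = single 0 1" for l :: "(4, 'k) dpoly"
    by (rule poly_mapping_eqI) (auto simp: lookup_dp_power lookup_one when_def)
  moreover have "dp_mult 1 1 = (1 :: (4, 'k) dpoly)"
    using dp_mult_single[of "0 :: 4 mon" "1 :: 'k" 0 1] by (simp add: dp_coeff_def)
  ultimately show ?thesis using True by (simp add: dp_monomial_def)
next
  case False
  then show ?thesis using homogD[OF dp_monomial_homog[of \<alpha>], of 0] by auto
qed

text \<open>
  Contraction by \<open>u j\<close> lowers the exponent of \<open>B j\<close> in \<open>dp_monomial B \<alpha>\<close>, so the divided power
  monomials in a basis are dual to the monomials in the dual basis.
\<close>

lemma pairing_upow_dp_monomial: "pairing (upow \<beta>) (dp_monomial B \<alpha>) = (if \<alpha> = \<beta> then 1 else 0)"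
proof (induction "mdeg \<beta>" arbitrary: \<beta> \<alpha>)
  case 0
  then show ?case using pairing_single[of 0 "dp_monomial B \<alpha>"] by (simp add: upow_0 lookup_dp_monomial_0)
next
  case (Suc n)
  have "\<exists>j. lookup \<beta> j \<noteq> 0" using Suc(2) by (metis mdeg_0 nat.distinct(1) poly_mapping_eqI lookup_zero)
  then obtain j where j: "lookup \<beta> j \<noteq> 0" ..
  let ?\<beta> = "\<beta> - single j 1"
  have \<beta>: "\<beta> = ?\<beta> + single j 1" by (rule mon_decompose[OF j])
  then have "mdeg \<beta> = mdeg ?\<beta> + 1" by (metis mdeg_add mdeg_single)
  then have n: "n = mdeg ?\<beta>" using Suc(2) by simp
  have "upow \<beta> = upow ?\<beta> * u j" by (subst \<beta>) (simp add: upow_add upow_single[of j 1, simplified])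
  then have "pairing (upow \<beta>) (dp_monomial B \<alpha>) = pairing (upow ?\<beta>) (contract (u j) (dp_monomial B \<alpha>))"
    by (simp add: pairing_contract)
  also have "\<dots> = (if lookup \<alpha> j \<noteq> 0 \<and> \<alpha> - single j 1 = ?\<beta> then 1 else 0)"
    using Suc(1)[OF n] by (simp add: contract_dp_monomial)
  also have "lookup \<alpha> j \<noteq> 0 \<and> \<alpha> - single j 1 = ?\<beta> \<longleftrightarrow> \<alpha> = \<beta>"
  proof
    assume a: "lookup \<alpha> j \<noteq> 0 \<and> \<alpha> - single j 1 = ?\<beta>"
    then have "\<alpha> = (\<alpha> - single j 1) + single j 1" by (intro mon_decompose) simp
    then show "\<alpha> = \<beta>" using a \<beta> by simp
  qed (use j in auto)
  finally show ?case .
qed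

lemma upow_span: "p \<in> K_space.span (range upow)"
proof -
  let ?N = "K_space.span (range upow)"
  have gen: "p * q \<in> ?N" if "\<And>\<beta>. p * upow \<beta> \<in> ?N" "q \<in> ?N" for p q
    using that(2)
  proof (induction rule: K_space.span_induct)
    case base
    have "p * smul c x = smul c (p * x)" for c x by (simp add: smul_conv mult.left_commute)
    then show ?case
      by (simp add: K_space.subspace_def K_space.span_zero K_space.span_add K_space.span_scale distrib_left)
  next
    case (step x)
    then show ?case using that(1) by auto
  qed
  have u: "u j * q \<in> ?N" if "q \<in> ?N" for j q
  proof (rule gen[OF _ that])
    fix \<beta>
    have "u j * upow \<beta> = upow (single j 1 + \<beta>)" by (simp add: upow_add upow_single[of j 1, simplified])
    then show "u j * upow \<beta> \<in> ?N" by (metis K_space.span_base rangeI)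
  qed
  have "\<forall>q\<in>?N. p * q \<in> ?N"
  proof (induction p rule: mpoly_induct)
    case (const c)
    then show ?case by (simp add: K_space.span_scale flip: smul_conv)
  next
    case (var i)
    show ?case
    proof
      fix q assume "q \<in> ?N"
      then have "(\<Sum>j\<in>UNIV. smul (lin_coeff (B j) i) (u j * q)) \<in> ?N"
        by (intro K_space.span_sum K_space.span_scale u)
      then show "var i * q \<in> ?N" by (subst var_u) (simp add: sum_distrib_right smul_conv mult.assoc)
    qed
  qed (auto simp: distrib_right K_space.span_add mult.assoc)
  moreover have "1 \<in> ?N" by (metis K_space.span_base rangeI upow_0)
  ultimately show ?thesis by fastforce
qed

lemma pairing_upow_eq_0:
  assumes "\<And>\<beta>. pairing (upow \<beta>) H = 0" shows "H = 0"
proof (rule poly_mapping_eqI)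
  fix \<gamma>
  have "pairing p H = 0" for p
    using upow_span[of p]
  proof (induction rule: K_space.span_induct)
    case base
    show ?case by (simp add: K_space.subspace_def pairing_simps)
  qed (use assms in auto)
  from this[of "single \<gamma> 1"] show "lookup H \<gamma> = lookup 0 \<gamma>" by simp
qed

lemma dp_monomial_expansion:
  assumes F: "F \<in> homog d"
  shows "F = (\<Sum>\<alpha> | mdeg \<alpha> = d. smul (pairing (upow \<alpha>) F) (dp_monomial B \<alpha>))"
proof -
  let ?G = "\<Sum>\<alpha> | mdeg \<alpha> = d. smul (pairing (upow \<alpha>) F) (dp_monomial B \<alpha>)"
  have "pairing (upow \<beta>) (F - ?G) = 0" for \<beta>
  proof (cases "mdeg \<beta> = d")
    case True
    have "pairing (upow \<beta>) ?G = (\<Sum>\<alpha> | mdeg \<alpha> = d. if \<alpha> = \<beta> then pairing (upow \<beta>) F else 0)"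
      unfolding pairing_right_sum pairing_right_smul pairing_upow_dp_monomial by (intro sum.cong) auto
    then show ?thesis using True by (simp add: pairing_right_diff finite_mdeg)
  next
    case False
    have "F - ?G \<in> homog d"
      using dp_monomial_homog by (intro homog_diff F homog_sum homog_smul) auto
    then show ?thesis using pairing_degree[OF _ upow_homog[of \<beta>], of "F - ?G" d] False by simp
  qed
  then show ?thesis using pairing_upow_eq_0[of "F - ?G"] by simp
qed

interpretation K_endo: vector_space_pair "smul :: 'k \<Rightarrow> ('x \<Rightarrow>\<^sub>0 'k) \<Rightarrow> _" "smul :: 'k \<Rightarrow> ('y \<Rightarrow>\<^sub>0 'k) \<Rightarrow> _"
  by unfold_locales

text \<open>
  By duality the monomials \<open>dp_monomial B \<alpha>\<close> form a basis, on which the linear map is prescribed.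
\<close>

lemma dehomogenize_eq:
  assumes F: "F \<in> homog d"
  shows "dehomogenize B F = (\<Sum>\<alpha> | mdeg \<alpha> = d. single (\<alpha> - single 0 (lookup \<alpha> 0)) (pairing (upow \<alpha>) F))"
proof -
  let ?v = "\<lambda>\<alpha>. single (\<alpha> - single 0 (lookup \<alpha> 0)) (1::'k)"
  let ?P = "\<lambda>\<pi>. Vector_Spaces.linear smul smul \<pi> \<and> (\<forall>\<alpha>. \<pi> (dp_monomial B \<alpha>) = ?v \<alpha>)"
  have inj: "inj (dp_monomial B)"
    by (rule injI) (metis pairing_upow_dp_monomial zero_neq_one)
  have "K_space.independent (range (dp_monomial B))"
    unfolding K_space.independent_explicit_module
  proof (intro allI impI)
    fix t c x assume t: "finite t" "t \<subseteq> range (dp_monomial B)" "(\<Sum>v\<in>t. smul (c v) v) = 0" "x \<in> t"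
    then obtain \<beta> where \<beta>: "x = dp_monomial B \<beta>" by auto
    have "0 = pairing (upow \<beta>) (\<Sum>v\<in>t. smul (c v) v)" using t by simp
    also have "\<dots> = (\<Sum>v\<in>t. if v = x then c x else 0)"
      unfolding pairing_right_sum pairing_right_smul
    proof (intro sum.cong refl)
      fix v assume "v \<in> t"
      then obtain \<alpha> where "v = dp_monomial B \<alpha>" using t by auto
      then show "c v * pairing (upow \<beta>) v = (if v = x then c x else 0)"
        using inj by (auto simp: pairing_upow_dp_monomial \<beta> dest: injD)
    qed
    also have "\<dots> = c x" using t by simp
    finally show "c x = 0" by simp
  qed
  from K_endo.linear_independent_extend[OF this, of "\<lambda>x. ?v (inv (dp_monomial B) x)"]
  obtain \<pi> where \<pi>: "?P \<pi>" by (auto simp: inv_f_f[OF inj])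
  have lin: "\<pi>' (\<Sum>x\<in>A. smul (c x) (f x)) = (\<Sum>x\<in>A. smul (c x) (\<pi>' (f x)))"
    if "Vector_Spaces.linear smul smul \<pi>'" for \<pi>' :: "(4, 'k) dpoly \<Rightarrow> (4, 'k) dpoly" and A :: "4 mon set" and c f
    using that by (simp add: K_endo.linear_sum K_endo.linear_scale)
  have on_homog: "\<pi>' G = (\<Sum>\<alpha> | mdeg \<alpha> = e. smul (pairing (upow \<alpha>) G) (?v \<alpha>))"
    if "?P \<pi>'" "G \<in> homog e" for \<pi>' G e
  proof -
    have "\<pi>' G = \<pi>' (\<Sum>\<alpha> | mdeg \<alpha> = e. smul (pairing (upow \<alpha>) G) (dp_monomial B \<alpha>))"
      by (rule arg_cong[OF dp_monomial_expansion[OF that(2)]])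
    also have "\<dots> = (\<Sum>\<alpha> | mdeg \<alpha> = e. smul (pairing (upow \<alpha>) G) (\<pi>' (dp_monomial B \<alpha>)))"
      using that(1) by (intro lin) simp
    finally show ?thesis using that(1) by simp
  qed
  have unique: "\<pi>' = \<pi>" if \<pi>': "?P \<pi>'" for \<pi>'
  proof
    fix G
    have "\<pi>' (hom_comp e G) = \<pi> (hom_comp e G)" for e
      by (simp only: on_homog[OF \<pi> hom_comp_homog] on_homog[OF \<pi>' hom_comp_homog])
    then have "\<pi>' (\<Sum>e\<le>tdeg G. hom_comp e G) = \<pi> (\<Sum>e\<le>tdeg G. hom_comp e G)"
      unfolding K_endo.linear_sum[OF conjunct1[OF \<pi>]] K_endo.linear_sum[OF conjunct1[OF \<pi>']]
      by (simp only:)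
    then show "\<pi>' G = \<pi> G" by (simp add: sum_hom_comp)
  qed
  have "dehomogenize B = \<pi>"
    unfolding dehomogenize_def by (rule the_equality[where P = ?P, OF \<pi> unique])
  moreover have "smul c (single m (1::'k)) = single m c" for c and m :: "4 mon"
    by (rule poly_mapping_eqI) (simp add: lookup_single when_def)
  ultimately show ?thesis using on_homog[OF \<pi> F] by simp
qed

lemma lookup_dehomogenize:
  assumes F: "F \<in> homog d"
  shows "lookup (dehomogenize B F) \<gamma> =
    (if lookup \<gamma> 0 = 0 \<and> mdeg \<gamma> \<le> d then pairing (u 0 ^ (d - mdeg \<gamma>) * upow \<gamma>) F else 0)"
proof -
  have split: "\<alpha> - single 0 (lookup \<alpha> 0) = \<gamma> \<longleftrightarrow> lookup \<gamma> 0 = 0 \<and> mdeg \<gamma> \<le> d \<and> \<alpha> = single 0 (d - mdeg \<gamma>) + \<gamma>"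
    if "mdeg \<alpha> = d" for \<alpha> :: "4 mon"
  proof
    assume a: "\<alpha> - single 0 (lookup \<alpha> 0) = \<gamma>"
    have \<alpha>: "\<alpha> = single 0 (lookup \<alpha> 0) + \<gamma>" unfolding a[symmetric]
      by (rule poly_mapping_eqI) (auto simp: lookup_add lookup_minus lookup_single when_def)
    have "d = lookup \<alpha> 0 + mdeg \<gamma>" using that arg_cong[OF \<alpha>, of mdeg] by simp
    moreover have "lookup \<gamma> 0 = 0" unfolding a[symmetric] by (simp add: lookup_minus)
    ultimately show "lookup \<gamma> 0 = 0 \<and> mdeg \<gamma> \<le> d \<and> \<alpha> = single 0 (d - mdeg \<gamma>) + \<gamma>" using \<alpha> by simp
  next
    assume "lookup \<gamma> 0 = 0 \<and> mdeg \<gamma> \<le> d \<and> \<alpha> = single 0 (d - mdeg \<gamma>) + \<gamma>"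
    then show "\<alpha> - single 0 (lookup \<alpha> 0) = \<gamma>" by (simp add: lookup_add)
  qed
  have "lookup (dehomogenize B F) \<gamma> =
      (\<Sum>\<alpha> | mdeg \<alpha> = d. if \<alpha> = single 0 (d - mdeg \<gamma>) + \<gamma> then
        (if lookup \<gamma> 0 = 0 \<and> mdeg \<gamma> \<le> d then pairing (upow \<alpha>) F else 0) else 0)"
    unfolding dehomogenize_eq[OF F] lookup_sum
    by (intro sum.cong refl) (auto simp: lookup_single when_def split)
  then show ?thesis by (auto simp: finite_mdeg upow_add upow_single)
qed

end

subsection \<open>The length of the apolar scheme of a dehomogenization\<close>

lemma pairing_single_mult: "pairing (single \<gamma> 1 * p) f = (\<Sum>\<alpha>\<in>keys p. lookup p \<alpha> * lookup f (\<alpha> + \<gamma>))"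
  by (simp flip: lookup_contract add: lookup_contract_sum)

lemma plane_combination:
  assumes u1: "\<And>j. u j \<in> homog 1" and dual: "\<And>j k. pairing (u j) (B k) = (if j = k then 1 else 0)"
    and var_u: "\<And>i. var i = (\<Sum>j\<in>UNIV. const (lin_coeff (B j) i) * u j)"
    and z: "z \<in> plane (B (0::4))"
  shows "z = (\<Sum>j\<in>UNIV - {0}. const (pairing z (B j)) * u j)"
proof -
  have z1: "z \<in> homog 1" and z0: "pairing z (B 0) = 0" using z by (auto simp: plane_def)
  have "z = (\<Sum>i\<in>UNIV. \<Sum>j\<in>UNIV. const (lin_coeff z i * lin_coeff (B j) i) * u j)"
    by (subst homog_1_conv[OF z1], subst var_u)
      (simp add: smul_conv sum_distrib_left const_mult mult.assoc)
  also have "\<dots> = (\<Sum>j\<in>UNIV. \<Sum>i\<in>UNIV. const (lin_coeff z i * lin_coeff (B j) i) * u j)"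
    by (rule sum.swap)
  also have "\<dots> = (\<Sum>j\<in>UNIV. const (pairing z (B j)) * u j)"
    by (simp add: pairing_linear[OF z1] const_sum sum_distrib_right)
  also have "\<dots> = (\<Sum>j\<in>UNIV - {0}. const (pairing z (B j)) * u j)"
    by (subst sum.remove[of _ 0]) (auto simp: z0)
  finally show ?thesis .
qed

text \<open>
  Write \<open>f\<close> for the dehomogenization and \<open>\<Lambda>\<close> for the pairing with \<open>f\<close>, a functional of degree 3
  whose cubic part is the restriction of \<open>F\<close> to the plane \<open>B 0\<close>. As this restriction is not a
  cone, \<open>p\<close> annihilates \<open>f\<close> if and only if its coefficients of degree 0 and 1 vanish together with
  \<open>\<Lambda> p\<close> and the three values \<open>\<Lambda> (y\<^sub>j p)\<close>; these are 8 independent conditions.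
\<close>

theorem dehomogenization_apolar_length:
  fixes F :: "(4, 'k::field) dpoly"
  assumes F: "F \<in> homog 3" "\<not> eckardt F" and B: "linear_basis B"
  shows "affine_apolar_length (dehomogenize B F) 8"
proof -
  obtain u where u1: "\<And>j. u j \<in> homog 1" and dual: "\<And>j k. pairing (u j) (B k) = (if j = k then 1 else 0)"
    and var_u: "\<And>i. var i = (\<Sum>j\<in>UNIV. const (lin_coeff (B j) i) * u j)"
    using dual_basis[OF B] by blast
  have B0: "B 0 \<in> homog 1" using B K_space.span_base[of "B 0" "range B"] by (auto simp: linear_basis_def)
  define f where "f = dehomogenize B F"
  define T where "T b c d = pairing (u b * u c * u d) F" for b c d
  have f: "lookup f \<gamma> = (if lookup \<gamma> 0 = 0 \<and> mdeg \<gamma> \<le> 3 then pairing (u 0 ^ (3 - mdeg \<gamma>) * upow u \<gamma>) F else 0)" for \<gamma>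
    unfolding f_def by (rule lookup_dehomogenize[OF u1 dual var_u F(1)])
  have f0: "lookup f \<gamma> = 0" if "lookup \<gamma> 0 \<noteq> 0 \<or> 3 < mdeg \<gamma>" for \<gamma> using that by (auto simp: f)
  let ?e = "\<lambda>b::4. single b (Suc 0)"
  have f3: "lookup f (?e b + ?e c + ?e d) = T b c d" if "b \<noteq> 0" "c \<noteq> 0" "d \<noteq> 0" for b c d
    using that upow_add[OF u1 dual var_u] upow_single[OF u1 dual var_u, of _ 1, simplified]
    by (simp add: f lookup_add lookup_single when_def T_def)
  have nondeg: "\<exists>c d. c \<noteq> 0 \<and> d \<noteq> 0 \<and> (\<Sum>b\<in>UNIV - {0}. a b * T b c d) \<noteq> 0" if a: "\<exists>b. b \<noteq> 0 \<and> a b \<noteq> 0" for a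
  proof (rule ccontr)
    assume neg: "\<not> ?thesis"
    define \<Psi> where "\<Psi> = (\<Sum>b\<in>UNIV - {0}. const (a b) * u b)"
    have \<Psi>1: "\<Psi> \<in> homog 1" unfolding \<Psi>_def by (intro homog_sum homog_const_mult u1)
    have val: "pairing \<Psi> (B k) = (if k = 0 then 0 else a k)" for k
    proof -
      have "pairing \<Psi> (B k) = (\<Sum>b\<in>UNIV - {0}. if b = k then a k else 0)"
        unfolding \<Psi>_def pairing_simps pairing_const_mult dual by (intro sum.cong) auto
      then show ?thesis by simp
    qed
    obtain b where "b \<noteq> 0" "a b \<noteq> 0" using a by blast
    then have "\<Psi> \<noteq> 0" using val[of b] by (auto simp: pairing_simps)
    moreover have "B 0 \<noteq> 0" using dual[of 0 0] by auto
    moreover have "pairing (\<Psi> * z * z') F = 0" if z: "z \<in> plane (B 0)" "z' \<in> plane (B 0)" for z z'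
    proof -
      have "\<Psi> * z * z' = \<Psi> * ((\<Sum>c\<in>UNIV - {0}. const (pairing z (B c)) * u c) *
          (\<Sum>d\<in>UNIV - {0}. const (pairing z' (B d)) * u d))"
        using plane_combination[OF u1 dual var_u z(1)] plane_combination[OF u1 dual var_u z(2)]
        by (simp add: mult.assoc)
      also have "\<dots> = (\<Sum>c\<in>UNIV - {0}. \<Sum>d\<in>UNIV - {0}.
          const (pairing z (B c) * pairing z' (B d)) * (\<Psi> * u c * u d))"
        by (simp add: sum_product sum_distrib_left const_mult mult_ac)
      finally have prod: "\<Psi> * z * z' = \<dots>" .
      have "pairing (\<Psi> * u c * u d) F = 0" if "c \<in> UNIV - {0}" "d \<in> UNIV - {0}" for c d
      proof -
        have "\<Psi> * u c * u d = (\<Sum>b\<in>UNIV - {0}. const (a b) * (u b * u c * u d))"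
          by (simp add: \<Psi>_def sum_distrib_right mult.assoc)
        then show ?thesis using neg that by (auto simp: pairing_simps T_def)
      qed
      then show ?thesis unfolding prod by (simp add: pairing_simps)
    qed
    ultimately have "eckardt F" unfolding eckardt_def using \<Psi>1 val[of 0] B0 by auto
    then show False using F by simp
  qed
  have T_ex: "\<exists>b c d. b \<noteq> 0 \<and> c \<noteq> 0 \<and> d \<noteq> 0 \<and> T b c d \<noteq> 0"
  proof -
    have "\<exists>b. b \<noteq> (0::4) \<and> (1::'k) \<noteq> 0" by (rule exI[of _ 1]) simp
    from nondeg[OF this] obtain c d where cd: "c \<noteq> 0" "d \<noteq> 0" "(\<Sum>b\<in>UNIV - {0}. 1 * T b c d) \<noteq> 0" by blast
    obtain b where "b \<in> UNIV - {0}" "1 * T b c d \<noteq> 0"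
      by (rule sum.not_neutral_contains_not_neutral[OF cd(3)])
    then show ?thesis using cd by auto
  qed

  have sub: "K_space.subspace (affine_ring :: (4, 'k) mpoly set)"
  proof -
    have "p \<in> affine_ring \<longleftrightarrow> (\<forall>m. lookup m 0 \<noteq> 0 \<longrightarrow> lookup p m = 0)" for p :: "(4, 'k) mpoly"
      unfolding affine_ring_def mem_Collect_eq Ball_def in_keys_iff by (rule iff_allI) argo
    then show ?thesis by (simp add: K_space.subspace_def lookup_add)
  qed
  have mono: "single m 1 \<in> affine_ring" if "lookup m 0 = 0" for m using that by (simp add: affine_ring_def)
  define \<xi> :: "4 + 4 \<Rightarrow> (4, 'k) mpoly \<Rightarrow> 'k" where "\<xi> s p = (case s of
      Inl b \<Rightarrow> if b = 0 then pairing p f else pairing (var b * p) f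
    | Inr b \<Rightarrow> if b = 0 then lookup p 0 else lookup p (?e b))" for s p
  have lin: "linear_form (\<xi> s)" for s
    using linear_form_mult[OF linear_form_pairing, of _ f]
    by (cases s) (auto simp: \<xi>_def linear_form_def lookup_add pairing_simps)
  have \<xi>_sum: "(\<Sum>s\<in>UNIV. c s * \<xi> s p) =
      c (Inl 0) * pairing p f + (\<Sum>b\<in>UNIV - {0}. c (Inl b) * pairing (var b * p) f) +
      c (Inr 0) * lookup p 0 + (\<Sum>b\<in>UNIV - {0}. c (Inr b) * lookup p (?e b))" for c p
  proof -
    have "(\<Sum>s\<in>UNIV. c s * \<xi> s p) = (\<Sum>b\<in>UNIV. c (Inl b) * \<xi> (Inl b) p) + (\<Sum>b\<in>UNIV. c (Inr b) * \<xi> (Inr b) p)"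
      by (subst UNIV_Plus_UNIV[symmetric], subst sum.Plus) auto
    also have "(\<Sum>b\<in>UNIV. c (Inl b) * \<xi> (Inl b) p) =
        c (Inl 0) * pairing p f + (\<Sum>b\<in>UNIV - {0}. c (Inl b) * pairing (var b * p) f)"
      by (subst sum.remove[of _ 0]) (auto simp: \<xi>_def intro!: sum.cong)
    also have "(\<Sum>b\<in>UNIV. c (Inr b) * \<xi> (Inr b) p) =
        c (Inr 0) * lookup p 0 + (\<Sum>b\<in>UNIV - {0}. c (Inr b) * lookup p (?e b))"
      by (subst sum.remove[of _ 0]) (auto simp: \<xi>_def intro!: sum.cong)
    finally show ?thesis by (simp add: add.assoc)
  qed
  have indep: "\<forall>s\<in>UNIV. c s = 0" if "\<forall>v\<in>affine_ring. (\<Sum>s\<in>UNIV. c s * \<xi> s v) = 0" for c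
  proof -
    have rel: "c (Inl 0) * lookup f m + (\<Sum>b\<in>UNIV - {0}. c (Inl b) * lookup f (?e b + m)) +
      c (Inr 0) * lookup (single m 1) 0 + (\<Sum>b\<in>UNIV - {0}. c (Inr b) * lookup (single m 1) (?e b)) = 0"
      if "lookup m 0 = 0" for m
      using \<open>\<forall>v\<in>affine_ring. _ v\<close>[rule_format, OF mono[OF that]] unfolding \<xi>_sum
      by (simp add: var_def mult_single)
    have low: "lookup (single m (1::'k)) 0 = 0" "lookup (single m (1::'k)) (single b (Suc 0)) = 0" if "2 \<le> mdeg m" for m :: "4 mon" and b
      using that by (auto simp: lookup_single when_def)
    have c1: "c (Inl 0) = 0"
    proof -
      obtain b c' d where bcd: "b \<noteq> 0" "c' \<noteq> 0" "d \<noteq> 0" "T b c' d \<noteq> 0" using T_ex by blast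
      have m0: "lookup (?e b + ?e c' + ?e d) 0 = 0" using bcd by (simp add: lookup_add lookup_single)
      have "c (Inl 0) * T b c' d = 0"
        using rel[OF m0] f3[OF bcd(1-3)] by (simp add: low f0)
      then show ?thesis using bcd by simp
    qed
    have c2: "c (Inl b) = 0" if b0: "b \<noteq> 0" for b
    proof (rule ccontr)
      assume "c (Inl b) \<noteq> 0"
      then have "\<exists>b. b \<noteq> 0 \<and> c (Inl b) \<noteq> 0" using b0 by blast
      from nondeg[OF this] obtain c' d
        where cd: "c' \<noteq> 0" "d \<noteq> 0" "(\<Sum>b\<in>UNIV - {0}. c (Inl b) * T b c' d) \<noteq> 0" by blast
      have "(\<Sum>b\<in>UNIV - {0}. c (Inl b) * lookup f (?e b + (?e c' + ?e d))) = (\<Sum>b\<in>UNIV - {0}. c (Inl b) * T b c' d)"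
        using cd f3 by (intro sum.cong) (auto simp: add.assoc[symmetric])
      then show False using rel[of "?e c' + ?e d"] cd c1 low[of "?e c' + ?e d"] by (simp add: lookup_add lookup_single)
    qed
    have c3: "c (Inr b) = 0" if b: "b \<noteq> 0" for b
    proof -
      have "(\<Sum>b'\<in>UNIV - {0}. c (Inr b') * lookup (single (?e b) 1) (?e b')) = (\<Sum>b'\<in>UNIV - {0}. if b' = b then c (Inr b) else 0)"
        by (intro sum.cong) (auto simp: lookup_single when_def single_1_eq_iff)
      then have "c (Inr 0) * lookup (single (?e b) 1) 0 + c (Inr b) = 0"
        using rel[of "?e b"] b by (simp add: c1 c2 lookup_single)
      moreover have "?e b \<noteq> 0" by (metis mdeg_0 mdeg_single nat.distinct(1))
      ultimately show ?thesis by (simp add: lookup_single)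
    qed
    have "c (Inr 0) = 0" using rel[of 0] by (simp add: c1 c2 c3)
    then have "c s = 0" for s using c1 c2 c3 by (cases s) metis+
    then show ?thesis by blast
  qed
  have low_part: "pairing (single \<gamma> 1 * p) f = lookup p 0 * lookup f \<gamma> + (\<Sum>b\<in>UNIV - {0}. lookup p (?e b) * lookup f (?e b + \<gamma>))"
    if \<gamma>: "2 \<le> mdeg \<gamma>" for p \<gamma>
  proof -
    let ?A = "insert 0 (?e ` UNIV)"
    have e0: "0 \<notin> ?e ` UNIV" by (metis (no_types, lifting) imageE mdeg_0 mdeg_single nat.distinct(1))
    have inj: "inj ?e" by (rule injI) (simp add: single_1_eq_iff)
    have "pairing (single \<gamma> 1 * p) f = (\<Sum>\<alpha>\<in>keys p \<union> ?A. lookup p \<alpha> * lookup f (\<alpha> + \<gamma>))"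
      unfolding pairing_single_mult by (intro sum.mono_neutral_left) (auto simp: in_keys_iff)
    also have "\<dots> = (\<Sum>\<alpha>\<in>?A. lookup p \<alpha> * lookup f (\<alpha> + \<gamma>))"
    proof (intro sum.mono_neutral_right ballI)
      fix \<alpha> assume \<alpha>: "\<alpha> \<in> (keys p \<union> ?A) - ?A"
      then have "\<alpha> \<noteq> 0" "mdeg \<alpha> \<noteq> 1" using mdeg_1_cases[of \<alpha>] by auto
      then have "mdeg \<alpha> \<noteq> 0" "mdeg \<alpha> \<noteq> 1" by auto
      then have "3 < mdeg (\<alpha> + \<gamma>)" using \<gamma> unfolding mdeg_add by linarith
      then show "lookup p \<alpha> * lookup f (\<alpha> + \<gamma>) = 0" by (simp only: f0 mult_zero_right simp_thms)
    qed auto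
    also have "\<dots> = lookup p 0 * lookup f \<gamma> + (\<Sum>b\<in>UNIV. lookup p (?e b) * lookup f (?e b + \<gamma>))"
      using e0 by (simp add: sum.reindex[OF inj[unfolded One_nat_def]])
    also have "(\<Sum>b\<in>UNIV. lookup p (?e b) * lookup f (?e b + \<gamma>)) = (\<Sum>b\<in>UNIV - {0}. lookup p (?e b) * lookup f (?e b + \<gamma>))"
      by (subst sum.remove[of _ 0]) (auto simp: f0 lookup_add)
    finally show ?thesis .
  qed
  have W: "p \<in> {p \<in> affine_ring. contract p f = 0} \<longleftrightarrow> (\<forall>s\<in>UNIV. \<xi> s p = 0)" if p: "p \<in> affine_ring" for p
  proof
    assume "p \<in> {p \<in> affine_ring. contract p f = 0}"
    then have ann: "pairing (q * p) f = 0" for q by (simp add: contract_eq_0_iff)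
    have p0: "lookup p 0 = 0"
    proof -
      obtain b c d where bcd: "b \<noteq> 0" "c \<noteq> 0" "d \<noteq> 0" "T b c d \<noteq> 0" using T_ex by blast
      have "0 = pairing (single (?e b + ?e c + ?e d) 1 * p) f" by (simp add: ann)
      also have "\<dots> = lookup p 0 * T b c d"
        by (subst low_part) (auto simp: f3[OF bcd(1-3)] f0)
      finally show ?thesis using bcd by simp
    qed
    have p1: "lookup p (?e b) = 0" if b0: "b \<noteq> 0" for b
    proof (rule ccontr)
      assume "lookup p (?e b) \<noteq> 0"
      then have "\<exists>b. b \<noteq> 0 \<and> lookup p (?e b) \<noteq> 0" using b0 by blast
      from nondeg[OF this] obtain c d
        where cd: "c \<noteq> 0" "d \<noteq> 0" "(\<Sum>b\<in>UNIV - {0}. lookup p (?e b) * T b c d) \<noteq> 0" by blast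
      have "0 = pairing (single (?e c + ?e d) 1 * p) f" by (simp add: ann)
      also have "\<dots> = (\<Sum>b\<in>UNIV - {0}. lookup p (?e b) * T b c d)"
        using cd f3 by (subst low_part) (auto simp: p0 add.assoc[symmetric] intro!: sum.cong)
      finally show False using cd by simp
    qed
    show "\<forall>s\<in>UNIV. \<xi> s p = 0"
    proof
      fix s show "\<xi> s p = 0" using ann[of 1] ann p0 p1 by (cases s) (auto simp: \<xi>_def)
    qed
  next
    assume all: "\<forall>s\<in>UNIV. \<xi> s p = 0"
    have \<Lambda>: "pairing p f = 0" using bspec[OF all, of "Inl 0"] by (simp add: \<xi>_def)
    have \<Lambda>1: "pairing (var b * p) f = 0" if "b \<noteq> 0" for b
      using bspec[OF all, of "Inl b"] that by (simp add: \<xi>_def)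
    have p0: "lookup p 0 = 0" using bspec[OF all, of "Inr 0"] by (simp add: \<xi>_def)
    have p1: "lookup p (?e b) = 0" if "b \<noteq> 0" for b
      using bspec[OF all, of "Inr b"] that by (simp add: \<xi>_def)
    have "pairing (single \<gamma> 1 * p) f = 0" for \<gamma>
    proof -
      consider "lookup \<gamma> 0 \<noteq> 0" | "\<gamma> = 0" | b where "\<gamma> = ?e b" "b \<noteq> 0" | "2 \<le> mdeg \<gamma>"
      proof -
        have "mdeg \<gamma> = 0 \<or> mdeg \<gamma> = 1 \<or> 2 \<le> mdeg \<gamma>" by linarith
        then show ?thesis
        proof (elim disjE)
          assume "mdeg \<gamma> = 1"
          then obtain i where i: "\<gamma> = ?e i" using mdeg_1_cases[of \<gamma>] by auto
          show ?thesis using that(1) that(3)[OF i] by (cases "i = 0") (auto simp: i)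
        qed (use that in auto)
      qed
      then show ?thesis
      proof cases
        case 1
        then show ?thesis unfolding pairing_single_mult by (intro sum.neutral) (auto simp: f0 lookup_add)
      next
        case 2
        then show ?thesis using \<Lambda> by simp
      next
        case (3 b)
        then show ?thesis using \<Lambda>1 by (simp add: var_def)
      next
        case 4
        then show ?thesis by (subst low_part) (auto simp: p0 p1)
      qed
    qed
    then show "p \<in> {p \<in> affine_ring. contract p f = 0}"
      using p by (auto intro!: poly_mapping_eqI simp: lookup_contract)
  qed
  have "quot_dim affine_ring {p \<in> affine_ring. contract p f = 0} 8"
    by (rule quot_dimI[of UNIV 8 affine_ring \<xi>, OF _ _ sub lin indep W]) (auto simp: card_UNIV_sum)
  then show ?thesis by (simp add: affine_apolar_length_def f_def)
qed

section \<open>Cuspidal plane sections\<close>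

text \<open>
  A frame adapted to a plane section with a singular point \<open>u 1\<close> whose tangent cone is a square:
  \<open>u 0\<close> is off the plane, and \<open>u 3\<close> spans the tangent cone together with \<open>u 1\<close>. The last condition
  is met by a suitable choice of \<open>u 2\<close>, unless the section is a cone.
\<close>

definition cuspidal_frame :: "(4, 'k::field) dpoly \<Rightarrow> (4 \<Rightarrow> (4, 'k) mpoly) \<Rightarrow> bool" where
  "cuspidal_frame F u \<longleftrightarrow>
    pairing (u 1 * u 1 * u 1) F = 0 \<and> pairing (u 1 * u 1 * u 2) F = 0 \<and> pairing (u 1 * u 1 * u 3) F = 0 \<and>
    pairing (u 1 * u 2 * u 3) F = 0 \<and> pairing (u 1 * u 3 * u 3) F = 0 \<and>
    pairing (u 0 * u 1 * u 1) F \<noteq> 0 \<and> pairing (u 1 * u 2 * u 2) F \<noteq> 0 \<and> pairing (u 2 * u 3 * u 3) F \<noteq> 0"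

lemma four_linear_forms_basis:
  fixes u :: "4 \<Rightarrow> (4, 'k::field) mpoly"
  assumes u1: "\<And>j. u j \<in> homog 1"
    and indep: "\<And>c. (\<Sum>j\<in>UNIV. const (c j) * u j) = 0 \<Longrightarrow> \<forall>j. c j = 0"
  shows "\<exists>B. (\<forall>j k. pairing (u j) (B k) = (if j = k then 1 else 0)) \<and>
    (\<forall>i. var i = (\<Sum>j\<in>UNIV. const (lin_coeff (B j) i) * u j))"
proof -
  have "\<exists>e. var i = (\<Sum>j\<in>UNIV. const (e j) * u j)" for i
  proof -
    let ?v = "\<lambda>s. case s of None \<Rightarrow> var i | Some j \<Rightarrow> u j"
    have "card (UNIV :: 4 set) < card (UNIV :: 4 option set)" by (simp add: card_UNIV_option)
    from underdetermined_system[OF finite finite this, of "\<lambda>s k. lin_coeff (?v s) k"]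
    obtain c where c: "\<exists>s. c s \<noteq> 0" "\<And>k. (\<Sum>s\<in>UNIV. c s * lin_coeff (?v s) k) = 0" by auto
    have c': "c None * lin_coeff (var i) k + (\<Sum>j\<in>UNIV. c (Some j) * lin_coeff (u j) k) = 0" for k
      using c(2)[of k] by (simp add: UNIV_option_conv sum.reindex)
    have zero: "const (c None) * var i + (\<Sum>j\<in>UNIV. const (c (Some j)) * u j) = 0"
    proof (rule homog_1_eqI)
      show "const (c None) * var i + (\<Sum>j\<in>UNIV. const (c (Some j)) * u j) \<in> homog 1"
        by (intro homog_add homog_sum homog_const_mult homog_var u1)
      show "lin_coeff (const (c None) * var i + (\<Sum>j\<in>UNIV. const (c (Some j)) * u j)) k = lin_coeff 0 k" for k
        using c'[of k] by (simp only: lin_coeff_simps lin_coeff_sum)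
    qed simp
    have nz: "c None \<noteq> 0"
    proof
      assume "c None = 0"
      then have "\<forall>j. c (Some j) = 0" using zero by (intro indep) simp
      then show False using c(1) \<open>c None = 0\<close> by (metis option.exhaust)
    qed
    let ?a = "inverse (c None)"
    have "const ?a * (const (c None) * var i) = var i" using nz by (simp flip: mult.assoc const_mult)
    moreover have "const (c None) * var i = - (\<Sum>j\<in>UNIV. const (c (Some j)) * u j)"
      using zero by (simp add: eq_neg_iff_add_eq_0)
    ultimately have "var i = const ?a * - (\<Sum>j\<in>UNIV. const (c (Some j)) * u j)" by simp
    also have "\<dots> = (\<Sum>j\<in>UNIV. const (- ?a * c (Some j)) * u j)"
      by (simp add: sum_distrib_left const_mult const_minus mult.assoc sum_negf)
    finally show ?thesis by (rule exI[of _ "\<lambda>j. - ?a * c (Some j)"])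
  qed
  then obtain e where e: "\<And>i. var i = (\<Sum>j\<in>UNIV. const (e i j) * u j)" by metis
  define B where "B j = (\<Sum>i\<in>UNIV. smul (e i j) (var i))" for j
  have lB: "lin_coeff (B j) i = e i j" for i j by (simp only: B_def lin_coeff_combination)
  have "pairing (u j) (B k) = (if j = k then 1 else 0)" for j k
  proof -
    have "u j = (\<Sum>i\<in>UNIV. const (lin_coeff (u j) i) * (\<Sum>k\<in>UNIV. const (e i k) * u k))"
      using homog_1_conv[OF u1[of j]] e by (simp add: smul_conv)
    also have "\<dots> = (\<Sum>i\<in>UNIV. \<Sum>k\<in>UNIV. const (lin_coeff (u j) i * e i k) * u k)"
      by (simp add: sum_distrib_left const_mult mult.assoc)
    also have "\<dots> = (\<Sum>k\<in>UNIV. \<Sum>i\<in>UNIV. const (lin_coeff (u j) i * e i k) * u k)" by (rule sum.swap)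
    also have "\<dots> = (\<Sum>k\<in>UNIV. const (pairing (u j) (B k)) * u k)"
      by (simp add: pairing_linear[OF u1] lB const_sum sum_distrib_right)
    finally have eq: "u j = (\<Sum>k\<in>UNIV. const (pairing (u j) (B k)) * u k)" .
    have "u j = (\<Sum>k\<in>UNIV. if k = j then u k else 0)" by simp
    also have "\<dots> = (\<Sum>k\<in>UNIV. const (if k = j then 1 else 0) * u k)" by (intro sum.cong) auto
    finally have "(\<Sum>k\<in>UNIV. const (pairing (u j) (B k) - (if k = j then 1 else 0)) * u k) = 0"
      using eq by (simp add: const_diff left_diff_distrib sum_subtractf)
    from indep[OF this] show ?thesis by (metis eq_iff_diff_eq_0)
  qed
  then show ?thesis using e lB by (intro exI[of _ B]) simp
qed

lemma sum_4_const: "(\<Sum>j\<in>UNIV. const (c j) * u (j :: 4)) =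
    const (c 0) * u 0 + const (c 1) * u 1 + const (c 2) * u 2 + const (c 3) * u 3"
  by (rule sum_4_eq)

lemma independent_4:
  fixes a b c d :: "(4, 'k::field) mpoly"
  assumes "\<And>s t v w. const s * a + const t * b + const v * c + const w * d = 0 \<Longrightarrow> s = 0 \<and> t = 0 \<and> v = 0 \<and> w = 0"
    and "(\<Sum>j\<in>UNIV. const (e j) * (if j = 0 then a else if j = 1 then b else if j = 2 then c else d)) = 0"
  shows "\<forall>j::4. e j = 0"
proof
  fix j :: 4
  have "e 0 = 0 \<and> e 1 = 0 \<and> e 2 = 0 \<and> e 3 = 0"
    using assms(2) by (intro assms(1)) (simp add: sum_4_const)
  moreover have "j \<in> {0, 1, 2, 3}" using UNIV_4_eq by blast
  ultimately show "e j = 0" by auto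
qed

text \<open>
  Let \<open>m\<close> be the linear form whose square is the tangent cone. For \<open>u 3\<close> any second vector in the plane
  with \<open>m = 0\<close> is taken, and for \<open>u 2\<close> a vector with \<open>m \<noteq> 0\<close>. If \<open>u 2 * u 3 * u 3\<close> paired to zero for
  every choice of \<open>u 2\<close>, then so would \<open>u 3 * u 3 * u 3\<close>, and a combination of \<open>u 3\<close> and \<open>u 1\<close> would be
  a vertex of the section.
\<close>

lemma exists_cuspidal_frame:
  fixes F :: "(4, 'k::field_char_0) dpoly"
  assumes F: "F \<in> homog 3" "smooth_cubic F" "\<not> eckardt F" and l: "l \<in> homog 1" "l \<noteq> 0"
    and sing: "section_singular_at F l \<Psi>" and square: "tangent_cone_square F l \<Psi>"
  shows "\<exists>u B. (\<forall>j. u j \<in> homog 1) \<and> (\<forall>j k. pairing (u j) (B k) = (if j = k then 1 else 0)) \<and>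
    (\<forall>i. var i = (\<Sum>j\<in>UNIV. const (lin_coeff (B j) i) * u j)) \<and> (\<forall>j. pairing (u j) l = (if j = 0 then 1 else 0)) \<and>
    cuspidal_frame F u"
proof -
  let ?\<phi> = "\<lambda>p. pairing p F"
  have \<Psi>: "\<Psi> \<in> homog 1" "\<Psi> \<noteq> 0" "pairing \<Psi> l = 0" "\<Psi> \<in> plane l" and "contract (\<Psi> ^ 3) F = 0"
    using sing by (auto simp: section_singular_at_def cubic_surface_def plane_def)
  then have \<Psi>3: "?\<phi> (\<Psi> * \<Psi> * \<Psi>) = 0" by (simp add: pairing_def power3_eq_cube)
  have \<Psi>2: "?\<phi> (\<Psi> * \<Psi> * z) = 0" if "z \<in> plane l" for z
    using sing that by (auto simp: section_singular_at_def taylor_part_def power2_eq_square)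
  have "(3 choose 2) = (3 :: nat)" by (simp add: eval_nat_numeral)
  then have taylor2: "taylor_part 2 F \<Psi> z = 3 * ?\<phi> (\<Psi> * z * z)" for z
    by (simp add: taylor_part_def power2_eq_square mult.assoc)
  obtain m where m: "\<And>z. z \<in> plane l \<Longrightarrow> 3 * ?\<phi> (\<Psi> * z * z) = (pairing z m)\<^sup>2" "\<exists>z\<in>plane l. pairing z m \<noteq> 0"
    using square unfolding tangent_cone_square_def taylor2 by blast
  have plane_add: "z + z' \<in> plane l" "const s * z \<in> plane l" "z - z' \<in> plane l" if "z \<in> plane l" "z' \<in> plane l" for z z' s
    using that by (auto simp: plane_def pairing_simps homog_add homog_diff homog_const_mult)
  have polar: "3 * ?\<phi> (\<Psi> * z * z') = pairing z m * pairing z' m" if z: "z \<in> plane l" "z' \<in> plane l" for z z'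
  proof -
    have "\<Psi> * (z + z') * (z + z') = \<Psi> * z * z + \<Psi> * z' * z' + const 2 * (\<Psi> * z * z')"
    proof -
      have "const 2 = (2 :: (4, 'k) mpoly)" using const_add[of "1::'k" 1] by simp
      then show ?thesis by (simp add: algebra_simps)
    qed
    then have "?\<phi> (\<Psi> * (z + z') * (z + z')) = ?\<phi> (\<Psi> * z * z) + ?\<phi> (\<Psi> * z' * z') + 2 * ?\<phi> (\<Psi> * z * z')"
      by (simp only: pairing_simps pairing_const_mult)
    moreover have "3 * ?\<phi> (\<Psi> * (z + z') * (z + z')) = (pairing z m + pairing z' m)\<^sup>2"
      using m(1)[OF plane_add(1)[OF z]] by (simp add: pairing_simps)
    ultimately have "2 * (3 * ?\<phi> (\<Psi> * z * z')) = 2 * (pairing z m * pairing z' m)"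
      using m(1)[OF z(1)] m(1)[OF z(2)] by algebra
    then show ?thesis by simp
  qed
  have m\<Psi>: "pairing \<Psi> m = 0" using m(1)[OF \<Psi>(4)] \<Psi>3 by simp
  obtain i where i: "lin_coeff l i \<noteq> 0" using homog_1_eqI[OF l(1) homog_0] l(2) by auto
  define h :: "(4, 'k) mpoly" where "h = const (inverse (lin_coeff l i)) * var i"
  have h: "h \<in> homog 1" "pairing h l = 1" using i by (simp_all add: h_def homog_const_mult)
  have h\<Psi>: "?\<phi> (h * \<Psi> * \<Psi>) \<noteq> 0"
  proof -
    have "\<Psi> \<in> cubic_surface F" using sing by (simp add: section_singular_at_def)
    then obtain \<Phi> where \<Phi>: "\<Phi> \<in> homog 1" "taylor_part 1 F \<Psi> \<Phi> \<noteq> 0" using F(2) by (auto simp: smooth_cubic_def)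
    then have nz: "?\<phi> (\<Psi> * \<Psi> * \<Phi>) \<noteq> 0" by (auto simp: taylor_part_def power2_eq_square)
    have "\<Phi> - const (pairing \<Phi> l) * h \<in> plane l"
      using \<Phi>(1) h by (simp add: plane_def pairing_simps homog_diff homog_const_mult)
    then have "?\<phi> (\<Psi> * \<Psi> * (\<Phi> - const (pairing \<Phi> l) * h)) = 0" by (rule \<Psi>2)
    moreover have "\<Psi> * \<Psi> * (\<Phi> - const (pairing \<Phi> l) * h) = \<Psi> * \<Psi> * \<Phi> - const (pairing \<Phi> l) * (h * \<Psi> * \<Psi>)"
      by (simp add: algebra_simps)
    ultimately have "?\<phi> (\<Psi> * \<Psi> * \<Phi>) = pairing \<Phi> l * ?\<phi> (h * \<Psi> * \<Psi>)" by (simp add: pairing_simps)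
    then show ?thesis using nz by auto
  qed
  obtain z2 where z2: "z2 \<in> plane l" "pairing z2 m \<noteq> 0" using m(2) by blast
  define red where "red p = (p - const (pairing p l) * h) -
    const (pairing (p - const (pairing p l) * h) m / pairing z2 m) * z2" for p
  have red: "red p \<in> plane l" "pairing (red p) m = 0" if "p \<in> homog 1" for p
  proof -
    have "p - const (pairing p l) * h \<in> plane l"
      using that h by (simp add: plane_def pairing_simps homog_diff homog_const_mult)
    then show "red p \<in> plane l" unfolding red_def using plane_add z2(1) by blast
    show "pairing (red p) m = 0" unfolding red_def using z2(2) by (simp add: pairing_simps)
  qed
  have "\<exists>z3\<in>plane l. pairing z3 m = 0 \<and> (\<forall>s. z3 \<noteq> const s * \<Psi>)"
  proof (rule ccontr)
    assume neg: "\<not> ?thesis"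
    have "\<exists>s t v. var j = const s * h + const t * z2 + const v * \<Psi>" for j
    proof -
      obtain v where "red (var j) = const v * \<Psi>" using neg red[of "var j"] by auto
      then have "var j = const (pairing (var j) l) * h +
          const (pairing (var j - const (pairing (var j) l) * h) m / pairing z2 m) * z2 + const v * \<Psi>"
        unfolding red_def by (simp only: diff_eq_eq) (simp add: algebra_simps)
      then show ?thesis by blast
    qed
    then obtain s t v where stv: "\<And>j. var j = const (s j) * h + const (t j) * z2 + const (v j) * \<Psi>" by metis
    let ?M = "\<lambda>j n. if n = (0::nat) then s j else if n = 1 then t j else v j"
    have "card {0, 1, 2::nat} < card (UNIV :: 4 set)" by simp
    from underdetermined_system[OF _ _ this, of ?M]
    obtain c where c: "\<exists>j. c j \<noteq> 0" "(\<Sum>j\<in>UNIV. c j * s j) = 0" "(\<Sum>j\<in>UNIV. c j * t j) = 0"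
      "(\<Sum>j\<in>UNIV. c j * v j) = 0" by auto
    have "(\<Sum>j\<in>UNIV. const (c j) * var j) = const (\<Sum>j\<in>UNIV. c j * s j) * h +
        const (\<Sum>j\<in>UNIV. c j * t j) * z2 + const (\<Sum>j\<in>UNIV. c j * v j) * \<Psi>"
      by (subst stv) (simp add: const_sum const_mult sum_distrib_right distrib_left sum.distrib mult.assoc)
    also have "\<dots> = 0" by (simp add: c)
    finally have "(\<Sum>j\<in>UNIV. smul (c j) (var j)) = 0" by (simp add: smul_conv)
    then have "c j = 0" for j using lin_coeff_combination[of c j] by simp
    then show False using c(1) by blast
  qed
  then obtain z3 where z3: "z3 \<in> plane l" "pairing z3 m = 0" "\<And>s. z3 \<noteq> const s * \<Psi>" by blast
  have p1: "z \<in> homog 1" "pairing z l = 0" if "z \<in> plane l" for z using that by (auto simp: plane_def)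
  have ind: "s = 0 \<and> t = 0 \<and> v = 0 \<and> w = 0"
    if "const s * h + const t * \<Psi> + const v * z + const w * z3 = 0" "z \<in> plane l" "pairing z m \<noteq> 0" for s t v w z
  proof -
    have "pairing (const s * h + const t * \<Psi> + const v * z + const w * z3) l = 0" by (simp add: that(1) pairing_simps)
    then have s: "s = 0" using h \<Psi>(3) p1(2)[OF that(2)] p1(2)[OF z3(1)] by (simp add: pairing_simps)
    have "pairing (const s * h + const t * \<Psi> + const v * z + const w * z3) m = 0" by (simp add: that(1) pairing_simps)
    then have v: "v = 0" using s m\<Psi> that(3) z3(2) by (simp add: pairing_simps)
    have eq: "const t * \<Psi> + const w * z3 = 0" using that(1) s v by simp
    have w: "w = 0"
    proof (rule ccontr)
      assume nz: "w \<noteq> 0"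
      have "z3 = const (inverse w) * (const w * z3)" using nz by (simp flip: mult.assoc const_mult)
      also have "const w * z3 = - (const t * \<Psi>)" using eq by (simp add: eq_neg_iff_add_eq_0 add.commute)
      also have "const (inverse w) * - (const t * \<Psi>) = const (- inverse w * t) * \<Psi>"
        by (simp add: const_mult const_minus mult.assoc)
      finally show False using z3(3) by blast
    qed
    have "t = 0"
    proof (rule ccontr)
      assume nz: "t \<noteq> 0"
      have "\<Psi> = const (inverse t) * (const t * \<Psi>)" using nz by (simp flip: mult.assoc const_mult)
      then show False using eq w \<Psi>(2) by simp
    qed
    then show ?thesis using s v w by simp
  qed
  have basis: "\<exists>B. (\<forall>j k. pairing (u j) (B k) = (if j = k then 1 else 0)) \<and>
      (\<forall>i. var i = (\<Sum>j\<in>UNIV. const (lin_coeff (B j) i) * u j))"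
    if u: "u = (\<lambda>j::4. if j = 0 then h else if j = 1 then \<Psi> else if j = 2 then z else z3)"
      and z: "z \<in> plane l" "pairing z m \<noteq> 0" for z u
  proof (rule four_linear_forms_basis)
    show "u j \<in> homog 1" for j using h(1) \<Psi>(1) p1(1)[OF z(1)] p1(1)[OF z3(1)] by (simp add: u)
    show "\<forall>j. c j = 0" if "(\<Sum>j\<in>UNIV. const (c j) * u j) = 0" for c
      using that unfolding u by (rule independent_4[rotated]) (rule ind[OF _ z])
  qed
  have in_plane: "\<exists>s t v. p = const s * \<Psi> + const t * z2 + const v * z3" if p: "p \<in> plane l" for p
  proof -
    define u where "u = (\<lambda>j::4. if j = 0 then h else if j = 1 then \<Psi> else if j = 2 then z2 else z3)"
    obtain B where B: "\<forall>i. var i = (\<Sum>j\<in>UNIV. const (lin_coeff (B j) i) * u j)"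
      using basis[OF u_def z2] by blast
    have "p = (\<Sum>i\<in>UNIV. const (lin_coeff p i) * var i)" using homog_1_conv[OF p1(1)[OF p]] by (simp add: smul_conv)
    also have "\<dots> = (\<Sum>i\<in>UNIV. \<Sum>j\<in>UNIV. const (lin_coeff p i * lin_coeff (B j) i) * u j)"
      using B by (simp add: sum_distrib_left const_mult mult.assoc)
    also have "\<dots> = (\<Sum>j\<in>UNIV. \<Sum>i\<in>UNIV. const (lin_coeff p i * lin_coeff (B j) i) * u j)" by (rule sum.swap)
    also have "\<dots> = (\<Sum>j\<in>UNIV. const (\<Sum>i\<in>UNIV. lin_coeff p i * lin_coeff (B j) i) * u j)"
      by (simp add: const_sum sum_distrib_right)
    finally have c: "p = (\<Sum>j\<in>UNIV. const (\<Sum>i\<in>UNIV. lin_coeff p i * lin_coeff (B j) i) * u j)" .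
    define c where "c j = (\<Sum>i\<in>UNIV. lin_coeff p i * lin_coeff (B j) i)" for j
    have p_eq: "p = const (c 0) * h + const (c 1) * \<Psi> + const (c 2) * z2 + const (c 3) * z3"
      using c by (simp add: sum_4_const u_def c_def)
    have "pairing p l = c 0"
      unfolding p_eq using h \<Psi>(3) p1(2)[OF z2(1)] p1(2)[OF z3(1)] by (simp add: pairing_simps)
    then have "c 0 = 0" using p1(2)[OF p] by simp
    then show ?thesis using p_eq by auto
  qed
  have P: "?\<phi> (\<Psi> * z * z') = 0" if "z \<in> plane l" "z' \<in> plane l" "pairing z m = 0 \<or> pairing z' m = 0" for z z'
    using polar[OF that(1,2)] that(3) by auto
  have nz22: "?\<phi> (\<Psi> * z * z) \<noteq> 0" if "z \<in> plane l" "pairing z m \<noteq> 0" for z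
    using polar[OF that(1,1)] that(2) by auto
  have concise: "?\<phi> (z2 * z3 * z3) \<noteq> 0 \<or> ?\<phi> (z3 * z3 * z3) \<noteq> 0"
  proof (rule ccontr)
    assume neg: "\<not> ?thesis"
    \<comment> \<open>The vertex: \<open>s\<close> is chosen such that the product with \<open>z2 * z2\<close> pairs to zero as well.\<close>
    define s where "s = ?\<phi> (z3 * z2 * z2) / ?\<phi> (\<Psi> * z2 * z2)"
    define w where "w = z3 - const s * \<Psi>"
    have wp: "w \<in> plane l" unfolding w_def by (rule plane_add(3)[OF z3(1) plane_add(2)[OF \<Psi>(4) \<Psi>(4)]])
    have val: "?\<phi> (w * a * b) = ?\<phi> (z3 * a * b) - s * ?\<phi> (\<Psi> * a * b)" for a b
    proof -
      have "w * a * b = z3 * a * b - const s * (\<Psi> * a * b)" by (simp add: w_def algebra_simps)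
      then show ?thesis by (simp add: pairing_simps)
    qed
    have z3\<Psi>: "z3 * \<Psi> * a = \<Psi> * z3 * a" "z3 * a * \<Psi> = \<Psi> * z3 * a" for a by (simp_all add: mult_ac)
    have w\<Psi>: "?\<phi> (w * \<Psi> * a) = 0" if "a \<in> plane l" for a
      using P[OF z3(1) that] z3(2) \<Psi>2[OF that] by (simp add: val z3\<Psi>)
    have w22: "?\<phi> (w * z2 * z2) = 0" using nz22[OF z2] by (simp add: val s_def)
    have z232: "z3 * z2 * z3 = z2 * z3 * z3" by (simp add: mult_ac)
    have w23: "?\<phi> (w * z2 * z3) = 0" using neg P[OF z2(1) z3(1)] z3(2) unfolding val z232 by simp
    have w33: "?\<phi> (w * z3 * z3) = 0" using neg P[OF z3(1) z3(1)] z3(2) by (simp add: val)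
    have "?\<phi> (w * a * b) = 0" if ab: "a \<in> plane l" "b \<in> plane l" for a b
    proof -
      obtain a1 a2 a3 where a: "a = const a1 * \<Psi> + const a2 * z2 + const a3 * z3" using in_plane[OF ab(1)] by blast
      obtain b1 b2 b3 where b: "b = const b1 * \<Psi> + const b2 * z2 + const b3 * z3" using in_plane[OF ab(2)] by blast
      have "w * a * b = const a1 * (w * \<Psi> * b) + const (a2 * b1) * (w * \<Psi> * z2) + const (a3 * b1) * (w * \<Psi> * z3) +
          const (a2 * b2) * (w * z2 * z2) + const (a2 * b3 + a3 * b2) * (w * z2 * z3) + const (a3 * b3) * (w * z3 * z3)"
        unfolding const_mult const_add using a b by algebra
      then show ?thesis
        by (simp add: pairing_simps w\<Psi>[OF ab(2)] w\<Psi>[OF z2(1)] w\<Psi>[OF z3(1)] w22 w23 w33)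
    qed
    moreover have "w \<noteq> 0" using z3(3)[of s] by (simp add: w_def)
    ultimately have "eckardt F" unfolding eckardt_def using p1[OF wp] l by blast
    then show False using F by simp
  qed
  have "\<exists>z\<in>plane l. pairing z m \<noteq> 0 \<and> ?\<phi> (z * z3 * z3) \<noteq> 0"
  proof (cases "?\<phi> (z2 * z3 * z3) = 0")
    case True
    then have "?\<phi> ((z2 + z3) * z3 * z3) \<noteq> 0" using concise by (simp add: distrib_right pairing_simps)
    moreover have "pairing (z2 + z3) m \<noteq> 0" using z2(2) z3(2) by (simp add: pairing_simps)
    ultimately show ?thesis using plane_add(1)[OF z2(1) z3(1)] by blast
  qed (use z2 in blast)
  then obtain z where z: "z \<in> plane l" "pairing z m \<noteq> 0" "?\<phi> (z * z3 * z3) \<noteq> 0" by blast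
  define u where "u = (\<lambda>j::4. if j = 0 then h else if j = 1 then \<Psi> else if j = 2 then z else z3)"
  have u: "u 0 = h" "u 1 = \<Psi>" "u 2 = z" "u 3 = z3" by (simp_all add: u_def)
  have uj: "j = 0 \<or> j = 1 \<or> j = 2 \<or> j = 3" for j :: 4 using UNIV_4_eq by blast
  have u1: "u j \<in> homog 1" for j using uj[of j] h(1) \<Psi>(1) p1(1)[OF z(1)] p1(1)[OF z3(1)] by (auto simp: u)
  have ul: "pairing (u j) l = (if j = 0 then 1 else 0)" for j
    using uj[of j] h(2) \<Psi>(3) p1(2)[OF z(1)] p1(2)[OF z3(1)] by (auto simp: u)
  have "cuspidal_frame F u"
    unfolding cuspidal_frame_def u
    using \<Psi>3 \<Psi>2 z z3 h\<Psi> nz22[OF z(1,2)] P[OF z(1) z3(1)] P[OF z3(1) z3(1)] by simp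
  then show ?thesis using basis[OF u_def z(1,2)] u1 ul by blast
qed

subsection \<open>An apolar local scheme of length 7\<close>

lemma hom_comp_mult: "hom_comp d (p * q) = (\<Sum>e\<le>d. hom_comp (d - e) p * hom_comp e q)"
proof -
  define N where "N = max d (tdeg q)"
  have "p * q = (\<Sum>e\<le>N. p * hom_comp e q)"
    using sum_hom_comp[of q N] by (simp add: N_def flip: sum_distrib_left)
  then have "hom_comp d (p * q) = (\<Sum>e\<le>N. if d < e then 0 else hom_comp (d - e) p * hom_comp e q)"
    by (simp add: hom_comp_sum hom_comp_mult_homog_cases[OF hom_comp_homog])
  also have "\<dots> = (\<Sum>e\<le>d. hom_comp (d - e) p * hom_comp e q)"
    by (rule sum.mono_neutral_cong_right) (auto simp: N_def)
  finally show ?thesis .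
qed

lemma eval_mpoly_linear: "p \<in> homog 1 \<Longrightarrow> eval_mpoly (lin_coeff m) p = pairing p m"
  for p :: "('i::finite, 'k::field) mpoly"
  by (subst homog_1_conv, assumption) (simp add: eval_mpoly_subst pairing_linear)

lemma eval_mpoly_scale:
  assumes "p \<in> homog d"
  shows "eval_mpoly (\<lambda>i. s * a i) p = s ^ d * eval_mpoly a (p :: ('i, 'k::field) mpoly)"
proof -
  have "(\<Prod>i\<in>keys m. (s * a i) ^ lookup m i) = s ^ d * (\<Prod>i\<in>keys m. a i ^ lookup m i)" if "m \<in> keys p" for m
  proof -
    have "mdeg m = d" using that assms by (auto simp: homog_def)
    then have "s ^ d = (\<Prod>i\<in>keys m. s ^ lookup m i)" unfolding mdeg_def by (metis power_sum)
    then show ?thesis by (simp add: power_mult_distrib prod.distrib)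
  qed
  then show ?thesis unfolding eval_mpoly_def sum_distrib_left by (intro sum.cong) (auto simp: mult_ac)
qed

text \<open>
  The values of \<open>F\<close> on cubic monomials in \<open>u 0\<close>, \<open>u 2\<close>, \<open>u 3\<close> are those of a polynomial of degree 3 in
  two variables. A term \<open>e\<close> at the fourth power of the first variable is added to it, which gives \<open>G\<close>.
  Substituting \<open>1, \<zeta>, X, Y\<close> for the \<open>u j\<close> with \<open>\<zeta> = a X\<^sup>2 + b X Y + b2 X\<^sup>3 + b3 X\<^sup>4\<close> and pairing with
  \<open>G\<close> defines a functional \<open>\<psi>\<close>, which is to agree with \<open>F\<close> on all cubic forms. For \<open>u 1 * u 2 * u 2\<close> and
  \<open>u 0 * u 1 * u 1\<close> this requires \<open>a e = k\<close> and \<open>a\<^sup>2 e = c\<close>, which determines \<open>e\<close> and \<open>a\<close>. The products of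
  \<open>u 0 * u 1\<close> with \<open>u 3\<close>, \<open>u 2\<close> and \<open>u 0\<close> determine \<open>b\<close>, \<open>b2\<close> and \<open>b3\<close> in this order. On the remaining
  monomials divisible by \<open>u 1\<close>, \<open>F\<close> vanishes by the choice of the frame, and \<open>\<psi>\<close> because \<open>G\<close> has no term
  of degree above 3 except the fourth power.
  The elements \<open>1, x, y, x\<^sup>2, x y, x\<^sup>3, x\<^sup>4\<close> form a basis of the residue ring of the ideal \<open>N\<close> of all \<open>p\<close>
  with \<open>\<psi> (q * p) = 0\<close> for every \<open>q\<close>.
\<close>

theorem cuspidal_frame_apolar_scheme:
  fixes F :: "(4, 'k::field) dpoly"
  assumes F: "F \<in> homog 3" and u1: "\<And>j. u j \<in> homog 1"
    and dual: "\<And>j k. pairing (u j) (B k) = (if j = k then 1 else 0)"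
    and var_u: "\<And>i. var i = (\<Sum>j\<in>UNIV. const (lin_coeff (B j) i) * u j)"
    and l: "l \<in> homog 1" and ul: "\<And>j. pairing (u j) l = (if j = 0 then 1 else 0)"
    and frame: "cuspidal_frame F u"
  shows "\<exists>I. local_scheme_at l I \<and> scheme_length I 7 \<and> apolar I F"
proof -
  let ?\<phi> = "\<lambda>p. pairing p F"
  have uj: "j = 0 \<or> j = 1 \<or> j = 2 \<or> j = 3" for j :: 4 using UNIV_4_eq by blast
  define k where "k = ?\<phi> (u 1 * u 2 * u 2)"
  define c where "c = ?\<phi> (u 0 * u 1 * u 1)"
  define e where "e = k\<^sup>2 / c"
  define a where "a = k / e"
  have k0: "k \<noteq> 0" and c0: "c \<noteq> 0" using frame by (auto simp: cuspidal_frame_def k_def c_def)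
  have e0: "e \<noteq> 0" using k0 c0 by (simp add: e_def)
  have ae: "a * e = k" "a * k = c" using k0 c0 by (auto simp: a_def e_def power2_eq_square)
  define w where "w i j = (if i + j \<le> 3 then ?\<phi> (u 0 ^ (3 - i - j) * u 2 ^ i * u 3 ^ j)
    else if i = 4 \<and> j = 0 then e else 0)" for i j
  have w4: "w 4 0 = e" "w (Suc (Suc (Suc (Suc 0)))) 0 = e" by (simp_all add: w_def)
  have wz: "w i j = 0" if "4 \<le> i + j" "i \<noteq> 4 \<or> j \<noteq> 0" for i j using that by (auto simp: w_def)
  have w12: "w 1 2 \<noteq> 0"
    using frame by (simp add: w_def cuspidal_frame_def power2_eq_square mult.assoc)
  define b where "b = (?\<phi> (u 0 * u 1 * u 3) - a * w 2 1) / w 1 2"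
  define b2 where "b2 = (?\<phi> (u 0 * u 1 * u 2) - a * w 3 0 - b * w 2 1) / e"
  define b3 where "b3 = (?\<phi> (u 0 * u 0 * u 1) - a * w 2 0 - b * w 1 1 - b2 * w 3 0) / e"
  \<comment> \<open>The quartic polynomial in two variables whose derivatives describe the scheme.\<close>
  define G :: "(4, 'k) dpoly" where
    "G = (\<Sum>d\<le>4. \<Sum>m | mdeg m = d. single m (if lookup m 0 = 0 \<and> lookup m 1 = 0 then w (lookup m 2) (lookup m 3) else 0))"
  have G: "lookup G m = (if lookup m 0 = 0 \<and> lookup m 1 = 0 then w (lookup m 2) (lookup m 3) else 0)" for m
  proof -
    have "lookup G m = (\<Sum>d\<le>4. if mdeg m = d then
        (if lookup m 0 = 0 \<and> lookup m 1 = 0 then w (lookup m 2) (lookup m 3) else 0) else 0)"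
      unfolding G_def lookup_sum by (intro sum.cong refl) (simp add: lookup_single when_def finite_mdeg)
    moreover have "w (lookup m 2) (lookup m 3) = 0" if "lookup m 0 = 0" "lookup m 1 = 0" "4 < mdeg m"
      using that by (intro wz) (auto simp: mdeg_UNIV sum_4_eq)
    ultimately show ?thesis by auto
  qed
  define X Y :: "(4, 'k) mpoly" where "X = var 2" and "Y = var 3"
  have XY: "pairing (X ^ i * Y ^ j) G = w i j" for i j
    by (simp add: X_def Y_def var_power mult_single G lookup_add lookup_single when_def)
  define \<zeta> where "\<zeta> = const a * X ^ 2 + const b * (X * Y) + const b2 * X ^ 3 + const b3 * X ^ 4"
  define r where "r j = (if j = 0 then 1 else if j = 1 then \<zeta> else if j = 2 then X else Y)" for j :: 4
  have r: "r 0 = 1" "r 1 = \<zeta>" "r 2 = X" "r 3 = Y" by (simp_all add: r_def)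
  define \<rho> where "\<rho> = subst const (\<lambda>i. \<Sum>j\<in>UNIV. const (lin_coeff (B j) i) * r j)"
  have \<rho>_simps [simp]: "\<rho> (p + q) = \<rho> p + \<rho> q" "\<rho> (p - q) = \<rho> p - \<rho> q" "\<rho> (p * q) = \<rho> p * \<rho> q"
    "\<rho> (p ^ n) = \<rho> p ^ n" "\<rho> (const s) = const s" "\<rho> 1 = 1" "\<rho> 0 = 0" "\<rho> (smul s p) = const s * \<rho> p"
    "\<rho> (\<Prod>i\<in>A. g i) = (\<Prod>i\<in>A. \<rho> (g i))" for p q n s A and g :: "4 \<Rightarrow> _"
    by (simp_all add: \<rho>_def)
  have \<rho>u: "\<rho> (u j) = r j" for j
  proof -
    have "\<rho> (u j) = (\<Sum>i\<in>UNIV. const (lin_coeff (u j) i) * (\<Sum>k\<in>UNIV. const (lin_coeff (B k) i) * r k))"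
      by (subst homog_1_conv[OF u1]) (simp add: \<rho>_def)
    also have "\<dots> = (\<Sum>i\<in>UNIV. \<Sum>k\<in>UNIV. const (lin_coeff (u j) i * lin_coeff (B k) i) * r k)"
      by (simp add: sum_distrib_left const_mult mult.assoc)
    also have "\<dots> = (\<Sum>k\<in>UNIV. \<Sum>i\<in>UNIV. const (lin_coeff (u j) i * lin_coeff (B k) i) * r k)" by (rule sum.swap)
    also have "\<dots> = (\<Sum>k\<in>UNIV. const (pairing (u j) (B k)) * r k)"
      by (simp add: pairing_linear[OF u1] const_sum sum_distrib_right)
    also have "\<dots> = (\<Sum>k\<in>UNIV. if k = j then r k else 0)" by (intro sum.cong) (auto simp: dual)
    finally show ?thesis by simp
  qed
  note \<rho>s = \<rho>u[of 0, unfolded r] \<rho>u[of 1, unfolded r] \<rho>u[of 2, unfolded r] \<rho>u[of 3, unfolded r]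
  define \<psi> where "\<psi> p = pairing (\<rho> p) G" for p
  have \<psi>: "linear_form \<psi>" by (simp add: linear_form_def \<psi>_def pairing_simps)
  have \<zeta>_mult: "pairing (\<zeta> * (X ^ i * Y ^ j)) G = a * w (i + 2) j + b * w (i + 1) (j + 1) + b2 * w (i + 3) j + b3 * w (i + 4) j" for i j
  proof -
    have "\<zeta> * (X ^ i * Y ^ j) = const a * (X ^ (i + 2) * Y ^ j) + const b * (X ^ (i + 1) * Y ^ (j + 1)) +
        const b2 * (X ^ (i + 3) * Y ^ j) + const b3 * (X ^ (i + 4) * Y ^ j)"
      by (simp add: \<zeta>_def algebra_simps power_add power2_eq_square)
    then show ?thesis by (simp only: pairing_simps pairing_const_mult XY)
  qed
  have \<zeta>2_mult: "pairing (\<zeta> ^ 2 * (X ^ i * Y ^ j)) G = (if i = 0 \<and> j = 0 then c else 0)" for i j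
  proof -
    have "\<zeta> ^ 2 * (X ^ i * Y ^ j) = const a * (\<zeta> * (X ^ (i + 2) * Y ^ j)) + const b * (\<zeta> * (X ^ (i + 1) * Y ^ (j + 1))) +
        const b2 * (\<zeta> * (X ^ (i + 3) * Y ^ j)) + const b3 * (\<zeta> * (X ^ (i + 4) * Y ^ j))"
      by (subst power2_eq_square, subst (1) \<zeta>_def) (simp add: algebra_simps power_add power2_eq_square)
    then show ?thesis
      by (simp only: pairing_simps pairing_const_mult \<zeta>_mult) (auto simp: wz w4 ae mult.assoc)
  qed
  have \<zeta>3: "pairing (\<zeta> ^ 3) G = 0"
  proof -
    have "\<zeta> ^ 3 = const a * (\<zeta> ^ 2 * (X ^ 2 * Y ^ 0)) + const b * (\<zeta> ^ 2 * (X ^ 1 * Y ^ 1)) +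
        const b2 * (\<zeta> ^ 2 * (X ^ 3 * Y ^ 0)) + const b3 * (\<zeta> ^ 2 * (X ^ 4 * Y ^ 0))"
      by (subst power3_eq_cube, subst (1) \<zeta>_def) (simp add: algebra_simps power2_eq_square)
    then show ?thesis by (simp only: pairing_simps pairing_const_mult \<zeta>2_mult) simp
  qed
  have frame0: "?\<phi> (u 1 * u 1 * u 1) = 0" "?\<phi> (u 1 * u 1 * u 2) = 0" "?\<phi> (u 1 * u 1 * u 3) = 0"
    "?\<phi> (u 1 * u 2 * u 3) = 0" "?\<phi> (u 1 * u 3 * u 3) = 0"
    using frame by (auto simp: cuspidal_frame_def)
  have agree_mon: "\<psi> (u 0 ^ n * u 1 ^ m * u 2 ^ i * u 3 ^ j) = ?\<phi> (u 0 ^ n * u 1 ^ m * u 2 ^ i * u 3 ^ j)"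
    if nmij: "n + m + i + j = 3" for n m i j
  proof -
    have val: "\<psi> (u 0 ^ n * u 1 ^ m * u 2 ^ i * u 3 ^ j) = pairing (\<zeta> ^ m * (X ^ i * Y ^ j)) G"
      by (simp add: \<psi>_def \<rho>s mult.assoc)
    consider "m = 0" | "m = 1" "n = 2" "i = 0" "j = 0" | "m = 1" "n = 1" "i = 1" "j = 0" | "m = 1" "n = 1" "i = 0" "j = 1"
      | "m = 1" "n = 0" "i = 2" "j = 0" | "m = 1" "n = 0" "i = 1" "j = 1" | "m = 1" "n = 0" "i = 0" "j = 2"
      | "m = 2" "n = 1" "i = 0" "j = 0" | "m = 2" "n = 0" "i = 1" "j = 0" | "m = 2" "n = 0" "i = 0" "j = 1"
      | "m = 3" "n = 0" "i = 0" "j = 0"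
    proof -
      have "m = 0 \<or> m = 1 \<or> m = 2 \<or> m = 3" using nmij by presburger
      moreover have "n = 2 \<and> i = 0 \<and> j = 0 \<or> n = 1 \<and> i = 1 \<and> j = 0 \<or> n = 1 \<and> i = 0 \<and> j = 1 \<or>
          n = 0 \<and> i = 2 \<and> j = 0 \<or> n = 0 \<and> i = 1 \<and> j = 1 \<or> n = 0 \<and> i = 0 \<and> j = 2" if "m = 1"
        using nmij that by presburger
      moreover have "n = 1 \<and> i = 0 \<and> j = 0 \<or> n = 0 \<and> i = 1 \<and> j = 0 \<or> n = 0 \<and> i = 0 \<and> j = 1" if "m = 2"
        using nmij that by presburger
      moreover have "n = 0 \<and> i = 0 \<and> j = 0" if "m = 3" using nmij that by presburger
      ultimately show ?thesis using that by metis
    qed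
    then show ?thesis
    proof cases
      case 1
      then have "n = 3 - i - j" "i + j \<le> 3" using nmij by auto
      then show ?thesis unfolding val using 1 by (simp add: XY w_def)
    next
      case 2
      have "b3 * e = ?\<phi> (u 0 * u 0 * u 1) - a * w 2 0 - b * w 1 1 - b2 * w 3 0" using e0 by (simp add: b3_def)
      then show ?thesis unfolding val using 2 \<zeta>_mult[of 0 0] by (simp add: w4 eval_nat_numeral)
    next
      case 3
      have "b2 * e = ?\<phi> (u 0 * u 1 * u 2) - a * w 3 0 - b * w 2 1" using e0 by (simp add: b2_def)
      then show ?thesis unfolding val using 3 \<zeta>_mult[of 1 0] by (simp add: w4 wz eval_nat_numeral)
    next
      case 4
      have "b * w 1 2 = ?\<phi> (u 0 * u 1 * u 3) - a * w 2 1" using w12 by (simp add: b_def)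
      then show ?thesis unfolding val using 4 \<zeta>_mult[of 0 1] by (simp add: wz eval_nat_numeral)
    next
      case 5
      then show ?thesis unfolding val using \<zeta>_mult[of 2 0] ae by (simp add: w4 wz k_def power2_eq_square mult.assoc)
    next
      case 6
      then show ?thesis unfolding val using \<zeta>_mult[of 1 1] frame0 by (simp add: wz)
    next
      case 7
      then show ?thesis unfolding val using \<zeta>_mult[of 0 2] frame0 by (simp add: wz power2_eq_square mult.assoc)
    next
      case 8
      then show ?thesis unfolding val using \<zeta>2_mult[of 0 0] by (simp add: c_def power2_eq_square mult.assoc)
    next
      case 9
      then show ?thesis unfolding val using \<zeta>2_mult[of 1 0] frame0 by (simp add: power2_eq_square)
    next
      case 10
      then show ?thesis unfolding val using \<zeta>2_mult[of 0 1] frame0 by (simp add: power2_eq_square)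
    next
      case 11
      then show ?thesis unfolding val using \<zeta>3 frame0 by (simp add: power3_eq_cube)
    qed
  qed
  have agree: "\<psi> p = ?\<phi> p" if p: "p \<in> homog 3" for p
  proof -
    have "\<psi> (hom_comp 3 q) = ?\<phi> (hom_comp 3 q)" for q
      using upow_span[OF u1 dual var_u, of q]
    proof (induction rule: K_space.span_induct)
      case base
      show ?case
        by (simp add: K_space.subspace_def hom_comp_add hom_comp_smul linear_form_simps \<psi> pairing_simps)
    next
      case (step q)
      then obtain \<alpha> where q: "q = upow u \<alpha>" by auto
      have deg: "mdeg \<alpha> = lookup \<alpha> 0 + lookup \<alpha> 1 + lookup \<alpha> 2 + lookup \<alpha> 3" by (simp add: mdeg_UNIV sum_4_eq)
      have prod: "upow u \<alpha> = u 0 ^ lookup \<alpha> 0 * u 1 ^ lookup \<alpha> 1 * u 2 ^ lookup \<alpha> 2 * u 3 ^ lookup \<alpha> 3"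
        unfolding upow_def[OF u1 dual var_u] UNIV_4_eq by (simp add: mult.assoc)
      show ?case
        unfolding q hom_comp_of_homog[OF upow_homog[OF u1 dual var_u]]
        using agree_mon[of "lookup \<alpha> 0" "lookup \<alpha> 1" "lookup \<alpha> 2" "lookup \<alpha> 3"]
        by (simp add: prod deg linear_form_0[OF \<psi>] pairing_simps)
    qed
    from this[of p] show ?thesis using p by (simp add: hom_comp_of_homog)
  qed
  define N where "N = {p. \<forall>q. \<psi> (q * p) = 0}"
  have N: "poly_ideal N"
    by (auto simp: poly_ideal_def N_def distrib_left linear_form_simps \<psi> mult.assoc[symmetric])
  have N_\<psi>: "\<psi> p = 0" if "p \<in> N" for p
    using that unfolding N_def by (metis (mono_tags) mem_Collect_eq mult_1)
  have G_ann: "pairing q G = 0" if "\<And>i j. pairing (X ^ i * Y ^ j * p) G = 0" "q = q' * p" for q q' p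
  proof -
    have "pairing (q' * p) G = 0"
    proof (rule linear_form_eqI[of "\<lambda>q'. pairing (q' * p) G" "\<lambda>_. 0"])
      show "linear_form (\<lambda>q'. pairing (q' * p) G)"
        using linear_form_mult[OF linear_form_pairing, of p G] by (simp add: mult.commute)
      show "pairing (single m 1 * p) G = 0" for m
      proof (cases "lookup m 0 = 0 \<and> lookup m 1 = 0")
        case True
        have "single m 1 = X ^ lookup m 2 * Y ^ lookup m 3"
          unfolding single_conv_vars_UNIV UNIV_4_eq using True by (simp add: X_def Y_def)
        then show ?thesis using that(1) by simp
      next
        case False
        then show ?thesis unfolding pairing_single_mult by (intro sum.neutral) (auto simp: G lookup_add)
      qed
    qed (simp add: linear_form_def)
    then show ?thesis using that(2) by simp
  qed
  have N_I: "p \<in> N" if "\<And>i j. pairing (X ^ i * Y ^ j * \<rho> p) G = 0" for p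
    unfolding N_def \<psi>_def using G_ann[OF that] by simp
  have N_eq: "p - q \<in> N" if "\<rho> p = \<rho> q" for p q using that by (intro N_I) (simp add: pairing_simps)
  let ?x = "u 2" and ?y = "u 3"
  define \<zeta>' where "\<zeta>' = const a * ?x ^ 2 + const b * (?x * ?y) + const b2 * ?x ^ 3 + const b3 * ?x ^ 4"
  have u0: "u 0 - 1 \<in> N" by (rule N_eq) (simp add: \<rho>s)
  have u1N: "u 1 - \<zeta>' \<in> N" by (rule N_eq) (simp add: \<rho>s \<zeta>'_def \<zeta>_def)
  define s1 where "s1 = w 2 1 / e"
  define s2 where "s2 = w 1 2 / e"
  define t1 where "t1 = w 0 3 / w 1 2"
  define t2 where "t2 = (w 1 2 - t1 * w 2 1) / e"
  define t3 where "t3 = (w 0 2 - t1 * w 1 1 - t2 * w 3 0) / e"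
  have n1: "?x ^ 2 * ?y - const s1 * ?x ^ 4 \<in> N"
  proof (rule N_I)
    fix i j
    have "X ^ i * Y ^ j * \<rho> (?x ^ 2 * ?y - const s1 * ?x ^ 4) = X ^ (i + 2) * Y ^ (j + 1) - const s1 * (X ^ (i + 4) * Y ^ j)"
      by (simp add: \<rho>s right_diff_distrib power_add power2_eq_square mult_ac)
    then have val: "pairing (X ^ i * Y ^ j * \<rho> (?x ^ 2 * ?y - const s1 * ?x ^ 4)) G =
        w (i + 2) (j + 1) - s1 * w (i + 4) j"
      by (simp only: pairing_simps pairing_const_mult XY)
    show "pairing (X ^ i * Y ^ j * \<rho> (?x ^ 2 * ?y - const s1 * ?x ^ 4)) G = 0"
      unfolding val using e0 by (cases "i = 0 \<and> j = 0") (auto simp: wz w4 s1_def numeral_2_eq_2)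
  qed
  have n2: "?x * ?y ^ 2 - const s2 * ?x ^ 4 \<in> N"
  proof (rule N_I)
    fix i j
    have "X ^ i * Y ^ j * \<rho> (?x * ?y ^ 2 - const s2 * ?x ^ 4) = X ^ (i + 1) * Y ^ (j + 2) - const s2 * (X ^ (i + 4) * Y ^ j)"
      by (simp add: \<rho>s right_diff_distrib power_add power2_eq_square mult_ac)
    then have val: "pairing (X ^ i * Y ^ j * \<rho> (?x * ?y ^ 2 - const s2 * ?x ^ 4)) G =
        w (i + 1) (j + 2) - s2 * w (i + 4) j"
      by (simp only: pairing_simps pairing_const_mult XY)
    show "pairing (X ^ i * Y ^ j * \<rho> (?x * ?y ^ 2 - const s2 * ?x ^ 4)) G = 0"
      unfolding val using e0 by (cases "i = 0 \<and> j = 0") (auto simp: wz w4 s2_def numeral_2_eq_2)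
  qed
  have n3: "?x ^ 3 * ?y \<in> N" and n5: "?x ^ 5 \<in> N" and n7: "?y ^ 5 \<in> N"
  proof -
    have e: "X ^ i * Y ^ j * \<rho> (?x ^ 3 * ?y) = X ^ (i + 3) * Y ^ (j + 1)" "X ^ i * Y ^ j * \<rho> (?x ^ 5) = X ^ (i + 5) * Y ^ j"
      "X ^ i * Y ^ j * \<rho> (?y ^ 5) = X ^ i * Y ^ (j + 5)" for i j
      by (simp_all add: \<rho>s power_add mult_ac)
    have p: "pairing (X ^ i * Y ^ j * \<rho> (?x ^ 3 * ?y)) G = 0" "pairing (X ^ i * Y ^ j * \<rho> (?x ^ 5)) G = 0"
      "pairing (X ^ i * Y ^ j * \<rho> (?y ^ 5)) G = 0" for i j
      unfolding e XY by (rule wz; simp)+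
    show "?x ^ 3 * ?y \<in> N" "?x ^ 5 \<in> N" "?y ^ 5 \<in> N" by (rule N_I, rule p)+
  qed
  have n6: "?y ^ 2 - (const t1 * (?x * ?y) + const t2 * ?x ^ 3 + const t3 * ?x ^ 4) \<in> N" (is "?p \<in> N")
  proof (rule N_I)
    fix i j
    have "X ^ i * Y ^ j * \<rho> ?p = X ^ i * Y ^ (j + 2) - (const t1 * (X ^ (i + 1) * Y ^ (j + 1)) +
        const t2 * (X ^ (i + 3) * Y ^ j) + const t3 * (X ^ (i + 4) * Y ^ j))"
      by (simp add: \<rho>s right_diff_distrib distrib_left power_add power2_eq_square mult_ac)
    then have val: "pairing (X ^ i * Y ^ j * \<rho> ?p) G =
        w i (j + 2) - (t1 * w (i + 1) (j + 1) + t2 * w (i + 3) j + t3 * w (i + 4) j)"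
      by (simp only: pairing_simps pairing_const_mult XY)
    consider "i = 0" "j = 0" | "i = 1" "j = 0" | "i = 0" "j = 1" | "2 \<le> i + j" by linarith
    then show "pairing (X ^ i * Y ^ j * \<rho> ?p) G = 0"
    proof cases
      case 1
      have "t3 * e = w 0 2 - t1 * w 1 1 - t2 * w 3 0" using e0 by (simp add: t3_def)
      then show ?thesis unfolding val using 1 by (simp add: w4 numeral_2_eq_2 numeral_3_eq_3)
    next
      case 2
      have "t2 * e = w 1 2 - t1 * w 2 1" using e0 by (simp add: t2_def)
      then show ?thesis unfolding val using 2 by (simp add: w4 wz numeral_2_eq_2)
    next
      case 3
      have "t1 * w 1 2 = w 0 3" using w12 by (simp add: t1_def)
      then show ?thesis unfolding val using 3 by (simp add: wz numeral_2_eq_2 numeral_3_eq_3)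
    next
      case 4
      then have "w i (j + 2) = 0" "w (i + 1) (j + 1) = 0" "w (i + 3) j = 0" "w (i + 4) j = 0"
        by (intro wz; linarith)+
      then show ?thesis unfolding val by simp
    qed
  qed
  define bs where "bs = (\<lambda>s::nat. [1, ?x, ?y, ?x ^ 2, ?x * ?y, ?x ^ 3, ?x ^ 4] ! s)"
  define M where "M = {1, ?x, ?y, ?x ^ 2, ?x * ?y, ?x ^ 3, ?x ^ 4}"
  have M: "s = 1 \<or> s = ?x \<or> s = ?y \<or> s = ?x ^ 2 \<or> s = ?x * ?y \<or> s = ?x ^ 3 \<or> s = ?x ^ 4" if "s \<in> M" for s
    using that by (simp add: M_def)
  let ?S = "K_space.span (M \<union> N)"
  have SN: "q \<in> ?S" if "q \<in> N" for q using that by (intro K_space.span_base) simp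
  have Sb: "1 \<in> ?S" "?x \<in> ?S" "?y \<in> ?S" "?x ^ 2 \<in> ?S" "?x * ?y \<in> ?S" "?x ^ 3 \<in> ?S" "?x ^ 4 \<in> ?S"
    by (intro K_space.span_base; simp add: M_def)+
  have Sc: "const s * q \<in> ?S" if "q \<in> ?S" for s q using that by (simp add: K_space.span_scale flip: smul_conv)
  have Smod: "p \<in> ?S" if "p - q \<in> N" "q \<in> ?S" for p q
    using K_space.span_add[OF SN[OF that(1)] that(2)] by simp
  have mult_closed: "g * q \<in> ?S"
    if "\<And>s. s \<in> M \<Longrightarrow> g * s \<in> ?S" "q \<in> ?S" for g q
    using that(2)
  proof (induction rule: K_space.span_induct)
    case base
    have "g * smul s p = smul s (g * p)" for s p by (simp add: smul_conv mult.left_commute)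
    then show ?case
      by (simp add: K_space.subspace_def K_space.span_zero K_space.span_add K_space.span_scale distrib_left)
  next
    case (step p)
    then show ?case using that(1) SN ideal_mult[OF N] by blast
  qed
  have xxy: "?x ^ 2 * ?y \<in> ?S" and xyy: "?x * ?y ^ 2 \<in> ?S" by (rule Smod[OF n1 Sc[OF Sb(7)]] Smod[OF n2 Sc[OF Sb(7)]])+
  have xS: "?x * q \<in> ?S" if "q \<in> ?S" for q
  proof (rule mult_closed[OF _ that])
    fix s assume "s \<in> M"
    moreover have "?x * ?x = ?x ^ 2" "?x * ?x ^ 2 = ?x ^ 3" "?x * (?x * ?y) = ?x ^ 2 * ?y" "?x * ?x ^ 3 = ?x ^ 4" "?x * ?x ^ 4 = ?x ^ 5"
      by (simp_all add: eval_nat_numeral mult.assoc)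
    ultimately show "?x * s \<in> ?S" using M[of s] Sb xxy SN[OF n3] SN[OF n5] by (metis mult.right_neutral)
  qed
  have yS: "?y * q \<in> ?S" if "q \<in> ?S" for q
  proof (rule mult_closed[OF _ that])
    fix s assume "s \<in> M"
    moreover have "?y * ?y \<in> ?S"
      using Smod[OF n6 K_space.span_add[OF K_space.span_add[OF Sc[OF Sb(5)] Sc[OF Sb(6)]] Sc[OF Sb(7)]]]
      by (simp add: power2_eq_square)
    moreover have "?y * ?x = ?x * ?y" "?y * ?x ^ 2 = ?x ^ 2 * ?y" "?y * (?x * ?y) = ?x * ?y ^ 2" "?y * ?x ^ 3 = ?x ^ 3 * ?y"
      "?y * ?x ^ 4 = ?x * (?x ^ 3 * ?y)"
      by (simp_all add: eval_nat_numeral mult_ac)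
    ultimately show "?y * s \<in> ?S" using M[of s] Sb xxy xyy SN[OF n3] xS[OF SN[OF n3]] by (metis mult.right_neutral)
  qed
  have uS: "u j * q \<in> ?S" if q: "q \<in> ?S" for j q
  proof -
    have "u 0 * q - q \<in> N" using ideal_mult_right[OF N u0, of q] by (simp add: algebra_simps)
    then have 0: "u 0 * q \<in> ?S" using q by (rule Smod)
    have "\<zeta>' * q = const a * (?x * (?x * q)) + const b * (?x * (?y * q)) + const b2 * (?x * (?x * (?x * q))) +
        const b3 * (?x * (?x * (?x * (?x * q))))"
      unfolding \<zeta>'_def by algebra
    also have "\<dots> \<in> ?S" by (intro K_space.span_add Sc xS yS q)
    finally have "\<zeta>' * q \<in> ?S" .
    moreover have "u 1 * q - \<zeta>' * q \<in> N" using ideal_mult_right[OF N u1N, of q] by (simp add: algebra_simps)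
    ultimately have 1: "u 1 * q \<in> ?S" using Smod by blast
    show ?thesis using uj[of j] 0 1 xS[OF q] yS[OF q] by auto
  qed
  have "\<forall>q\<in>?S. p * q \<in> ?S" for p
  proof (induction p rule: mpoly_induct)
    case (const s)
    then show ?case using Sc by blast
  next
    case (var i)
    show ?case
    proof
      fix q assume q: "q \<in> ?S"
      have "(\<Sum>j\<in>UNIV. const (lin_coeff (B j) i) * (u j * q)) \<in> ?S" by (intro K_space.span_sum Sc uS q)
      then show "var i * q \<in> ?S" by (subst var_u) (simp add: sum_distrib_right mult.assoc)
    qed
  qed (auto simp: distrib_right K_space.span_add mult.assoc)
  then have S_UNIV: "p \<in> ?S" for p using Sb(1) by fastforce
  have bs: "bs 0 = 1" "bs (Suc 0) = ?x" "bs 2 = ?y" "bs 3 = ?x ^ 2" "bs 4 = ?x * ?y" "bs 5 = ?x ^ 3" "bs 6 = ?x ^ 4"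
    by (simp_all add: bs_def)
  have seven: "{..<7::nat} = {0, 1, 2, 3, 4, 5, 6}" by auto
  have N_iff: "p \<in> N \<longleftrightarrow> (\<forall>s\<in>{..<7}. \<psi> (p * bs s) = 0)" for p
  proof
    assume "p \<in> N"
    then show "\<forall>s\<in>{..<7}. \<psi> (p * bs s) = 0" by (auto simp: N_def mult.commute)
  next
    assume all: "\<forall>s\<in>{..<7}. \<psi> (p * bs s) = 0"
    have gens: "\<psi> (p * s) = 0" if "s \<in> M" for s
      using M[OF that] all unfolding seven by (auto simp: bs)
    have "\<psi> (p * q) = 0" for q
      using S_UNIV[of q]
    proof (induction rule: K_space.span_induct)
      case base
      have "p * smul s q = smul s (p * q)" for s q by (simp add: smul_conv mult.left_commute)
      then show ?case by (simp add: K_space.subspace_def distrib_left linear_form_simps \<psi>)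
    next
      case (step q)
      then show ?case using gens by (auto simp: N_def)
    qed
    then show "p \<in> N" by (auto simp: N_def mult.commute)
  qed
  \<comment> \<open>The homogenization of \<open>N\<close>: the largest homogeneous ideal contained in it.\<close>
  define I where "I = {p. \<forall>d. hom_comp d p \<in> N}"
  have I_homog: "p \<in> I \<longleftrightarrow> p \<in> N" if "p \<in> homog d" for p d
    using that ideal_0[OF N] by (auto simp: I_def hom_comp_of_homog)
  have I_N: "p \<in> N" if "p \<in> I" for p
  proof -
    have "(\<Sum>d\<le>tdeg p. hom_comp d p) \<in> N" using that by (intro ideal_sum N) (simp add: I_def)
    then show ?thesis by (simp add: sum_hom_comp)
  qed
  have I_ideal: "poly_ideal I"
    by (auto simp: poly_ideal_def I_def hom_comp_add hom_comp_mult ideal_0[OF N]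
        intro!: ideal_add[OF N] ideal_sum[OF N] ideal_mult[OF N])
  have hI: "homogeneous_ideal I"
    using I_ideal ideal_0[OF N] by (auto simp: homogeneous_ideal_def I_def hom_comp_of_homog[OF hom_comp_homog])
  have u0_cancel: "p \<in> N" if "p * u 0 ^ n \<in> N" for p n
    using that
  proof (induction n)
    case (Suc n)
    have "p * u 0 ^ Suc n - p * u 0 ^ n * (u 0 - 1) \<in> N"
      using Suc.prems by (intro ideal_diff[OF N] ideal_mult[OF N u0])
    then have "p * u 0 ^ n \<in> N" by (simp add: algebra_simps)
    then show ?case by (rule Suc.IH)
  qed simp
  have "saturated I"
    unfolding saturated_def
  proof (intro allI impI)
    fix p assume "\<exists>n. \<forall>q\<in>homog n. q * p \<in> I"
    then obtain n where n: "\<And>q. q \<in> homog n \<Longrightarrow> q * p \<in> I" by blast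
    have hn: "u 0 ^ n \<in> homog n" using homog_power[OF u1, of 0 n] by simp
    have "hom_comp d p * u 0 ^ n \<in> N" for d
      using n[OF hn] hom_comp_mult_homog[OF hn, of d p] unfolding I_def
      by (metis (no_types, lifting) mem_Collect_eq mult.commute)
    then show "p \<in> I" unfolding I_def using u0_cancel by blast
  qed
  moreover have "{m \<in> homog 1. m \<noteq> 0 \<and> (\<forall>p\<in>I. eval_mpoly (lin_coeff m) p = 0)} = {smul s l |s. s \<noteq> 0}"
  proof
    have lB: "lin_coeff l i = lin_coeff (B 0) i" for i
    proof -
      have "lin_coeff l i = pairing (\<Sum>j\<in>UNIV. const (lin_coeff (B j) i) * u j) l"
        using var_u[of i] pairing_var[of i l] by simp
      then show ?thesis by (simp add: pairing_simps ul if_distrib cong: if_cong)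
    qed
    show "{m \<in> homog 1. m \<noteq> 0 \<and> (\<forall>p\<in>I. eval_mpoly (lin_coeff m) p = 0)} \<subseteq> {smul s l |s. s \<noteq> 0}"
    proof
      fix m assume m: "m \<in> {m \<in> homog 1. m \<noteq> 0 \<and> (\<forall>p\<in>I. eval_mpoly (lin_coeff m) p = 0)}"
      have fifth: "pairing (u j) m = 0" if "u j ^ 5 \<in> N" for j
      proof -
        have "u j ^ 5 \<in> homog 5" using homog_power[OF u1, of j 5] by simp
        then have "u j ^ 5 \<in> I" using that I_homog by blast
        then have "eval_mpoly (lin_coeff m) (u j ^ 5) = 0" using m by blast
        then show ?thesis by (simp add: eval_mpoly_subst) (simp add: eval_mpoly_linear[OF u1] flip: eval_mpoly_subst)
      qed
      have "u 1 ^ 5 \<in> N"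
      proof -
        have diff: "u 1 ^ n - \<zeta>' ^ n \<in> N" for n
        proof (induction n)
          case 0
          then show ?case by (simp add: ideal_0[OF N])
        next
          case (Suc n)
          have "u 1 ^ Suc n - \<zeta>' ^ Suc n = u 1 ^ n * (u 1 - \<zeta>') + \<zeta>' * (u 1 ^ n - \<zeta>' ^ n)"
            by (simp add: algebra_simps)
          then show ?case using ideal_add[OF N ideal_mult[OF N u1N] ideal_mult[OF N Suc]] by metis
        qed
        have "\<zeta>' = ?x * (const a * ?x + const b * ?y + const b2 * ?x ^ 2 + const b3 * ?x ^ 3)"
          by (simp add: \<zeta>'_def distrib_left eval_nat_numeral mult_ac)
        then have "\<zeta>' ^ 5 \<in> N" using ideal_mult_right[OF N n5] by (metis power_mult_distrib)
        then show ?thesis using ideal_add[OF N diff[of 5]] by fastforce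
      qed
      then have z: "pairing (u j) m = 0" if "j \<noteq> 0" for j
        using fifth n5 n7 uj[of j] that by blast
      have "m = smul (pairing (u 0) m) l"
      proof (rule homog_1_eqI)
        show "m \<in> homog 1" using m by blast
        show "smul (pairing (u 0) m) l \<in> homog 1" by (rule homog_smul[OF l])
        fix i
        have "lin_coeff m i = pairing (\<Sum>j\<in>UNIV. const (lin_coeff (B j) i) * u j) m"
          using var_u[of i] pairing_var[of i m] by simp
        also have "\<dots> = lin_coeff (B 0) i * pairing (u 0) m + (\<Sum>j\<in>UNIV - {0}. lin_coeff (B j) i * pairing (u j) m)"
          unfolding pairing_simps pairing_const_mult by (rule sum.remove) auto
        also have "(\<Sum>j\<in>UNIV - {0}. lin_coeff (B j) i * pairing (u j) m) = 0" by (intro sum.neutral) (simp add: z)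
        finally show "lin_coeff m i = lin_coeff (smul (pairing (u 0) m) l) i" by (simp add: lB)
      qed
      moreover have "pairing (u 0) m \<noteq> 0"
      proof
        assume "pairing (u 0) m = 0"
        with \<open>m = _\<close> have "m = smul 0 l" by metis
        then show False using m by simp
      qed
      ultimately show "m \<in> {smul s l |s. s \<noteq> 0}" by blast
    qed
    have l0: "l \<noteq> 0" using ul[of 0] by auto
    have zero_mon: "eval_mpoly (\<lambda>_. 0) (single m 1) = (if m = 0 then 1 else (0::'k))" for m :: "4 mon"
    proof (cases "m = 0")
      case False
      then obtain i where "i \<in> keys m" by (metis ex_in_conv keys_eq_empty)
      then have "(\<Prod>i\<in>keys m. (0::'k) ^ lookup m i) = 0" by (intro prod_zero) (auto simp: in_keys_iff)
      then show ?thesis using False by (simp add: eval_mpoly_subst subst_single)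
    qed (simp add: eval_mpoly_subst subst_single)
    \<comment> \<open>The socle element \<open>X\<^sup>4\<close> evaluates a polynomial at the origin, so membership in \<open>N\<close> implies vanishing at \<open>l\<close>.\<close>
    have top: "pairing (X ^ 4 * q) G = e * eval_mpoly (\<lambda>_. 0) q" for q
    proof (rule linear_form_eqI[of "\<lambda>q. pairing (X ^ 4 * q) G" "\<lambda>q. e * eval_mpoly (\<lambda>_. 0) q"])
      show "linear_form (\<lambda>q. pairing (X ^ 4 * q) G)" by (rule linear_form_mult[OF linear_form_pairing])
      show "linear_form (\<lambda>q. e * eval_mpoly (\<lambda>_. 0) q)"
        by (simp add: linear_form_def linear_form_simps[OF linear_form_eval] distrib_left)
      fix m :: "4 mon"
      have "lookup G (single 2 4 + m) = (if m = 0 then e else 0)"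
      proof (cases "m = 0")
        case False
        then have "\<exists>i. lookup m i \<noteq> 0" by (metis lookup_zero poly_mapping_eqI)
        then have "lookup m 0 \<noteq> 0 \<or> lookup m 1 \<noteq> 0 \<or> lookup m 2 \<noteq> 0 \<or> lookup m 3 \<noteq> 0" using uj by metis
        then show ?thesis using False by (auto simp: G lookup_add lookup_single intro!: wz)
      qed (simp add: G lookup_single w4)
      then show "pairing (X ^ 4 * single m 1) G = e * eval_mpoly (\<lambda>_. 0) (single m 1)"
        by (simp add: X_def var_power mult_single zero_mon)
    qed
    have eval_\<rho>: "eval_mpoly (\<lambda>_. 0) (\<rho> p) = eval_mpoly (lin_coeff l) p" for p
    proof (induction p rule: mpoly_induct)
      case (const s)
      then show ?case by (simp add: eval_mpoly_subst)
    next
      case (var i)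
      have "eval_mpoly (\<lambda>_. 0) (r j) = (if j = 0 then 1 else 0)" for j
        using uj[of j] by (auto simp: r \<zeta>_def X_def Y_def eval_mpoly_subst)
      then have "eval_mpoly (\<lambda>_. 0) (\<rho> (var i)) = (\<Sum>j\<in>UNIV. lin_coeff (B j) i * (if j = 0 then 1 else 0))"
        by (simp add: \<rho>_def eval_mpoly_subst)
      also have "\<dots> = lin_coeff (B 0) i" by (simp add: if_distrib cong: if_cong)
      finally show ?case by (simp add: eval_mpoly_subst lB)
    qed (simp_all add: eval_mpoly_subst)
    have vanish: "eval_mpoly (lin_coeff l) p = 0" if "p \<in> N" for p
    proof -
      have "\<psi> (?x ^ 4 * p) = 0" using that by (simp add: N_def)
      then show ?thesis using e0 by (simp add: \<psi>_def \<rho>s top eval_\<rho>)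
    qed
    show "{smul s l |s. s \<noteq> 0} \<subseteq> {m \<in> homog 1. m \<noteq> 0 \<and> (\<forall>p\<in>I. eval_mpoly (lin_coeff m) p = 0)}"
    proof clarify
      fix s :: 'k assume s: "s \<noteq> 0"
      have "eval_mpoly (lin_coeff (smul s l)) p = 0" if p: "p \<in> I" for p
      proof -
        have ls: "lin_coeff (smul s l) = (\<lambda>i. s * lin_coeff l i)" by auto
        have "eval_mpoly (lin_coeff (smul s l)) (\<Sum>d\<le>tdeg p. hom_comp d p) =
            (\<Sum>d\<le>tdeg p. s ^ d * eval_mpoly (lin_coeff l) (hom_comp d p))"
          unfolding ls linear_form_sum[OF linear_form_eval] by (intro sum.cong refl eval_mpoly_scale hom_comp_homog)
        also have "\<dots> = 0" using p by (intro sum.neutral) (auto simp: I_def vanish)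
        finally show ?thesis by (simp add: sum_hom_comp)
      qed
      then show "smul s l \<in> homog 1 \<and> smul s l \<noteq> 0 \<and> (\<forall>p\<in>I. eval_mpoly (lin_coeff (smul s l)) p = 0)"
        using l l0 s by (simp add: homog_smul)
    qed
  qed
  ultimately have "local_scheme_at l I" using hI by (simp add: local_scheme_at_def)
  moreover have "apolar I F"
    unfolding apolar_def
  proof clarify
    fix p assume p: "p \<in> I"
    have "?\<phi> (q * p) = 0" for q
    proof -
      have "hom_comp 3 (q * p) \<in> N" using ideal_mult[OF I_ideal p, of q] by (simp add: I_def)
      then have "\<psi> (hom_comp 3 (q * p)) = 0" by (rule N_\<psi>)
      then show ?thesis using agree[OF hom_comp_homog] pairing_hom_comp[OF F, of "q * p"] by simp
    qed
    then show "contract p F = 0" by (simp add: contract_eq_0_iff)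
  qed
  moreover have "quot_dim (homog d) I 7" if d: "4 \<le> d" for d
  proof (rule quot_dimI[of "{..<7::nat}" 7 "homog d" "\<lambda>s p. \<psi> (p * bs s)"])
    show "linear_form (\<lambda>p. \<psi> (p * bs s))" for s
      using linear_form_mult[OF \<psi>, of "bs s"] by (simp add: mult.commute)
    show "v \<in> I \<longleftrightarrow> (\<forall>s\<in>{..<7}. \<psi> (v * bs s) = 0)" if "v \<in> homog d" for v
      using I_homog[OF that] N_iff by blast
    fix g assume g: "\<forall>v\<in>homog d. (\<Sum>s\<in>{..<7}. g s * \<psi> (v * bs s)) = 0"
    have E: "g 0 * w i j + g 1 * w (i + 1) j + g 2 * w i (j + 1) + g 3 * w (i + 2) j + g 4 * w (i + 1) (j + 1) +
        g 5 * w (i + 3) j + g 6 * w (i + 4) j = 0" if ij: "i + j \<le> 4" for i j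
    proof -
      let ?v = "u 0 ^ (d - i - j) * (?x ^ i * ?y ^ j)"
      have "?v \<in> homog ((d - i - j) * 1 + (i * 1 + j * 1))" by (intro homog_mult homog_power u1)
      then have "?v \<in> homog d" using ij d by simp
      then have sum: "(\<Sum>s\<in>{..<7}. g s * \<psi> (?v * bs s)) = 0" using g by blast
      have expand: "(\<Sum>s\<in>{..<7}. h s) = h 0 + h (Suc 0) + h 2 + h 3 + h 4 + h 5 + h 6" for h :: "nat \<Rightarrow> 'k"
        by (simp add: seven add.assoc)
      have "\<rho> (?v * q) = \<rho> q * (X ^ i * Y ^ j)" for q by (simp add: \<rho>s mult_ac)
      then have v: "\<psi> (?v * q) = pairing (\<rho> q * (X ^ i * Y ^ j)) G" for q by (simp only: \<psi>_def)
      have mon: "1 * (X ^ i * Y ^ j) = X ^ i * Y ^ j" "X ^ n * (X ^ i * Y ^ j) = X ^ (i + n) * Y ^ j" "X * (X ^ i * Y ^ j) = X ^ (i + 1) * Y ^ j"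
        "Y * (X ^ i * Y ^ j) = X ^ i * Y ^ (j + 1)" "X * Y * (X ^ i * Y ^ j) = X ^ (i + 1) * Y ^ (j + 1)" for n
        by (simp_all add: power_add mult_ac)
      show ?thesis using sum unfolding expand bs v \<rho>_simps \<rho>s mon XY One_nat_def .
    qed
    have g0: "g 0 = 0" using E[of 4 0] e0 by (simp add: w4 wz)
    have g1: "g 1 = 0" using E[of 3 0] e0 g0 by (simp add: w4 wz)
    have g2: "g 2 = 0" using E[of 1 1] g0 g1 w12 by (simp add: wz numeral_2_eq_2)
    have g3: "g 3 = 0" using E[of 2 0] e0 g0 g1 g2 by (simp add: w4 wz)
    have g4: "g 4 = 0" using E[of 0 1] g0 g1 g2 g3 w12 by (simp add: wz numeral_2_eq_2)
    have g5: "g 5 = 0" using E[of 1 0] e0 g0 g1 g2 g3 g4 by (simp add: w4 wz)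
    have g6: "g 6 = 0" using E[of 0 0] e0 g0 g1 g2 g3 g4 g5 by (simp add: w4)
    show "\<forall>s\<in>{..<7}. g s = 0" unfolding seven using g0 g1 g2 g3 g4 g5 g6 by simp
  qed (simp_all add: subspace_homog)
  then have "scheme_length I 7" unfolding scheme_length_def by blast
  ultimately show ?thesis by blast
qed

section \<open>The Hessian surface and the existence of cuspidal sections\<close>

lemma singular_matrix_kernel:
  fixes A :: "'k::field^'n^'n"
  assumes "det A = 0"
  shows "\<exists>x. x \<noteq> 0 \<and> A *v x = 0"
  using assms by (metis invertible_det_nz invertible_left_inverse matrix_left_invertible_ker)

text \<open>
  The matrix of the quadratic form \<open>\<Psi>(F)\<close> has entries that are linear in the coefficients of \<open>\<Psi>\<close>, so
  its determinant is a quartic form in them. A common zero of this form and of the equation of the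
  surface gives \<open>\<Psi>\<close>, and the kernel of the matrix contains \<open>\<Phi>\<close>.
\<close>

lemma hessian_meets_cubic:
  fixes F :: "(4, 'k::alg_closed_field) dpoly"
  shows "\<exists>\<Psi>\<in>homog 1. \<exists>\<Phi>\<in>homog 1. \<Psi> \<noteq> 0 \<and> \<Phi> \<noteq> 0 \<and> pairing (\<Psi> ^ 3) F = 0 \<and>
    (\<forall>z\<in>homog 1. pairing (\<Psi> * \<Phi> * z) F = 0)"
proof -
  define f where "f i j k = pairing (var i * var j * var k) F" for i j k :: 4
  define M :: "(4, 'k) mpoly^4^4" where "M = (\<chi> i j. \<Sum>k\<in>UNIV. const (f i j k) * var k)"
  define C where "C = (\<Sum>i\<in>UNIV. \<Sum>j\<in>UNIV. \<Sum>k\<in>UNIV. const (f i j k) * (var i * var j * var k))"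
  have C3: "C \<in> homog (1 + 1 + 1)"
    unfolding C_def by (intro homog_sum homog_const_mult homog_mult homog_var)
  have sgn: "of_int (sign p) = (if evenperm p then 1 else - 1 :: 'b::ring_1)" for p :: "4 \<Rightarrow> 4"
    by (simp add: sign_def)
  have M1: "M $ i $ j \<in> homog 1" for i j
    by (auto simp: M_def intro!: homog_sum homog_const_mult)
  have "det M \<in> homog 4"
    unfolding det_def
  proof (intro homog_sum)
    fix p :: "4 \<Rightarrow> 4"
    have "(\<Prod>i\<in>UNIV. M $ i $ p i) \<in> homog (\<Sum>i\<in>(UNIV :: 4 set). 1)" by (intro homog_prod M1) simp
    then show "of_int (sign p) * (\<Prod>i\<in>UNIV. M $ i $ p i) \<in> homog 4" by (simp add: sgn homog_uminus)
  qed
  with two_forms_common_zero[OF C3 _ this] obtain c where c: "\<exists>i. c i \<noteq> 0" "eval_mpoly c C = 0" "eval_mpoly c (det M) = 0"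
    by auto
  define A :: "'k^4^4" where "A = (\<chi> i j. \<Sum>k\<in>UNIV. f i j k * c k)"
  have A: "eval_mpoly c (M $ i $ j) = A $ i $ j" for i j by (simp add: A_def M_def eval_mpoly_subst)
  have "eval_mpoly c (of_int (sign p) * (\<Prod>i\<in>UNIV. M $ i $ p i)) = of_int (sign p) * (\<Prod>i\<in>UNIV. A $ i $ p i)" for p
    unfolding sgn A[symmetric] by (simp add: eval_mpoly_subst)
  then have "eval_mpoly c (det M) = det A"
    unfolding det_def linear_form_sum[OF linear_form_eval] by simp
  then obtain x where x: "x \<noteq> 0" "A *v x = 0" using c(3) singular_matrix_kernel by metis
  have Ax: "(\<Sum>j\<in>UNIV. (\<Sum>k\<in>UNIV. f i j k * c k) * x $ j) = 0" for i
    using arg_cong[OF x(2), of "\<lambda>v. v $ i"] by (simp add: matrix_vector_mult_def A_def)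
  define \<Psi> where "\<Psi> = (\<Sum>i\<in>UNIV. const (c i) * var i)"
  define \<Phi> where "\<Phi> = (\<Sum>i\<in>UNIV. const (x $ i) * var i)"
  have co: "lin_coeff (\<Sum>i\<in>UNIV. const (a i) * var i) k = a k" for a :: "4 \<Rightarrow> 'k" and k
    by (simp add: lin_coeff_sum if_distrib cong: if_cong)
  have 1: "\<Psi> \<in> homog 1" "\<Phi> \<in> homog 1" by (auto simp: \<Psi>_def \<Phi>_def intro!: homog_sum homog_const_mult)
  have "\<Psi> \<noteq> 0" using c(1) co[of c] by (auto simp flip: \<Psi>_def)
  moreover have "\<Phi> \<noteq> 0"
  proof
    assume "\<Phi> = 0"
    then have "x $ k = 0" for k using co[of "\<lambda>i. x $ i" k] by (simp flip: \<Phi>_def)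
    then show False using x(1) by (simp add: vec_eq_iff)
  qed
  moreover have "pairing (\<Psi> ^ 3) F = 0"
  proof -
    have "\<Psi> ^ 3 = (\<Sum>i\<in>UNIV. \<Sum>j\<in>UNIV. \<Sum>k\<in>UNIV. const (c i * c j * c k) * (var i * var j * var k))"
      unfolding \<Psi>_def power3_eq_cube
      by (simp add: sum_distrib_left sum_distrib_right const_mult mult_ac)
    then have "pairing (\<Psi> ^ 3) F = (\<Sum>i\<in>UNIV. \<Sum>j\<in>UNIV. \<Sum>k\<in>UNIV. c i * c j * c k * f i j k)"
      by (simp only: pairing_simps pairing_const_mult f_def)
    also have "\<dots> = eval_mpoly c C" by (simp add: C_def eval_mpoly_subst mult_ac)
    finally show ?thesis using c(2) by simp
  qed
  moreover have "pairing (\<Psi> * \<Phi> * z) F = 0" if z: "z \<in> homog 1" for z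
  proof -
    have var: "pairing (\<Psi> * \<Phi> * var i) F = 0" for i
    proof -
      have "\<Psi> * \<Phi> * var i = (\<Sum>j\<in>UNIV. \<Sum>k\<in>UNIV. const (c k * x $ j) * (var i * var j * var k))"
        unfolding \<Psi>_def \<Phi>_def by (simp add: sum_distrib_left sum_distrib_right const_mult mult_ac)
      then have "pairing (\<Psi> * \<Phi> * var i) F = (\<Sum>j\<in>UNIV. \<Sum>k\<in>UNIV. c k * x $ j * f i j k)"
        by (simp only: pairing_simps pairing_const_mult f_def)
      also have "\<dots> = (\<Sum>j\<in>UNIV. (\<Sum>k\<in>UNIV. f i j k * c k) * x $ j)"
        by (simp add: sum_distrib_left sum_distrib_right mult_ac)
      finally show ?thesis using Ax by simp
    qed
    have "pairing (\<Psi> * \<Phi> * z) F = pairing (\<Sum>i\<in>UNIV. smul (lin_coeff z i) (\<Psi> * \<Phi> * var i)) F"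
      by (subst homog_1_conv[OF z]) (simp add: sum_distrib_left smul_conv mult.left_commute)
    then show ?thesis by (simp add: pairing_simps var)
  qed
  ultimately show ?thesis using 1 by blast
qed

text \<open>
  Let \<open>l\<close> be the tangent plane at a point \<open>\<Psi>\<close> of the surface and its Hessian. On this plane, the form
  \<open>\<Psi>(F)\<close> has \<open>\<Psi>\<close> and a kernel vector \<open>\<Phi>\<close> in its radical. They are independent, since \<open>\<Psi>\<close> is not in
  the kernel by smoothness. So the rank is at most 1, and it is not 0 as the section is not a cone.
\<close>

lemma exists_cuspidal_section:
  fixes F :: "(4, 'k::{alg_closed_field, field_char_0}) dpoly"
  assumes F: "F \<in> homog 3" and smooth: "smooth_cubic F" and ne: "\<not> eckardt F"
  shows "\<exists>l\<in>homog 1. l \<noteq> 0 \<and> (\<exists>\<Psi>. section_singular_at F l \<Psi> \<and> tangent_cone_square F l \<Psi>)"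
proof -
  obtain \<Psi> \<Phi> where 1: "\<Psi> \<in> homog 1" "\<Phi> \<in> homog 1" and "\<Psi> \<noteq> 0" "\<Phi> \<noteq> 0" and \<Psi>3: "pairing (\<Psi> ^ 3) F = 0"
    and ker: "\<And>z. z \<in> homog 1 \<Longrightarrow> pairing (\<Psi> * \<Phi> * z) F = 0"
    using hessian_meets_cubic[of F] by blast
  define l :: "(4, 'k) dpoly" where "l = (\<Sum>i\<in>UNIV. const (pairing (\<Psi> * \<Psi> * var i) F) * var i)"
  have l1: "l \<in> homog 1" by (auto simp: l_def intro!: homog_sum homog_const_mult)
  have pl: "pairing z l = pairing (\<Psi> * \<Psi> * z) F" if z: "z \<in> homog 1" for z
  proof -
    have co: "lin_coeff l k = pairing (\<Psi> * \<Psi> * var k) F" for k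
      by (simp add: l_def lin_coeff_sum if_distrib cong: if_cong)
    have "pairing (\<Psi> * \<Psi> * z) F = pairing (\<Sum>i\<in>UNIV. smul (lin_coeff z i) (\<Psi> * \<Psi> * var i)) F"
      by (subst homog_1_conv[OF z]) (simp add: sum_distrib_left smul_conv mult.left_commute)
    then show ?thesis unfolding pairing_linear[OF z] co by (simp add: pairing_simps)
  qed
  have "contract (\<Psi> ^ 3) F = 0"
    unfolding contract_eq_0_iff
  proof
    fix q
    have "pairing (\<Psi> ^ 3 * q) F = 0 * pairing q F"
    proof (rule linear_form_eqI[of "\<lambda>q. pairing (\<Psi> ^ 3 * q) F" "\<lambda>q. 0 * pairing q F"])
      show "linear_form (\<lambda>q. pairing (\<Psi> ^ 3 * q) F)" by (rule linear_form_mult[OF linear_form_pairing])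
      show "linear_form (\<lambda>q. 0 * pairing q F)" by (simp add: linear_form_def)
      fix m :: "4 mon"
      have "pairing (\<Psi> ^ 3 * single m 1) F = 0"
      proof (cases "m = 0")
        case False
        have "\<Psi> ^ 3 * single m 1 \<in> homog (3 * 1 + mdeg m)"
          by (intro homog_mult homog_power homog_single 1 refl)
        moreover have "mdeg m \<noteq> 0" using False by (simp add: mdeg_eq_0_iff)
        ultimately show ?thesis using pairing_degree[OF F] by simp
      qed (simp add: \<Psi>3)
      then show "pairing (\<Psi> ^ 3 * single m 1) F = 0 * pairing (single m 1) F" by simp
    qed
    then show "pairing (q * \<Psi> ^ 3) F = 0" by (simp add: mult.commute)
  qed
  then have surface: "\<Psi> \<in> cubic_surface F" using 1 \<open>\<Psi> \<noteq> 0\<close> by (simp add: cubic_surface_def)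
  then obtain v where v: "v \<in> homog 1" "taylor_part 1 F \<Psi> v \<noteq> 0" using smooth by (auto simp: smooth_cubic_def)
  then have vl: "pairing v l \<noteq> 0" by (simp add: pl[OF v(1)] taylor_part_def power2_eq_square)
  then have l0: "l \<noteq> 0" using pairing_linear[OF v(1), of 0] by auto
  have \<Psi>l: "pairing \<Psi> l = 0" using \<Psi>3 by (simp add: pl[OF 1(1)] power3_eq_cube)
  have \<Phi>l: "pairing \<Phi> l = 0" using ker[OF 1(1)] by (simp add: pl[OF 1(2)] mult_ac)
  have ker': "pairing (\<Psi> * \<Psi> * z) F = 0" if "z \<in> plane l" for z using that pl[of z] by (simp add: plane_def)
  have sym: "pairing (\<Psi> * x * y) F = pairing (\<Psi> * y * x) F" for x y by (simp add: mult_ac)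
  \<comment> \<open>Off the Eckardt case the tangent cone does not vanish identically.\<close>
  have "\<exists>\<theta>\<in>plane l. pairing (\<Psi> * \<theta> * \<theta>) F \<noteq> 0"
  proof (rule ccontr)
    assume "\<not> ?thesis"
    then have z2: "pairing (\<Psi> * z * z) F = 0" if "z \<in> plane l" for z using that by blast
    have "pairing (\<Psi> * z * z') F = 0" if "z \<in> plane l" "z' \<in> plane l" for z z'
    proof -
      have "z + z' \<in> plane l" using that by (auto simp: plane_def pairing_simps intro: homog_add)
      moreover have "const 2 = (2 :: (4, 'k) mpoly)" using const_add[of 1 "1 :: 'k"] by simp
      then have "\<Psi> * (z + z') * (z + z') = \<Psi> * z * z + const 2 * (\<Psi> * z * z') + \<Psi> * z' * z'"
        by (simp add: algebra_simps)
      ultimately have "2 * pairing (\<Psi> * z * z') F = 0"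
        using z2[of "z + z'"] z2[OF that(1)] z2[OF that(2)] by (simp only: pairing_simps pairing_const_mult) simp
      then show ?thesis by simp
    qed
    then have "eckardt F" unfolding eckardt_def using 1 \<open>\<Psi> \<noteq> 0\<close> l1 l0 \<Psi>l by blast
    then show False using ne by simp
  qed
  then obtain \<theta> where \<theta>: "\<theta> \<in> plane l" "pairing (\<Psi> * \<theta> * \<theta>) F \<noteq> 0" by blast
  define \<kappa> where "\<kappa> = pairing (\<Psi> * \<theta> * \<theta>) F"
  have \<kappa>: "\<kappa> \<noteq> 0" using \<theta> by (simp add: \<kappa>_def)
  \<comment> \<open>The factor 3 is the one of \<open>taylor_part 2\<close>.\<close>
  obtain s where s: "s ^ 2 = 3 * \<kappa>" using nth_root_exists[of 2 "3 * \<kappa>"] by auto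
  define m :: "(4, 'k) dpoly" where "m = (\<Sum>i\<in>UNIV. const (s / \<kappa> * pairing (\<Psi> * \<theta> * var i) F) * var i)"
  have m1: "m \<in> homog 1" by (auto simp: m_def intro!: homog_sum homog_const_mult)
  have pm: "pairing z m = s / \<kappa> * pairing (\<Psi> * \<theta> * z) F" if z: "z \<in> homog 1" for z
  proof -
    have co: "lin_coeff m k = s / \<kappa> * pairing (\<Psi> * \<theta> * var k) F" for k
      by (simp add: m_def lin_coeff_sum if_distrib cong: if_cong)
    have "pairing (\<Psi> * \<theta> * z) F = pairing (\<Sum>i\<in>UNIV. smul (lin_coeff z i) (\<Psi> * \<theta> * var i)) F"
      by (subst homog_1_conv[OF z]) (simp add: sum_distrib_left smul_conv mult.left_commute)
    then show ?thesis unfolding pairing_linear[OF z] co by (simp add: pairing_simps sum_distrib_left mult_ac)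
  qed
  have square: "pairing (\<Psi> * z * z) F * \<kappa> = (pairing (\<Psi> * \<theta> * z) F)\<^sup>2" if z: "z \<in> plane l" for z
  proof -
    define \<tau> where "\<tau> = pairing (\<Psi> * \<theta> * z) F / \<kappa>"
    have \<tau>: "pairing (\<Psi> * \<theta> * z) F = \<tau> * \<kappa>" using \<kappa> by (simp add: \<tau>_def)
    define z' where "z' = z - const \<tau> * \<theta>"
    have z': "z' \<in> homog 1" "pairing z' l = 0"
      using z \<theta>(1) by (auto simp: z'_def plane_def pairing_simps intro: homog_diff homog_const_mult)
    have \<theta>z': "pairing (\<Psi> * \<theta> * z') F = 0"
    proof -
      have "\<Psi> * \<theta> * z' = \<Psi> * \<theta> * z - const \<tau> * (\<Psi> * \<theta> * \<theta>)" by (simp add: z'_def algebra_simps)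
      then show ?thesis by (simp only: pairing_simps pairing_const_mult \<tau> \<kappa>_def) simp
    qed
    define u where "u j = (if j = 0 then \<Psi> else if j = 1 then \<Phi> else if j = 2 then \<theta> else z')" for j :: 4
    have u: "u 0 = \<Psi>" "u 1 = \<Phi>" "u 2 = \<theta>" "u 3 = z'" by (simp_all add: u_def)
    have u1: "u j \<in> homog 1" and ul: "pairing (u j) l = 0" for j
      using 1 \<Psi>l \<Phi>l z' \<theta>(1) by (auto simp: u_def plane_def)
    \<comment> \<open>Four vectors in the three-dimensional space of forms vanishing at \<open>l\<close>.\<close>
    have "\<exists>a. (\<Sum>j\<in>UNIV. const (a j) * u j) = 0 \<and> (\<exists>j. a j \<noteq> 0)"
    proof (rule ccontr)
      assume "\<not> ?thesis"
      then have "\<And>a. (\<Sum>j\<in>UNIV. const (a j) * u j) = 0 \<Longrightarrow> \<forall>j. a j = 0" by blast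
      from four_linear_forms_basis[of u, OF u1 this] obtain B where
        B: "\<And>i. var i = (\<Sum>j\<in>UNIV. const (lin_coeff (B j) i) * u j)" by blast
      have "lin_coeff l i = 0" for i
        using B[of i] pairing_var[of i l] by (simp add: pairing_simps ul)
      then have "l = 0" using homog_1_eqI[OF l1 homog_0] by simp
      then show False using l0 by simp
    qed
    then obtain a where a: "(\<Sum>j\<in>UNIV. const (a j) * u j) = 0" "\<exists>j. a j \<noteq> 0" by blast
    have rel: "const (a 0) * \<Psi> + const (a 1) * \<Phi> + const (a 2) * \<theta> + const (a 3) * z' = 0"
      using a(1) by (simp add: sum_4_eq u add.assoc)
    have T: "a 2 * pairing (\<Psi> * \<theta> * y) F + a 3 * pairing (\<Psi> * z' * y) F = 0" if y: "y \<in> plane l" for y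
    proof -
      have "\<Psi> * (const (a 0) * \<Psi> + const (a 1) * \<Phi> + const (a 2) * \<theta> + const (a 3) * z') * y =
          const (a 0) * (\<Psi> * \<Psi> * y) + const (a 1) * (\<Psi> * \<Phi> * y) + const (a 2) * (\<Psi> * \<theta> * y) + const (a 3) * (\<Psi> * z' * y)"
        by (simp add: algebra_simps)
      then have "pairing (const (a 0) * (\<Psi> * \<Psi> * y) + const (a 1) * (\<Psi> * \<Phi> * y) + const (a 2) * (\<Psi> * \<theta> * y) +
          const (a 3) * (\<Psi> * z' * y)) F = 0" using rel by (simp add: pairing_simps)
      moreover have "pairing (\<Psi> * \<Phi> * y) F = 0" using y ker by (simp add: plane_def)
      ultimately show ?thesis using ker'[OF y] by (simp only: pairing_simps pairing_const_mult) simp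
    qed
    have a2: "a 2 = 0"
      using T[OF \<theta>(1)] \<theta>z' \<kappa> sym[of z' \<theta>] by (simp add: \<kappa>_def)
    have "a 3 \<noteq> 0"
    proof
      assume a3: "a 3 = 0"
      then have r: "const (a 0) * \<Psi> + const (a 1) * \<Phi> = 0" using rel a2 by simp
      have "a 0 * pairing v l = pairing (\<Psi> * v * (const (a 0) * \<Psi> + const (a 1) * \<Phi>)) F"
      proof -
        have "\<Psi> * v * (const (a 0) * \<Psi> + const (a 1) * \<Phi>) = const (a 0) * (\<Psi> * \<Psi> * v) + const (a 1) * (\<Psi> * \<Phi> * v)"
          by (simp add: algebra_simps)
        then show ?thesis using ker[OF v(1)] pl[OF v(1)] by (simp only: pairing_simps pairing_const_mult) simp
      qed
      then have a0: "a 0 = 0" using r vl by (simp add: pairing_simps)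
      then have "smul (a 1) \<Phi> = 0" using r by (simp add: smul_conv)
      then have a1: "a 1 = 0" using \<open>\<Phi> \<noteq> 0\<close> by (simp add: K_space.scale_eq_0_iff)
      have "j = 0 \<or> j = 1 \<or> j = 2 \<or> j = 3" for j :: 4 using UNIV_4_eq by blast
      then have "a j = 0" for j using a0 a1 a2 a3 by metis
      then show False using a(2) by blast
    qed
    then have "pairing (\<Psi> * z' * z') F = 0" using T[of z'] z' a2 by (simp add: plane_def)
    moreover have "\<Psi> * z * z = \<Psi> * z' * z' + const (2 * \<tau>) * (\<Psi> * \<theta> * z') + const (\<tau> * \<tau>) * (\<Psi> * \<theta> * \<theta>)"
    proof -
      have eq: "z = z' + const \<tau> * \<theta>" by (simp add: z'_def)
      show ?thesis unfolding mult_2 const_add const_mult eq by algebra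
    qed
    ultimately have "pairing (\<Psi> * z * z) F = \<tau> * \<tau> * \<kappa>"
      by (simp only: pairing_simps pairing_const_mult \<theta>z' \<kappa>_def) simp
    then show ?thesis by (simp add: \<tau> power2_eq_square)
  qed
  have "section_singular_at F l \<Psi>"
    using surface 1 \<Psi>l ker' by (auto simp: section_singular_at_def plane_def taylor_part_def power2_eq_square)
  moreover have "tangent_cone_square F l \<Psi>"
    unfolding tangent_cone_square_def
  proof (rule bexI[OF _ m1], intro conjI ballI)
    have "s \<noteq> 0" using s \<kappa> by auto
    then show "\<exists>\<Phi>\<in>plane l. pairing \<Phi> m \<noteq> 0"
      using \<theta> \<kappa> by (intro bexI[of _ \<theta>]) (auto simp: pm plane_def)
  next
    fix z assume z: "z \<in> plane l"
    have "taylor_part 2 F \<Psi> z = 3 * pairing (\<Psi> * z * z) F"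
      by (simp add: taylor_part_def power2_eq_square mult.assoc eval_nat_numeral)
    also have "\<dots> = (pairing z m)\<^sup>2"
    proof -
      have "(pairing z m)\<^sup>2 = s ^ 2 / \<kappa>\<^sup>2 * (pairing (\<Psi> * z * z) F * \<kappa>)"
        using z by (simp add: pm plane_def power_mult_distrib power_divide flip: square)
      then show ?thesis unfolding s using \<kappa> by (simp add: power2_eq_square)
    qed
    finally show "taylor_part 2 F \<Psi> z = (pairing z m)\<^sup>2" .
  qed
  ultimately show ?thesis using l1 l0 by blast
qed

section \<open>The local cactus rank\<close>

theorem proposition36:
  shows "\<exists>U :: (4, 'k::{alg_closed_field, field_char_0}) dpoly set.
    zariski_open_forms 3 U \<and> U \<noteq> {} \<and>
    (\<forall>F\<in>U. smooth_cubic F \<longrightarrow>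
       local_cactus_rank F = 7 \<and>
       (\<forall>l\<in>homog 1. l \<noteq> 0 \<longrightarrow>
          (\<forall>B. linear_basis B \<and> B 0 = l \<longrightarrow> affine_apolar_length (dehomogenize B F) 8) \<and>
          ((\<exists>\<Psi>. section_singular_at F l \<Psi> \<and> tangent_cone_square F l \<Psi>) \<longrightarrow>
             (\<exists>I. local_scheme_at l I \<and> scheme_length I 7 \<and> apolar I F))))"
proof -
  obtain U :: "(4, 'k) dpoly set" where U: "zariski_open_forms 3 U" "U \<noteq> {}"
    and gen: "\<And>F. F \<in> U \<Longrightarrow> \<not> eckardt F \<and> \<not> curvilinear F"
    using generic_not_eckardt_nor_curvilinear by blast
  have "local_cactus_rank F = 7 \<and>
       (\<forall>l\<in>homog 1. l \<noteq> 0 \<longrightarrow>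
          (\<forall>B. linear_basis B \<and> B 0 = l \<longrightarrow> affine_apolar_length (dehomogenize B F) 8) \<and>
          ((\<exists>\<Psi>. section_singular_at F l \<Psi> \<and> tangent_cone_square F l \<Psi>) \<longrightarrow>
             (\<exists>I. local_scheme_at l I \<and> scheme_length I 7 \<and> apolar I F)))"
    if FU: "F \<in> U" and smooth: "smooth_cubic F" for F
  proof -
    have F: "F \<in> homog 3" using smooth by (simp add: smooth_cubic_def)
    have ne: "\<not> eckardt F" and nc: "\<not> curvilinear F" using gen[OF FU] by auto
    have seven: "\<exists>I. local_scheme_at l I \<and> scheme_length I 7 \<and> apolar I F"
      if l: "l \<in> homog 1" "l \<noteq> 0" and sec: "section_singular_at F l \<Psi>" "tangent_cone_square F l \<Psi>" for l \<Psi>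
    proof -
      obtain u B where "\<forall>j. u j \<in> homog 1" "\<forall>j k. pairing (u j) (B k) = (if j = k then 1 else 0)"
        "\<forall>i. var i = (\<Sum>j\<in>UNIV. const (lin_coeff (B j) i) * u j)" "\<forall>j. pairing (u j) l = (if j = 0 then 1 else 0)"
        "cuspidal_frame F u"
        using exists_cuspidal_frame[OF F smooth ne l sec] by blast
      then show ?thesis by (intro cuspidal_frame_apolar_scheme[OF F, of u B l] l(1)) auto
    qed
    have "local_cactus_rank F = 7"
      unfolding local_cactus_rank_def
    proof (rule Least_equality)
      show "\<exists>l\<in>homog 1. l \<noteq> 0 \<and> (\<exists>I. local_scheme_at l I \<and> scheme_length I 7 \<and> apolar I F)"
        using exists_cuspidal_section[OF F smooth ne] seven by blast
      fix r assume "\<exists>l\<in>homog 1. l \<noteq> 0 \<and> (\<exists>I. local_scheme_at l I \<and> scheme_length I r \<and> apolar I F)"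
      then show "7 \<le> r"
        using short_local_apolar_scheme_curvilinear[OF _ _ _ _ _ _ F ne] nc by (metis not_le)
    qed
    then show ?thesis using seven dehomogenization_apolar_length[OF F ne] by blast
  qed
  then show ?thesis using U by blast
qed

end
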